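(* Let $s\ge r\ge 0$ and let $F$ be the $2$-regular graph whose cycles are: one cycle of length $h$, one cycle of length $2\ell_i$ for each $1\le i\le r$, and two cycles of length $\ell_j$ for each $r+1\le j\le s$, where $2\le \ell_1<\ell_2<\dots<\ell_r$ and $h,\ell_{r+1},\ell_{r+2},\dots,\ell_s\ge 3$. Let $v$ be the order of $F$ and let $I=\{i \mid 1\le i\le s,\ \ell_i>2 \text{ and } \ell_i \text{ is even}\}$. Put \[h_0=2|I|\max\{\ell_i+3\mid i\in I\}-1,\qquad h_1=7^{\,s-|I|-1}\max\{2\ell_i+1\mid i\notin I,\ 1\le i\le s,\ \ell_i\neq 2\}.\] If $h>16\max(1,h_0)+20\max(3,h_1)+29$, then for every $\sigma\in\{-1,0,1\}$ with $v-1\equiv\sigma\pmod 2$, the problem $OP^\sigma(F)$ has a $(1-\sigma)$-pyramidal solution.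
   Context: The maximum of an empty set of integers is taken to be $0$. For $\sigma\in\{-1,0,1\}$ with $v-1\equiv \sigma \pmod 2$, let $(K_v)^\sigma$ denote $K_v-I'$ if $\sigma=-1$, $K_v$ if $\sigma=0$, and $K_v+I'$ if $\sigma=1$, where $I'$ is a $1$-factor (perfect matching) of $K_v$ and $K_v+I'$ is the multigraph obtained from $K_v$ by doubling the edges of $I'$. A solution to $OP^\sigma(F)$ is an $F$-factorization of $(K_v)^\sigma$ (for some $1$-factor $I'$), i.e. a collection of spanning subgraphs, each isomorphic to $F$, whose edge multisets partition the edge multiset of $(K_v)^\sigma$. A solution is $f$-pyramidal if it admits a group $G$ of automorphisms (vertex permutations mapping each factor of the factorization onto a factor of it) which fixes exactly $f$ vertices and acts sharply transitively on the remaining vertices. *)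

theory Defs
  imports Complex_Main "HOL-Library.Multiset" "HOL-Number_Theory.Cong" "HOL-Algebra.Bij"
begin

text \<open>Simple graphs: an edge is the two-element set of its endpoints.\<close>

record 'a ugraph =
  verts :: "'a set"
  edges :: "'a set set"

definition complete_edges :: "'a set \<Rightarrow> 'a set set" where
  "complete_edges V = {e. e \<subseteq> V \<and> card e = 2}"

definition simple_graph :: "'a ugraph \<Rightarrow> bool" where
  "simple_graph H \<longleftrightarrow> finite (verts H) \<and> edges H \<subseteq> complete_edges (verts H)"

definition graph_iso :: "'a ugraph \<Rightarrow> 'b ugraph \<Rightarrow> bool" where
  "graph_iso H F \<longleftrightarrow>
     (\<exists>\<phi>. bij_betw \<phi> (verts H) (verts F) \<and> (`) \<phi> ` edges H = edges F)"

definition graph_image :: "('a \<Rightarrow> 'b) \<Rightarrow> 'a ugraph \<Rightarrow> 'b ugraph" where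
  "graph_image g H = \<lparr>verts = g ` verts H, edges = (`) g ` edges H\<rparr>"

text \<open>The disjoint union of cycles of the lengths listed in \<open>cs\<close> (all at least 3): the vertex
  \<open>(i, j)\<close> is the \<open>j\<close>-th vertex of the \<open>i\<close>-th cycle.\<close>

definition cycles_graph :: "nat list \<Rightarrow> (nat \<times> nat) ugraph" where
  "cycles_graph cs =
     \<lparr>verts = {(i, j). i < length cs \<and> j < cs ! i},
      edges = {{(i, j), (i, Suc j mod cs ! i)} | i j. i < length cs \<and> j < cs ! i}\<rparr>"

definition one_factor :: "'a set \<Rightarrow> 'a set set \<Rightarrow> bool" where
  "one_factor V J \<longleftrightarrow> J \<subseteq> complete_edges V \<and> (\<forall>x\<in>V. \<exists>!e. e \<in> J \<and> x \<in> e)"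

text \<open>\<open>M\<close> is the edge multiset of \<open>(K\<^sub>V)\<^sup>\<sigma>\<close>, for some choice of the 1-factor when \<open>\<sigma> \<noteq> 0\<close>.\<close>

definition K_sigma_edges :: "'a set \<Rightarrow> int \<Rightarrow> 'a set multiset \<Rightarrow> bool" where
  "K_sigma_edges V \<sigma> M \<longleftrightarrow>
     (\<sigma> = 0 \<and> M = mset_set (complete_edges V)) \<or>
     (\<sigma> = -1 \<and> (\<exists>J. one_factor V J \<and> M = mset_set (complete_edges V) - mset_set J)) \<or>
     (\<sigma> = 1 \<and> (\<exists>J. one_factor V J \<and> M = mset_set (complete_edges V) + mset_set J))"

definition factorization ::
    "'b ugraph \<Rightarrow> 'a set \<Rightarrow> 'a set multiset \<Rightarrow> 'a ugraph multiset \<Rightarrow> bool" where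
  "factorization F V M \<F> \<longleftrightarrow>
     (\<forall>H \<in># \<F>. verts H = V \<and> edges H \<subseteq> set_mset M \<and> graph_iso H F) \<and>
     (\<Sum>H \<in># \<F>. mset_set (edges H)) = M"

definition OP_solution ::
    "int \<Rightarrow> 'b ugraph \<Rightarrow> 'a set \<Rightarrow> 'a ugraph multiset \<Rightarrow> bool" where
  "OP_solution \<sigma> F V \<F> \<longleftrightarrow> (\<exists>M. K_sigma_edges V \<sigma> M \<and> factorization F V M \<F>)"

definition fixed_points :: "'a set \<Rightarrow> ('a \<Rightarrow> 'a) set \<Rightarrow> 'a set" where
  "fixed_points V G = {x \<in> V. \<forall>g\<in>G. g x = x}"

definition pyramidal :: "nat \<Rightarrow> 'a set \<Rightarrow> 'a ugraph multiset \<Rightarrow> bool" where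
  "pyramidal f V \<F> \<longleftrightarrow>
     (\<exists>G. subgroup G (BijGroup V) \<and>
        (\<forall>g\<in>G. \<forall>H \<in># \<F>. graph_image g H \<in># \<F>) \<and>
        card (fixed_points V G) = f \<and>
        (\<forall>x \<in> V - fixed_points V G. \<forall>y \<in> V - fixed_points V G. \<exists>!g. g \<in> G \<and> g x = y))"

definition max0 :: "nat set \<Rightarrow> nat" where
  "max0 A = (if A = {} then 0 else Max A)"

definition F_lengths :: "nat \<Rightarrow> nat \<Rightarrow> nat \<Rightarrow> (nat \<Rightarrow> nat) \<Rightarrow> nat list" where
  "F_lengths h r s l =
     h # map (\<lambda>i. 2 * l i) [1..<Suc r] @ concat (map (\<lambda>j. [l j, l j]) [Suc r..<Suc s])"

lemma simple_cycles_graph: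
  assumes "\<And>c. c \<in> set cs \<Longrightarrow> 3 \<le> c"
  shows "simple_graph (cycles_graph cs)"
proof -
  have eq: "verts (cycles_graph cs) = (SIGMA i:{..<length cs}. {..<cs ! i})"
    by (auto simp: cycles_graph_def)
  have ne: "Suc j mod cs ! i \<noteq> j" if "i < length cs" "j < cs ! i" for i j
    using assms[of "cs ! i"] that by (cases "Suc j = cs ! i") auto
  have "Suc j mod cs ! i < cs ! i" if "i < length cs" "j < cs ! i" for i j
    using that by (intro mod_less_divisor) auto
  with ne have "{(i, j), (i, Suc j mod cs ! i)} \<in> complete_edges (verts (cycles_graph cs))"
    if "i < length cs" "j < cs ! i" for i j
    using that ne[OF that, symmetric] by (auto simp: complete_edges_def cycles_graph_def)
  hence "edges (cycles_graph cs) \<subseteq> complete_edges (verts (cycles_graph cs))"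
    unfolding cycles_graph_def by auto
  thus ?thesis by (simp add: simple_graph_def eq)
qed

lemma cycles_graph_2_regular:
  assumes "\<And>c. c \<in> set cs \<Longrightarrow> 3 \<le> c" "x \<in> verts (cycles_graph cs)"
  shows "card {e \<in> edges (cycles_graph cs). x \<in> e} = 2"
proof -
  obtain i j where x: "x = (i, j)" and i: "i < length cs" and j: "j < cs ! i"
    using assms(2) by (auto simp: cycles_graph_def)
  define n where "n = cs ! i"
  have n: "3 \<le> n" using assms(1) i by (auto simp: n_def)
  define p where "p = (if j = 0 then n - 1 else j - 1)"
  have p: "p < n" "Suc p mod n = j" using n j by (auto simp: p_def n_def)
  have uniq: "k = p" if "k < n" "Suc k mod n = j" for k
    using that n by (cases "Suc k = n") (auto simp: p_def)
  have "{e \<in> edges (cycles_graph cs). x \<in> e} = {{(i, j), (i, Suc j mod n)}, {(i, p), (i, j)}}"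
  proof (intro equalityI subsetI)
    fix e assume "e \<in> {e \<in> edges (cycles_graph cs). x \<in> e}"
    then obtain i' k where k: "e = {(i', k), (i', Suc k mod cs ! i')}" "k < cs ! i'" "(i, j) \<in> e"
      unfolding cycles_graph_def x by auto
    hence [simp]: "i' = i" by auto
    have "j = k \<or> Suc k mod n = j" using k by (auto simp: n_def)
    thus "e \<in> {{(i, j), (i, Suc j mod n)}, {(i, p), (i, j)}}"
      using k uniq[of k] by (auto simp: n_def)
  next
    fix e assume "e \<in> {{(i, j), (i, Suc j mod n)}, {(i, p), (i, j)}}"
    then consider "e = {(i, j), (i, Suc j mod n)}" | "e = {(i, p), (i, Suc p mod n)}"
      using p by auto
    thus "e \<in> {e \<in> edges (cycles_graph cs). x \<in> e}"
    proof cases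
      case 1 thus ?thesis unfolding cycles_graph_def x n_def using i j by auto
    next
      case 2 
      moreover have "x \<in> e" using 2 p x by simp
      ultimately show ?thesis unfolding cycles_graph_def using i p by (auto simp: n_def)
    qed
  qed
  moreover have "Suc j mod n \<noteq> p"
    using n j by (cases "Suc j = n") (auto simp: p_def n_def)
  moreover have "Suc j mod n \<noteq> j"
    using n j by (cases "Suc j = n") (auto simp: n_def)
  ultimately show ?thesis by (auto simp: doubleton_eq_iff)
qed

lemma card_verts_cycles_graph: "card (verts (cycles_graph cs)) = sum_list cs"
proof -
  have "verts (cycles_graph cs) = (SIGMA i:{..<length cs}. {..<cs ! i})"
    by (auto simp: cycles_graph_def)
  thus ?thesis by (simp add: sum_list_sum_nth atLeast0LessThan)
qed

end

theory Submission
  imports Defs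
begin

text \<open>
  Let \<open>2 * n\<close> be the number of vertices moved by the group. They are identified with the integers modulo \<open>2 * n\<close>,
  and the factors are the translates by \<open>0, ..., n - 1\<close> of a single factor that is invariant under translation
  by \<open>n\<close>. Such a factor arises from a path and cycles that are disjointly labelled by \<open>0, ..., n - 1\<close>: the long
  cycle consists of a lift of the path and its translate by \<open>n\<close>, joined through the fixed vertices or by edges of
  difference \<open>n\<close>, while a cycle of length \<open>l\<close> lifts to two cycles of length \<open>l\<close> or, with its closing edge twisted
  by \<open>n\<close>, to one of length \<open>2 * l\<close>. If all differences are realised, the translates cover all edges, and
  by counting they partition them. A twisted closing edge realises \<open>n - d\<close> instead of \<open>d\<close>; twisting the path edge of
  distance \<open>n - d\<close> as well compensates for this.

  It remains to label a path and short cycles so that all distances \<open>1, ..., n - 1\<close> occur. Starting from a graceful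
  labeling of a path, the odd cycles are added one by one, each multiplying the size by a constant; then the
  even cycles are added by alpha-labelings placed around the labels used so far; the long path absorbs the rest.
\<close>

section \<open>Zigzag paths\<close>

text \<open>Three obstacles shape the labelling. (1) The twist needs \<open>n - d\<close> on the
  path, so no two cycle distances may add up to \<open>n\<close>. Without a cycle of length 2 this
  is achieved by keeping all cycle distances below \<open>n / 2\<close>, one reason why
  \<open>h\<close> must be large. A cycle of length 2 lifts to a 4-cycle that realises both
  \<open>d\<close> and \<open>n - d\<close>; the second distance is therefore left out of the
  labelling, and the parity of \<open>n\<close> decides whether \<open>n - 2 * d\<close> is 1 or 2.
  (2) Pieces of the path are glued at prescribed ends. A path that fills \<open>2 * p + 1\<close>
  labels joins the upper labels \<open>i\<close> and \<open>p - i\<close>, so for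
  \<open>p > 0\<close> the start \<open>i = p / 2\<close> is impossible. Excluded sizes such as
  \<open>s \<noteq> 4 * t + 1\<close> avoid exactly this case. (3) An odd cycle is not bipartite,
  hence has no alpha-labeling and cannot simply be put around a smaller labelling. It is added
  together with new path vertices, in number proportional to the old size; 7 is a rounded-up bound
  for the resulting growth factor.\<close>

definition steps :: "'a list \<Rightarrow> ('a \<times> 'a) set" where
  "steps xs = set (zip xs (tl xs))"

lemma steps_Nil [simp]: "steps [] = {}" and steps_single [simp]: "steps [x] = {}"
  and steps_Cons2 [simp]: "steps (x # y # xs) = insert (x, y) (steps (y # xs))"
  by (auto simp: steps_def)

lemma steps_Cons: "xs \<noteq> [] \<Longrightarrow> steps (x # xs) = insert (x, hd xs) (steps xs)"
  by (cases xs) auto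

lemma steps_append:
  "xs \<noteq> [] \<Longrightarrow> ys \<noteq> [] \<Longrightarrow> steps (xs @ ys) = steps xs \<union> {(last xs, hd ys)} \<union> steps ys"
  by (induction xs rule: induct_list012) (auto simp: steps_Cons)

lemma steps_map: "steps (map f xs) = map_prod f f ` steps xs"
  by (simp add: steps_def zip_map_map map_tl[symmetric] map_prod_def)

lemma steps_rev: "steps (rev xs) = prod.swap ` steps xs"
proof (induction xs)
  case (Cons x xs)
  then show ?case
    by (cases "xs = []") (auto simp: steps_append steps_Cons last_rev)
qed auto

lemma steps_subset: "(x, y) \<in> steps xs \<Longrightarrow> x \<in> set xs \<and> y \<in> set xs"
  unfolding steps_def by (metis in_set_zipE list.set_sel(2) tl_Nil)

text \<open>The list is \<open>x, y, x - s, y + s, x - 2 * s, ...\<close>: both sides move by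
  \<open>s\<close> in opposite directions, so for \<open>s = 1\<close> or \<open>s = -1\<close>
  successive distances run through an interval as long as \<open>x - y\<close> does not change
  sign.\<close>

primrec zigzag :: "nat \<Rightarrow> int \<Rightarrow> int \<Rightarrow> int \<Rightarrow> int list" where
  "zigzag 0 x y s = []"
| "zigzag (Suc n) x y s = x # zigzag n y (x - s) (- s)"

lemma length_zigzag [simp]: "length (zigzag n x y s) = n"
  by (induction n arbitrary: x y s) auto

lemma zigzag_eq_Nil [simp]: "zigzag n x y s = [] \<longleftrightarrow> n = 0"
  by (cases n) auto

lemma hd_zigzag [simp]: "n > 0 \<Longrightarrow> hd (zigzag n x y s) = x"
  by (cases n) auto

lemma last_zigzag_even [simp]: "m > 0 \<Longrightarrow> last (zigzag (2 * m) x y s) = y + s * (int m - 1)"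
proof (induction m arbitrary: x y)
  case (Suc m)
  show ?case
  proof (cases "m = 0")
    case False
    have "last (zigzag (2 * Suc m) x y s) = last (zigzag (2 * m) (x - s) (y + s) s)"
      using False by simp
    also have "\<dots> = y + s * (int (Suc m) - 1)"
      using Suc.IH[of "x - s" "y + s"] False by (simp only:) (simp add: algebra_simps)
    finally show ?thesis .
  qed (simp add: numeral_2_eq_2)
qed auto

lemma last_zigzag_odd [simp]: "last (zigzag (Suc (2 * m)) x y s) = x - s * int m"
proof (induction m arbitrary: x y)
  case (Suc m)
  have "last (zigzag (Suc (2 * Suc m)) x y s) = last (zigzag (Suc (2 * m)) (x - s) (y + s) s)"
    by simp
  then show ?case unfolding Suc.IH by (simp add: algebra_simps)
qed auto

lemma set_zigzag_even [simp]:
  "set (zigzag (2 * m) x y 1) = {x - int m + 1..x} \<union> {y..y + int m - 1}"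
  "set (zigzag (2 * m) x y (-1)) = {x..x + int m - 1} \<union> {y - int m + 1..y}"
  by (induction m arbitrary: x y) auto

lemma set_zigzag_odd [simp]:
  "set (zigzag (Suc (2 * m)) x y 1) = {x - int m..x} \<union> {y..y + int m - 1}"
  "set (zigzag (Suc (2 * m)) x y (-1)) = {x..x + int m} \<union> {y - int m + 1..y}"
  by (induction m arbitrary: x y) auto

definition dist_steps :: "(int \<times> int) set \<Rightarrow> int set" where
  "dist_steps S = (\<lambda>(x, y). \<bar>x - y\<bar>) ` S"

lemma dist_steps_simps [simp]:
  "dist_steps {} = {}" "dist_steps (insert (x, y) S) = insert \<bar>x - y\<bar> (dist_steps S)"
  "dist_steps (S \<union> S') = dist_steps S \<union> dist_steps S'"
  by (auto simp: dist_steps_def)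

lemma dist_steps_zigzag:
  "dist_steps (steps (zigzag n x y s)) = {\<bar>x - y - s * k\<bar> | k. 0 \<le> k \<and> k < int n - 1}"
proof (induction n arbitrary: x y s)
  case (Suc n)
  show ?case
  proof (cases "n = 0")
    case False
    have "dist_steps (steps (zigzag (Suc n) x y s))
        = insert \<bar>x - y\<bar> {\<bar>y - (x - s) + s * k\<bar> | k. 0 \<le> k \<and> k < int n - 1}"
      using False by (simp add: steps_Cons Suc.IH)
    also have "\<dots> = {\<bar>x - y - s * k\<bar> | k. 0 \<le> k \<and> k < int (Suc n) - 1}"
    proof (intro Set.set_eqI iffI)
      fix d assume "d \<in> insert \<bar>x - y\<bar> {\<bar>y - (x - s) + s * k\<bar> | k. 0 \<le> k \<and> k < int n - 1}"
      then consider "d = \<bar>x - y\<bar>" | k where "d = \<bar>y - (x - s) + s * k\<bar>" "0 \<le> k" "k < int n - 1" by auto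
      then show "d \<in> {\<bar>x - y - s * k\<bar> | k. 0 \<le> k \<and> k < int (Suc n) - 1}"
      proof cases
        case 1 then show ?thesis using False by (auto intro!: exI[of _ 0])
      next
        case 2 then show ?thesis by (intro CollectI exI[of _ "k + 1"]) (auto simp: algebra_simps abs_minus_commute)
      qed
    next
      fix d assume "d \<in> {\<bar>x - y - s * k\<bar> | k. 0 \<le> k \<and> k < int (Suc n) - 1}"
      then obtain k where k: "d = \<bar>x - y - s * k\<bar>" "0 \<le> k" "k < int n" by auto
      show "d \<in> insert \<bar>x - y\<bar> {\<bar>y - (x - s) + s * k\<bar> | k. 0 \<le> k \<and> k < int n - 1}"
      proof (cases "k = 0")
        case False
        then show ?thesis using k
          by (intro insertI2 CollectI exI[of _ "k - 1"]) (auto simp: algebra_simps abs_minus_commute)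
      qed (use k in auto)
    qed
    finally show ?thesis .
  qed auto
qed auto

text \<open>The first two cases contract, and the length bound keeps the two sides from crossing;
  the last two expand. In the proof, \<open>g\<close> recovers the position of a step from its
  distance.\<close>

lemma dist_steps_zigzag_in [simp]:
  assumes "n > 0"
  shows "x - y \<ge> int n - 2 \<Longrightarrow> dist_steps (steps (zigzag n x y 1)) = {x - y - int n + 2..x - y}"
    and "y - x \<ge> int n - 2 \<Longrightarrow> dist_steps (steps (zigzag n x y (-1))) = {y - x - int n + 2..y - x}"
    and "x \<ge> y \<Longrightarrow> dist_steps (steps (zigzag n x y (-1))) = {x - y..x - y + int n - 2}"
    and "y \<ge> x \<Longrightarrow> dist_steps (steps (zigzag n x y 1)) = {y - x..y - x + int n - 2}"
proof -
  have *: "dist_steps (steps (zigzag n x y s)) = A"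
    if "\<And>k. 0 \<le> k \<Longrightarrow> k < int n - 1 \<Longrightarrow> \<bar>x - y - s * k\<bar> \<in> A"
      and "\<And>d. d \<in> A \<Longrightarrow> 0 \<le> g d \<and> g d < int n - 1 \<and> d = \<bar>x - y - s * g d\<bar>" for s A g
    unfolding dist_steps_zigzag using that by blast
  show "x - y \<ge> int n - 2 \<Longrightarrow> dist_steps (steps (zigzag n x y 1)) = {x - y - int n + 2..x - y}"
    by (rule *[of _ _ "\<lambda>d. x - y - d"]) (use assms in auto)
  show "x \<ge> y \<Longrightarrow> dist_steps (steps (zigzag n x y (-1))) = {x - y..x - y + int n - 2}"
    by (rule *[of _ _ "\<lambda>d. d - (x - y)"]) (use assms in auto)
  show "y \<ge> x \<Longrightarrow> dist_steps (steps (zigzag n x y 1)) = {y - x..y - x + int n - 2}"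
    by (rule *[of _ _ "\<lambda>d. d - (y - x)"]) (use assms in auto)
  show "y - x \<ge> int n - 2 \<Longrightarrow> dist_steps (steps (zigzag n x y (-1))) = {y - x - int n + 2..y - x}"
    by (rule *[of _ _ "\<lambda>d. y - x - d"]) (use assms in auto)
qed

declare zigzag.simps [simp del]

section \<open>Tours and blocks\<close>

definition cycle_steps :: "'a list \<Rightarrow> ('a \<times> 'a) set" where
  "cycle_steps c = steps (c @ [hd c])"

definition all_steps :: "'a list \<Rightarrow> 'a list list \<Rightarrow> ('a \<times> 'a) set" where
  "all_steps P Cs = steps P \<union> \<Union> (cycle_steps ` set Cs)"

text \<open>The total length forces every label to occur exactly once; \<open>X\<close> contains the distances that may be
  missing.\<close>

definition tour :: "int \<Rightarrow> int \<Rightarrow> int set \<Rightarrow> int list \<Rightarrow> int list list \<Rightarrow> bool" where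
  "tour a b X P Cs \<longleftrightarrow> P \<noteq> [] \<and> [] \<notin> set Cs \<and> set P \<union> \<Union> (set ` set Cs) = {a..b} \<and>
     int (length P + sum_list (map length Cs)) = b - a + 1 \<and>
     {1..b - a} \<subseteq> dist_steps (all_steps P Cs) \<union> X"

definition crossing :: "(int \<times> int) set \<Rightarrow> bool" where
  "crossing S \<longleftrightarrow> (\<forall>(x, y) \<in> S. (x < 0) \<noteq> (y < 0))"

text \<open>Opens a gap between the negative and the nonnegative labels into which
  \<open>{a..b}\<close> fits. Every crossing step grows by the same amount \<open>b - a + 1\<close>,
  so the new distances start just above those available inside the gap.\<close>

definition spread :: "int \<Rightarrow> int \<Rightarrow> int \<Rightarrow> int" where
  "spread a b v = (if v < 0 then a + v else b + 1 + v)"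

lemma crossing_simps [simp]:
  "crossing {}" "crossing (insert (x, y) S) \<longleftrightarrow> (x < 0) \<noteq> (y < 0) \<and> crossing S"
  "crossing (S \<union> S') \<longleftrightarrow> crossing S \<and> crossing S'"
  "crossing (\<Union> (f ` I)) \<longleftrightarrow> (\<forall>i\<in>I. crossing (f i))"
  by (auto simp: crossing_def)

lemma dist_steps_UN: "dist_steps (\<Union> (f ` I)) = (\<Union>i\<in>I. dist_steps (f i))"
  by (auto simp: dist_steps_def)

lemma dist_steps_mono: "S \<subseteq> T \<Longrightarrow> dist_steps S \<subseteq> dist_steps T"
  by (auto simp: dist_steps_def)

lemma cycle_steps_map: "c \<noteq> [] \<Longrightarrow> cycle_steps (map f c) = map_prod f f ` cycle_steps c"
  unfolding cycle_steps_def by (metis list.simps(8,9) list.map_sel(1) map_append steps_map)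

lemma cycle_steps_eq: "c \<noteq> [] \<Longrightarrow> cycle_steps c = insert (last c, hd c) (steps c)"
  by (simp add: cycle_steps_def steps_append)

lemma all_steps_map:
  "[] \<notin> set Cs \<Longrightarrow> all_steps (map f P) (map (map f) Cs) = map_prod f f ` all_steps P Cs"
  unfolding all_steps_def image_Un image_UN image_image set_map steps_map
  by (intro arg_cong2[of _ _ _ _ "(\<union>)"] refl SUP_cong cycle_steps_map) auto

lemma all_steps_append:
  "P \<noteq> [] \<Longrightarrow> Q \<noteq> [] \<Longrightarrow>
   all_steps (P @ Q) (Cs @ Ds) = all_steps P Cs \<union> {(last P, hd Q)} \<union> all_steps Q Ds"
  by (auto simp: all_steps_def steps_append)

lemma all_steps_append_map:
  "P \<noteq> [] \<Longrightarrow> Q \<noteq> [] \<Longrightarrow> [] \<notin> set Ds \<Longrightarrow>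
   all_steps (P @ map f Q) (Cs @ map (map f) Ds)
     = all_steps P Cs \<union> {(last P, f (hd Q))} \<union> map_prod f f ` all_steps Q Ds"
  by (subst all_steps_append) (auto simp: all_steps_map hd_map)

lemma dist_steps_spread:
  assumes "crossing S" "a \<le> b + 1"
  shows "dist_steps (map_prod (spread a b) (spread a b) ` S) = (\<lambda>d. d + (b - a + 1)) ` dist_steps S"
  using assms unfolding dist_steps_def image_image crossing_def spread_def
  by (intro image_cong) (auto split: prod.splits)

lemma crossing_spread:
  assumes "crossing S" "a \<le> 0" "-1 \<le> b"
  shows "crossing (map_prod (spread a b) (spread a b) ` S)"
  using assms unfolding crossing_def spread_def by fastforce

lemma dist_steps_transpose:
  "dist_steps (map_prod ((-) s) ((-) s) ` S) = dist_steps S"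
  unfolding dist_steps_def image_image by (intro image_cong) (auto split: prod.splits)

lemma crossing_transpose: "crossing S \<Longrightarrow> crossing (map_prod ((-) (-1)) ((-) (-1)) ` S)"
  unfolding crossing_def by fastforce

lemma dist_steps_translate:
  "dist_steps (map_prod ((+) s) ((+) s) ` S) = dist_steps S"
  unfolding dist_steps_def image_image by (intro image_cong) (auto split: prod.splits)

lemma dist_steps_swap: "dist_steps (prod.swap ` S) = dist_steps S"
  unfolding dist_steps_def image_image by (intro image_cong) auto

lemma crossing_swap: "crossing (prod.swap ` S) \<longleftrightarrow> crossing S"
  by (auto simp: crossing_def)

lemma spread_image:
  assumes "0 \<le> p" "0 \<le> q"
  shows "spread a b ` {- p..q - 1} = {a - p..a - 1} \<union> {b + 1..b + q}"
proof (intro Set.set_eqI iffI)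
  fix x assume "x \<in> {a - p..a - 1} \<union> {b + 1..b + q}"
  then consider "x = spread a b (x - a)" "x - a \<in> {- p..q - 1}"
    | "x = spread a b (x - b - 1)" "x - b - 1 \<in> {- p..q - 1}"
    using assms by (force simp: spread_def)
  then show "x \<in> spread a b ` {- p..q - 1}" by cases blast+
qed (use assms in \<open>auto simp: spread_def split: if_splits\<close>)

lemma length_comp_map [simp]: "length \<circ> map f = length"
  by auto

text \<open>The old tour supplies the distances up to \<open>b - a\<close>, the spread tour those
  above \<open>b - a + 1\<close>. The joining step of the path supplies either the value in between
  or one that was missing before; \<open>X\<close> collects what is still missing, a freedom that
  the cycle of length 2 requires.\<close>

lemma tour_extend:
  assumes P: "tour a b (insert \<bar>last P - spread a b (hd w)\<bar> X) P Cs"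
    and top: "b - a + 1 \<in> insert \<bar>last P - spread a b (hd w)\<bar> X"
    and w: "tour (- p) (q - 1) {} w Ds" and cr: "crossing (all_steps w Ds)"
    and pq: "0 \<le> p" "0 \<le> q"
  shows "tour (a - p) (b + q) X (P @ map (spread a b) w) (Cs @ map (map (spread a b)) Ds)"
proof -
  let ?f = "spread a b"
  have P': "P \<noteq> []" "[] \<notin> set Cs" "set P \<union> \<Union> (set ` set Cs) = {a..b}"
    "int (length P + sum_list (map length Cs)) = b - a + 1"
    "{1..b - a} \<subseteq> dist_steps (all_steps P Cs) \<union> insert \<bar>last P - ?f (hd w)\<bar> X"
    using P by (auto simp: tour_def)
  have w': "w \<noteq> []" "[] \<notin> set Ds" "set w \<union> \<Union> (set ` set Ds) = {- p..q - 1}"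
    "int (length w + sum_list (map length Ds)) = q + p"
    "{1..q + p - 1} \<subseteq> dist_steps (all_steps w Ds)"
    using w by (auto simp: tour_def)
  have ab: "a \<le> b" using P'(1,3) by (metis UnI1 all_not_in_conv atLeastAtMost_iff last_in_set order_trans)
  have steps: "all_steps (P @ map ?f w) (Cs @ map (map ?f) Ds)
      = all_steps P Cs \<union> {(last P, ?f (hd w))} \<union> map_prod ?f ?f ` all_steps w Ds"
    using P'(1) w'(1,2) by (simp add: all_steps_append all_steps_map hd_map)
  have "{1..b + q - (a - p)} \<subseteq> {1..b - a} \<union> {b - a + 1} \<union> (\<lambda>d. d + (b - a + 1)) ` {1..q + p - 1}"
  proof
    fix x assume x: "x \<in> {1..b + q - (a - p)}"
    have "x = (x - (b - a + 1)) + (b - a + 1)" by simp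
    with x show "x \<in> {1..b - a} \<union> {b - a + 1} \<union> (\<lambda>d. d + (b - a + 1)) ` {1..q + p - 1}"
      by (cases "x \<le> b - a + 1") (auto intro!: image_eqI[of x _ "x - (b - a + 1)"])
  qed
  also have "\<dots> \<subseteq> dist_steps (all_steps P Cs) \<union> insert \<bar>last P - ?f (hd w)\<bar> X
      \<union> (\<lambda>d. d + (b - a + 1)) ` dist_steps (all_steps w Ds)"
    using P'(5) w'(5) top by blast
  also have "\<dots> \<subseteq> dist_steps (all_steps (P @ map ?f w) (Cs @ map (map ?f) Ds)) \<union> X"
    unfolding steps using dist_steps_spread[OF cr, of a b] ab by auto
  finally have diffs: "{1..b + q - (a - p)} \<subseteq> \<dots>" .
  have "set (P @ map ?f w) \<union> \<Union> (set ` set (Cs @ map (map ?f) Ds))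
      = (set P \<union> \<Union> (set ` set Cs)) \<union> ?f ` (set w \<union> \<Union> (set ` set Ds))"
    by auto
  also have "\<dots> = {a - p..b + q}"
    unfolding P'(3) w'(3) spread_image[OF pq] using ab pq by auto
  finally have labels: "set (P @ map ?f w) \<union> \<Union> (set ` set (Cs @ map (map ?f) Ds)) = {a - p..b + q}" .
  show ?thesis
    unfolding tour_def using diffs labels P'(1,2,4) w'(2,4) by (simp add: image_iff)
qed

lemma tour_map_affine:
  assumes "tour a b X P Cs"
  shows "tour (s - b) (s - a) X (map ((-) s) P) (map (map ((-) s)) Cs)"
    and "tour (a + s) (b + s) X (map ((+) s) P) (map (map ((+) s)) Cs)"
proof -
  have P': "P \<noteq> []" "[] \<notin> set Cs" "set P \<union> \<Union> (set ` set Cs) = {a..b}"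
    "int (length P + sum_list (map length Cs)) = b - a + 1"
    "{1..b - a} \<subseteq> dist_steps (all_steps P Cs) \<union> X"
    using assms by (auto simp: tour_def)
  have im: "set (map f P) \<union> \<Union> (set ` set (map (map f) Cs)) = f ` {a..b}" for f
    unfolding P'(3)[symmetric] by auto
  show "tour (s - b) (s - a) X (map ((-) s) P) (map (map ((-) s)) Cs)"
    unfolding tour_def im all_steps_map[OF P'(2)] dist_steps_transpose
    using P' by (auto simp: comp_def)
  show "tour (a + s) (b + s) X (map ((+) s) P) (map (map ((+) s)) Cs)"
    unfolding tour_def im all_steps_map[OF P'(2)] dist_steps_translate
    using P' by (auto simp: comp_def add.commute)
qed

lemma tour_rev: "tour a b X P Cs \<Longrightarrow> tour a b X (rev P) Cs"
  unfolding tour_def all_steps_def by (simp add: steps_rev dist_steps_swap)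

lemma tour_nonempty: "tour a b X P Cs \<Longrightarrow> P \<noteq> [] \<and> [] \<notin> set Cs"
  by (simp add: tour_def)

text \<open>Only the distances on cycles restrict the later twisting, so they are tracked apart from
  those on the path.\<close>

definition cycle_dists :: "int list list \<Rightarrow> int set" where
  "cycle_dists Cs = dist_steps (\<Union> (cycle_steps ` set Cs))"

lemma cycle_dists_append [simp]: "cycle_dists (Cs @ Ds) = cycle_dists Cs \<union> cycle_dists Ds"
  and cycle_dists_Nil [simp]: "cycle_dists [] = {}"
  by (auto simp: cycle_dists_def dist_steps_UN)

lemma cycle_dists_subset: "cycle_dists Cs \<subseteq> dist_steps (all_steps P Cs)"
  unfolding cycle_dists_def all_steps_def by (rule dist_steps_mono) blast

lemma UN_cycle_steps_map:
  "[] \<notin> set Cs \<Longrightarrow> \<Union> (cycle_steps ` set (map (map f) Cs)) = map_prod f f ` \<Union> (cycle_steps ` set Cs)"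
  unfolding image_UN image_image set_map by (intro SUP_cong refl cycle_steps_map) auto

lemma cycle_dists_spread:
  "crossing (all_steps w Cs) \<Longrightarrow> a \<le> b + 1 \<Longrightarrow> [] \<notin> set Cs \<Longrightarrow>
   cycle_dists (map (map (spread a b)) Cs) = (\<lambda>d. d + (b - a + 1)) ` cycle_dists Cs"
  unfolding cycle_dists_def
  by (subst UN_cycle_steps_map, assumption, rule dist_steps_spread) (auto simp: all_steps_def)

lemma cycle_dists_reflect:
  "[] \<notin> set Cs \<Longrightarrow> cycle_dists (map (map ((-) s)) Cs) = cycle_dists Cs"
  unfolding cycle_dists_def by (subst UN_cycle_steps_map) (auto simp: dist_steps_transpose)

lemma cycle_dists_translate:
  "[] \<notin> set Cs \<Longrightarrow> cycle_dists (map (map ((+) s)) Cs) = cycle_dists Cs"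
  unfolding cycle_dists_def by (subst UN_cycle_steps_map) (auto simp: dist_steps_translate)

text \<open>The negative and the nonnegative labels are the two sides of an alpha-labeling, so that blocks can be
  placed around each other and around a graceful labeling without repeating a distance. The prescribed
  ends of the path allow its continuation in the next block.\<close>

definition block :: "nat \<Rightarrow> nat \<Rightarrow> nat \<Rightarrow> nat list \<Rightarrow> int \<Rightarrow> bool" where
  "block p q i L B \<longleftrightarrow> (q = p \<or> q = Suc p) \<and> i < q \<and>
     (\<exists>w Cs. tour (- int p) (int q - 1) {} w Cs \<and> crossing (all_steps w Cs) \<and>
        hd w = int i \<and> last w = (if q = p then int i - int p else int p - int i) \<and>
        map length Cs = L \<and> cycle_dists Cs \<subseteq> {..B})"

lemma blockI:
  assumes "q = p \<or> q = Suc p" "i < q" "tour (- int p) (int q - 1) {} w Cs"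
    "crossing (all_steps w Cs)" "hd w = int i"
    "last w = (if q = p then int i - int p else int p - int i)"
    "map length Cs = L" "cycle_dists Cs \<subseteq> {..B}"
  shows "block p q i L B"
  using assms unfolding block_def by blast

lemma blockE:
  assumes "block p q i L B"
  obtains w Cs where "q = p \<or> q = Suc p" "i < q" "tour (- int p) (int q - 1) {} w Cs"
    "crossing (all_steps w Cs)" "hd w = int i"
    "last w = (if q = p then int i - int p else int p - int i)"
    "map length Cs = L" "cycle_dists Cs \<subseteq> {..B}" "w \<noteq> []" "[] \<notin> set Cs"
  using assms tour_nonempty unfolding block_def by blast

lemma map_length_map [simp]: "map length (map (map f) Cs) = map length Cs"
  by simp

text \<open>Reversing the path exchanges its ends. For \<open>q = p\<close> these lie on opposite
  sides, so the reflection \<open>-1 - x\<close> has to bring the new start back to the upper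
  side.\<close>

lemma block_reverse:
  assumes "block p q i L B"
  shows "block p q (q - 1 - i) L B"
  using assms
proof (cases rule: blockE)
  case w: (1 w Cs)
  have cr: "crossing (all_steps (rev w) Cs)"
    using w(4) unfolding all_steps_def by (simp add: steps_rev crossing_swap)
  show ?thesis
  proof (cases "q = p")
    case False
    then show ?thesis
      using w cr by (intro blockI[OF _ _ tour_rev[OF w(3)]]) (auto simp: hd_rev last_rev)
  next
    case True
    have t: "tour (- int p) (int p - 1) {} (map ((-) (-1)) (rev w)) (map (map ((-) (-1))) Cs)"
      using tour_map_affine(1)[OF tour_rev[OF w(3)], of "-1"] True by simp
    have "crossing (all_steps (map ((-) (-1)) (rev w)) (map (map ((-) (-1))) Cs))"
      unfolding all_steps_map[OF w(10)] by (rule crossing_transpose[OF cr])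
    with t show ?thesis
      using True w
      by (intro blockI[where w="map ((-) (-1)) (rev w)" and Cs="map (map ((-) (-1))) Cs"])
        (auto simp: hd_rev last_rev hd_map last_map comp_def cycle_dists_reflect)
  qed
qed

text \<open>The second block is placed around the first one; its path continues the first path with a step
  of length \<open>p1 + q1\<close>. If \<open>q1 = p1 + 1\<close> the two sides of the second block are exchanged.\<close>

lemma block_append:
  assumes 1: "block p1 q1 i L1 B1" and 2: "block p2 q2 i L2 B2"
    and B: "B1 \<le> B" "int p1 + int q1 + B2 \<le> B"
  shows "q1 = p1 \<Longrightarrow> block (p1 + p2) (q1 + q2) i (L1 @ L2) B"
    and "q1 = Suc p1 \<Longrightarrow> block (p1 + q2) (q1 + p2) i (L1 @ L2) B"
proof -
  obtain w Cs where q: "q1 = p1 \<or> q1 = Suc p1" "i < q1"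
    and w: "tour (- int p1) (int q1 - 1) {} w Cs" "crossing (all_steps w Cs)"
      "hd w = int i" "last w = (if q1 = p1 then int i - int p1 else int p1 - int i)"
      "map length Cs = L1" "cycle_dists Cs \<subseteq> {..B1}" "w \<noteq> []" "[] \<notin> set Cs"
    using 1 by (rule blockE)
  obtain v Ds where q2: "q2 = p2 \<or> q2 = Suc p2" "i < q2"
    and v: "tour (- int p2) (int q2 - 1) {} v Ds" "crossing (all_steps v Ds)"
      "hd v = int i" "last v = (if q2 = p2 then int i - int p2 else int p2 - int i)"
      "map length Ds = L2" "cycle_dists Ds \<subseteq> {..B2}" "v \<noteq> []" "[] \<notin> set Ds"
    using 2 by (rule blockE)
  let ?f = "spread (- int p1) (int q1 - 1)"
  \<comment> \<open>Distances on the outer cycles grow by the \<open>p1 + q1\<close> labels placed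
    in the gap, which is why \<open>B2\<close> enters with this summand.\<close>
  have bound: "cycle_dists (Cs @ map (map ?f) Ds') \<subseteq> {..B}"
    if "crossing (all_steps v' Ds')" "[] \<notin> set Ds'" "cycle_dists Ds' \<subseteq> {..B2}" for v' Ds'
    using that w(6) B cycle_dists_spread[OF that(1), of "- int p1" "int q1 - 1"] by fastforce
  show "block (p1 + p2) (q1 + q2) i (L1 @ L2) B" if eq: "q1 = p1"
  proof -
    have "tour (- int p1 - int p2) (int q1 - 1 + int q2) {} (w @ map ?f v) (Cs @ map (map ?f) Ds)"
    proof (rule tour_extend)
      have "\<bar>last w - ?f (hd v)\<bar> = int q1 - 1 - - int p1 + 1"
        using w v q eq by (simp add: spread_def)
      then show "int q1 - 1 - - int p1 + 1 \<in> insert \<bar>last w - ?f (hd v)\<bar> {}" by simp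
      show "tour (- int p1) (int q1 - 1) (insert \<bar>last w - ?f (hd v)\<bar> {}) w Cs"
        using w(1) unfolding tour_def by blast
    qed (use v in auto)
    moreover have "crossing (all_steps (w @ map ?f v) (Cs @ map (map ?f) Ds))"
      using w v q eq crossing_spread[OF v(2), of "- int p1" "int q1 - 1"]
      by (simp add: all_steps_append all_steps_map hd_map) (simp add: spread_def)
    ultimately show ?thesis
      using q q2 eq w v bound[OF v(2) v(8) v(6)]
      by (intro blockI[where w="w @ map ?f v" and Cs="Cs @ map (map ?f) Ds"])
         (simp_all only: map_append map_length_map, auto simp: last_map spread_def algebra_simps)
  qed
  show "block (p1 + q2) (q1 + p2) i (L1 @ L2) B" if eq: "q1 = Suc p1"
  proof -
    \<comment> \<open>Here the inner path ends on the upper side, at \<open>p1 - i\<close>. The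
      outer path has to start on the lower side for the joining step to cross, hence the
      reflection.\<close>
    let ?v = "map ((-) (-1)) v" and ?Ds = "map (map ((-) (-1))) Ds"
    have t: "tour (- int q2) (int p2 - 1) {} ?v ?Ds"
      using tour_map_affine(1)[OF v(1), of "-1"] by (simp add: algebra_simps)
    have cr: "crossing (all_steps ?v ?Ds)"
      unfolding all_steps_map[OF v(8)] by (rule crossing_transpose[OF v(2)])
    have v': "?v \<noteq> []" "[] \<notin> set ?Ds" "cycle_dists ?Ds \<subseteq> {..B2}" "hd ?v = - 1 - int i"
      "last ?v = (if q2 = p2 then int p2 - 1 - int i else int i - int q2)"
      using v q2 by (auto simp: cycle_dists_reflect hd_map last_map)
    have "tour (- int p1 - int q2) (int q1 - 1 + int p2) {} (w @ map ?f ?v) (Cs @ map (map ?f) ?Ds)"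
    proof (rule tour_extend)
      have "\<bar>last w - ?f (hd ?v)\<bar> = int q1 - 1 - - int p1 + 1"
        unfolding v' using w q eq by (simp add: spread_def)
      then show "int q1 - 1 - - int p1 + 1 \<in> insert \<bar>last w - ?f (hd ?v)\<bar> {}" by simp
      show "tour (- int p1) (int q1 - 1) (insert \<bar>last w - ?f (hd ?v)\<bar> {}) w Cs"
        using w(1) unfolding tour_def by blast
    qed (use t cr in auto)
    moreover have "crossing (all_steps (w @ map ?f ?v) (Cs @ map (map ?f) ?Ds))"
    proof -
      have "(last w < 0) \<noteq> (?f (hd ?v) < 0)"
        unfolding v' using w q eq by (simp add: spread_def)
      moreover have "crossing (map_prod ?f ?f ` all_steps ?v ?Ds)"
        by (rule crossing_spread[OF cr]) (use eq in auto)
      ultimately show ?thesis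
        unfolding all_steps_append_map[OF w(7) v'(1,2)] using w(2) by simp
    qed
    moreover have "last (w @ map ?f ?v) = ?f (last ?v)" "hd (w @ map ?f ?v) = hd w"
      using w v' by (simp_all add: last_map)
    ultimately show ?thesis
      unfolding v' using q q2 eq w v v' bound[OF cr v'(2,3)]
      by (intro blockI[where w="w @ map ?f ?v" and Cs="Cs @ map (map ?f) ?Ds"])
         (simp_all only: map_append map_length_map, auto simp: spread_def algebra_simps)
  qed
qed

section \<open>Blocks consisting of a path only\<close>

lemma crossing_zigzag:
  assumes "\<And>k. 2 * k < n \<Longrightarrow> (x - s * int k < 0) = b" "\<And>k. 2 * k + 1 < n \<Longrightarrow> (y + s * int k < 0) = (\<not> b)"
  shows "crossing (steps (zigzag n x y s))"
  using assms
proof (induction n arbitrary: x y s b)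
  case (Suc n)
  have "crossing (steps (zigzag n y (x - s) (- s)))"
  proof (rule Suc.IH)
    show "(y - - s * int k < 0) = (\<not> b)" if "2 * k < n" for k
      using Suc.prems(2)[of k] that by simp
    show "(x - s + - s * int k < 0) = (\<not> \<not> b)" if "2 * k + 1 < n" for k
      using Suc.prems(1)[of "Suc k"] that by (simp add: algebra_simps)
  qed
  moreover have "(x < 0) \<noteq> (y < 0)" if "n > 0"
    using that Suc.prems(1)[of 0] Suc.prems(2)[of 0] by simp
  ultimately show ?case by (cases "n = 0") (auto simp: steps_Cons zigzag.simps)
qed (auto simp: zigzag.simps)

lemma block_step: "block i (Suc i) i [] B"
proof (rule blockI)
  let ?w = "zigzag (Suc (2 * i)) (int i) (- int i) 1"
  have "set ?w = {- int i..int i}"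
    unfolding set_zigzag_odd by auto
  moreover have "{1..2 * int i} \<subseteq> dist_steps (steps ?w)"
    by (subst dist_steps_zigzag_in) simp_all
  ultimately show "tour (- int i) (int (Suc i) - 1) {} ?w []"
    unfolding tour_def all_steps_def by simp
  have "crossing (steps ?w)" by (rule crossing_zigzag[of _ _ _ False]) simp_all
  then show "crossing (all_steps ?w [])" unfolding all_steps_def by simp
  show "hd ?w = int i" by simp
  show "last ?w = (if Suc i = i then int i - int i else int i - int i)"
    unfolding last_zigzag_odd by simp
qed (auto simp: zigzag.simps)

text \<open>Removing a central \<open>block_step\<close> would leave the impossible path with
  \<open>2 * i\<close> and \<open>2 * i + 1\<close> labels and start \<open>i\<close>, so three
  zigzags are joined directly. From below, the distances come from \<open>?v\<close>, the jump
  \<open>2 * i\<close>, \<open>?u\<close>, the jump \<open>4 * i\<close>, and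
  \<open>?z\<close>.\<close>

lemma block_third:
  assumes "i > 0"
  shows "block (3 * i + 1) (3 * i + 1) i [] B"
proof (rule blockI)
  let ?u = "zigzag (2 * i) (int i) (- 1 - int i) (-1)"
  let ?v = "zigzag (2 * i) 0 (- 1) (-1)"
  define m where "m = Suc i"
  then have m: "int m = int i + 1" "m > 0" by simp_all
  let ?z = "zigzag (2 * m) (3 * int i) (- 1 - 3 * int i) 1"
  have ne: "?u \<noteq> []" "?v \<noteq> []" "?z \<noteq> []" using assms m by simp_all
  have hl: "last ?u = - 2 * int i" "hd ?v = 0" "last ?v = - int i" "hd ?z = 3 * int i" "hd ?u = int i"
    "last ?z = - 1 - 2 * int i"
    using assms m by simp_all
  have st: "steps (?u @ ?v @ ?z) = steps ?u \<union> {(- 2 * int i, 0)} \<union> (steps ?v \<union> {(- int i, 3 * int i)} \<union> steps ?z)"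
    using ne by (simp add: steps_append hl)
  have ds: "dist_steps (steps ?u) = {2 * int i + 1..4 * int i - 1}" "dist_steps (steps ?v) = {1..2 * int i - 1}"
    "dist_steps (steps ?z) = {4 * int i + 1..6 * int i + 1}"
    using assms m by simp_all
  have ss: "set ?u = {int i..2 * int i - 1} \<union> {- 2 * int i..- 1 - int i}"
    "set ?v = {0..int i - 1} \<union> {- int i..- 1}"
    "set ?z = {2 * int i..3 * int i} \<union> {- 1 - 3 * int i..- 1 - 2 * int i}"
    using m by auto
  have "set (?u @ ?v @ ?z) = {- int (3 * i + 1)..int (3 * i + 1) - 1}"
    unfolding set_append ss by auto
  moreover have "{1..int (3 * i + 1) - 1 - - int (3 * i + 1)} \<subseteq> dist_steps (steps (?u @ ?v @ ?z))"
    unfolding st dist_steps_simps ds by auto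
  ultimately show "tour (- int (3 * i + 1)) (int (3 * i + 1) - 1) {} (?u @ ?v @ ?z) []"
    unfolding tour_def all_steps_def using ne m by simp
  have "crossing (steps ?u)" "crossing (steps ?v)" "crossing (steps ?z)"
    using m by (auto intro!: crossing_zigzag[of _ _ _ False])
  then show "crossing (all_steps (?u @ ?v @ ?z) [])"
    unfolding all_steps_def st using assms by simp
  show "hd (?u @ ?v @ ?z) = int i" using ne hl by simp
  show "last (?u @ ?v @ ?z) = (if 3 * i + 1 = 3 * i + 1 then int i - int (3 * i + 1) else int (3 * i + 1) - int i)"
    using ne hl by simp
qed (auto simp: zigzag.simps)

lemma block_no_cycles: "block p q i [] B \<Longrightarrow> block p q i [] B'"
  by (elim blockE) (rule blockI, auto)

text \<open>For \<open>q = p + 1\<close> and \<open>2 * i = p > 0\<close> the path would end at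
  \<open>p - i = i\<close>, where it starts; this is the only obstruction. By reversal
  \<open>2 * i \<le> q - 1\<close> may be assumed. Then the block is \<open>block_step i\<close>
  surrounded by a smaller block with the same start and exchanged sides; the smaller block hits the
  obstruction only if \<open>p = q = 3 * i + 1\<close>.\<close>

lemma block_path:
  assumes "q = p \<or> q = Suc p" "i < q" "\<not> (q = Suc p \<and> 2 * i = p \<and> p > 0)"
  shows "block p q i [] B"
  using assms
proof (induction "p + q" arbitrary: p q i B rule: less_induct)
  case (less p q i B)
  have main: "block p q i [] B"
    if i: "i < q" "\<not> (q = Suc p \<and> 2 * i = p \<and> p > 0)" "2 * i \<le> q - 1" for i B
  proof (cases "q = p \<and> p = 3 * i + 1 \<and> i > 0")
    case True then show ?thesis using block_third by blast
  next
    case False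
    show ?thesis
    proof (cases "p = i")
      case True
      with i less.prems(1) have "p = 0" "q = 1" "i = 0" by linarith+
      then show ?thesis using block_step[of 0] by simp
    next
      case pi: False
      have le: "i < p" using pi i(1,3) less.prems(1) by linarith
      \<comment> \<open>The negative bound offsets the shift by the \<open>2 * i + 1\<close> central
        labels; with no cycles every bound holds.\<close>
      have "block (q - Suc i) (p - i) i [] (- int i - int (Suc i))"
      proof (rule less.hyps)
        show "q - Suc i + (p - i) < p + q" using le i(1) by linarith
        show "p - i = q - Suc i \<or> p - i = Suc (q - Suc i)" using le less.prems(1) by linarith
        show "i < p - i" "\<not> (p - i = Suc (q - Suc i) \<and> 2 * i = q - Suc i \<and> q - Suc i > 0)"
          using i le less.prems(1) False by linarith+
      qed
      from block_append(2)[OF block_step[of i 0] this, of 0]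
      have "block (i + (p - i)) (Suc i + (q - Suc i)) i [] 0" by simp
      then have "block p q i [] 0" using le i by simp
      then show ?thesis by (rule block_no_cycles)
    qed
  qed
  show ?case
  proof (cases "2 * i \<le> q - 1")
    case False
    have "block p q (q - 1 - i) [] B"
      using False less.prems by (intro main) auto
    from block_reverse[OF this] show ?thesis using less.prems by simp
  qed (use main less.prems in auto)
qed

section \<open>Blocks with one even cycle\<close>

lemma tour_cycle_dists: "tour a b X P Cs \<Longrightarrow> cycle_dists Cs \<subseteq> {..b - a}"
proof
  fix d assume t: "tour a b X P Cs" and "d \<in> cycle_dists Cs"
  then obtain c x y where c: "c \<in> set Cs" "(x, y) \<in> cycle_steps c" and d: "d = \<bar>x - y\<bar>"
    by (auto simp: cycle_dists_def dist_steps_def)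
  have "hd c \<in> set c" using c(1) t by (metis tour_nonempty hd_in_set)
  then have "x \<in> set c" "y \<in> set c"
    using steps_subset[of x y "c @ [hd c]"] c by (auto simp: cycle_steps_def)
  then have "x \<in> {a..b}" "y \<in> {a..b}" using c(1) t unfolding tour_def by blast+
  then show "d \<in> {..b - a}" by (auto simp: d)
qed

lemma all_steps_one: "all_steps P [c] = steps P \<union> cycle_steps c"
  by (simp add: all_steps_def)

lemma UN_set_single: "\<Union> (set ` set [c]) = set c"
  by simp

lemma crossing_zigzag_neg:
  assumes "x < 0" "0 \<le> y" shows "crossing (steps (zigzag n x y 1))"
  using assms by (intro crossing_zigzag[of _ _ _ True]) auto

text \<open>The cycle zigzags outwards around the core path \<open>w\<close> and skips only the
  upper label \<open>\<beta> + j\<close>, at which the path starts. From below, the distances come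
  from \<open>w\<close>, the first path step, \<open>?x\<close>, the step from \<open>?x\<close> to
  \<open>?y\<close>, the closing step, and \<open>?y\<close>. The core path has start
  \<open>\<beta> - j\<close>, which is impossible for \<open>\<beta> = 2 * j\<close>.\<close>

lemma even_block_4:
  assumes j: "0 < j" "j < \<beta>" "\<beta> \<noteq> 2 * j"
  shows "block (\<beta> + 2 * j + 1) (\<beta> + 2 * j + 1) (\<beta> + j) [4 * j] (2 * int (\<beta> + 2 * j + 1))"
proof -
  have "block \<beta> (Suc \<beta>) (\<beta> - j) [] 0"
    using j by (intro block_path) auto
  then obtain v Vs where "tour (- int \<beta>) (int (Suc \<beta>) - 1) {} v Vs" "crossing (all_steps v Vs)"
      "hd v = int (\<beta> - j)" "last v = int \<beta> - int (\<beta> - j)" "map length Vs = []"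
    by (auto elim!: blockE)
  then have v: "tour (- int \<beta>) (int \<beta>) {} v []" "crossing (all_steps v [])"
      "hd v = int \<beta> - int j" "last v = int j"
    using j by (auto simp: of_nat_diff)
  define w where "w = map ((-) (-1)) v"
  have ne: "v \<noteq> []" "w \<noteq> []" using v(1) by (auto simp: tour_def w_def)
  have "tour (- 1 - int \<beta>) (int \<beta> - 1) {} w []"
    using tour_map_affine(1)[OF v(1), of "-1"] by (simp add: w_def)
  then have w: "set w = {- int \<beta> - 1..int \<beta> - 1}" "int (length w) = 2 * int \<beta> + 1"
      "{1..2 * int \<beta>} \<subseteq> dist_steps (steps w)"
    by (auto simp: tour_def all_steps_def)
  have hw: "hd w = int j - int \<beta> - 1" "last w = - 1 - int j"
    using v ne by (auto simp: w_def hd_map last_map)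
  have cw: "crossing (steps w)"
    using crossing_transpose[OF v(2)] by (simp add: w_def steps_map all_steps_def)
  let ?x = "zigzag (2 * j) (- 2 - int \<beta>) (int \<beta>) 1"
  let ?y = "zigzag (2 * j) (- 2 - int \<beta> - int j) (int \<beta> + int j + 1) 1"
  let ?P = "(int \<beta> + int j) # w" and ?c = "?x @ ?y"
  have hl: "hd ?x = - 2 - int \<beta>" "hd ?y = - 2 - int \<beta> - int j" "last ?x = int \<beta> + int j - 1"
    "last ?y = int \<beta> + 2 * int j"
    using j by simp_all
  have xy: "?x \<noteq> []" "?y \<noteq> []" using j by simp_all
  have st: "steps ?P = insert (int \<beta> + int j, int j - int \<beta> - 1) (steps w)"
    "cycle_steps ?c = insert (int \<beta> + 2 * int j, - 2 - int \<beta>)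
       (insert (int \<beta> + int j - 1, - 2 - int \<beta> - int j) (steps ?x \<union> steps ?y))"
    using xy by (auto simp: steps_Cons ne hw cycle_steps_eq steps_append hl)
  have ds: "dist_steps (steps ?x) = {2 * int \<beta> + 2..2 * int \<beta> + 2 * int j}"
    "dist_steps (steps ?y) = {2 * int \<beta> + 2 * int j + 3..2 * int \<beta> + 4 * int j + 1}"
    using j by simp_all
  have sets: "set ?P \<union> set ?c = {- int (\<beta> + 2 * j + 1)..int (\<beta> + 2 * j + 1) - 1}"
    unfolding set_append set_zigzag_even list.set w(1) by auto
  have eq: "int (\<beta> + 2 * j + 1) - 1 - - int (\<beta> + 2 * j + 1) = 2 * int \<beta> + 4 * int j + 1" by simp
  have "{1..2 * int \<beta> + 4 * int j + 1} \<subseteq> dist_steps (all_steps ?P [?c])"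
    unfolding all_steps_one st dist_steps_simps ds
  proof
    fix d assume d: "d \<in> {1..2 * int \<beta> + 4 * int j + 1}"
    have "\<bar>int \<beta> + int j - (int j - int \<beta> - 1)\<bar> = 2 * int \<beta> + 1"
      "\<bar>int \<beta> + 2 * int j - (- 2 - int \<beta>)\<bar> = 2 * int \<beta> + 2 * int j + 2"
      "\<bar>int \<beta> + int j - 1 - (- 2 - int \<beta> - int j)\<bar> = 2 * int \<beta> + 2 * int j + 1" by simp_all
    then show "d \<in> insert \<bar>int \<beta> + int j - (int j - int \<beta> - 1)\<bar> (dist_steps (steps w))
      \<union> insert \<bar>int \<beta> + 2 * int j - (- 2 - int \<beta>)\<bar>
        (insert \<bar>int \<beta> + int j - 1 - (- 2 - int \<beta> - int j)\<bar>
        ({2 * int \<beta> + 2..2 * int \<beta> + 2 * int j} \<union> {2 * int \<beta> + 2 * int j + 3..2 * int \<beta> + 4 * int j + 1}))"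
      using d w(3) by (cases "d \<le> 2 * int \<beta>") auto
  qed
  with sets have t: "tour (- int (\<beta> + 2 * j + 1)) (int (\<beta> + 2 * j + 1) - 1) {} ?P [?c]"
    unfolding tour_def UN_set_single eq using w(2) xy by simp
  show ?thesis
  proof (rule blockI[OF _ _ t])
    show "cycle_dists [?c] \<subseteq> {..2 * int (\<beta> + 2 * j + 1)}"
      using tour_cycle_dists[OF t] by auto
    have "crossing (steps ?x)" "crossing (steps ?y)" by (rule crossing_zigzag_neg; simp)+
    then show "crossing (all_steps ?P [?c])"
      unfolding all_steps_one st using cw j by simp
  qed (use ne hw j in auto)
qed

text \<open>The cycle consists of a zigzag with an odd number of vertices and a spread path block
  from \<open>1\<close> to \<open>j - 1\<close>; it skips one label on each side, and these two
  begin the path. From below, the distances come from \<open>w\<close>, the second path step,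
  \<open>?x\<close>, the closing step, the first path step, the step from \<open>?x\<close> to
  \<open>?y\<close>, and \<open>?y\<close>.\<close>

lemma even_block_2:
  assumes j: "0 < j" "j \<noteq> 2" "j + 2 \<le> \<alpha>"
  shows "block (\<alpha> + 2 * j + 2) (\<alpha> + 2 * j + 2) (\<alpha> + j) [4 * j + 2] (2 * int (\<alpha> + 2 * j + 2))"
proof -
  have "block \<alpha> \<alpha> (\<alpha> - j - 2) [] 0"
    using j by (intro block_path) auto
  then obtain w Vs where "tour (- int \<alpha>) (int \<alpha> - 1) {} w Vs" "crossing (all_steps w Vs)"
      "hd w = int (\<alpha> - j - 2)" "last w = int (\<alpha> - j - 2) - int \<alpha>" "map length Vs = []"
    by (auto elim!: blockE)
  then have w: "set w = {- int \<alpha>..int \<alpha> - 1}" "int (length w) = 2 * int \<alpha>" "w \<noteq> []"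
      "{1..2 * int \<alpha> - 1} \<subseteq> dist_steps (steps w)" "crossing (steps w)"
      "hd w = int \<alpha> - int j - 2" "last w = - int j - 2"
    using j by (auto simp: of_nat_diff tour_def all_steps_def)
  have "block j (Suc j) 1 [] 0"
    using j by (intro block_path) auto
  then obtain z Vs where "tour (- int j) (int (Suc j) - 1) {} z Vs" "crossing (all_steps z Vs)"
      "hd z = 1" "last z = int j - 1" "map length Vs = []"
    by (auto elim!: blockE)
  then have z: "set z = {- int j..(int j + 1) - 1}" "int (length z) = 2 * int j + 1" "z \<noteq> []"
      "{1..2 * int j} \<subseteq> dist_steps (steps z)" "crossing (steps z)" "hd z = 1" "last z = int j - 1"
    by (auto simp: tour_def all_steps_def)
  let ?f = "spread (- int \<alpha> - int j - 2) (int \<alpha> + int j)"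
  let ?x = "zigzag (Suc (2 * j)) (- 1 - int \<alpha>) (int \<alpha>) 1" and ?y = "map ?f z"
  let ?P = "[int \<alpha> + int j, - int \<alpha> - int j - 2] @ w" and ?c = "?x @ ?y"
  have hl: "hd ?x = - 1 - int \<alpha>" "last ?x = - 1 - int \<alpha> - int j" "hd ?y = int \<alpha> + int j + 2"
    "last ?y = int \<alpha> + 2 * int j"
    using z j by (simp_all add: hd_map last_map spread_def)
  have xy: "?x \<noteq> []" "?y \<noteq> []" using z by simp_all
  have st: "steps ?P = insert (int \<alpha> + int j, - int \<alpha> - int j - 2)
      (insert (- int \<alpha> - int j - 2, int \<alpha> - int j - 2) (steps w))"
    "cycle_steps ?c = insert (int \<alpha> + 2 * int j, - 1 - int \<alpha>)
       (insert (- 1 - int \<alpha> - int j, int \<alpha> + int j + 2) (steps ?x \<union> steps ?y))"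
    using xy w by (auto simp: steps_Cons cycle_steps_eq steps_append hl)
  have dx: "dist_steps (steps ?x) = {2 * int \<alpha> + 1..2 * int \<alpha> + 2 * int j}"
    using j by simp
  have dy: "dist_steps (steps ?y) = (\<lambda>d. d + (2 * int \<alpha> + 2 * int j + 3)) ` dist_steps (steps z)"
    unfolding steps_map using dist_steps_spread[OF z(5), of "- int \<alpha> - int j - 2" "int \<alpha> + int j"]
    by (simp add: algebra_simps)
  have sy: "set ?y = {- int \<alpha> - 2 * int j - 2..- int \<alpha> - int j - 3} \<union> {int \<alpha> + int j + 1..int \<alpha> + 2 * int j + 1}"
    unfolding set_map z(1) by (subst spread_image) auto
  have sets: "set ?P \<union> set ?c = {- int (\<alpha> + 2 * j + 2)..int (\<alpha> + 2 * j + 2) - 1}"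
    unfolding set_append set_zigzag_odd list.set w(1) sy by auto
  have eq: "int (\<alpha> + 2 * j + 2) - 1 - - int (\<alpha> + 2 * j + 2) = 2 * int \<alpha> + 4 * int j + 3" by simp
  have "{1..2 * int \<alpha> + 4 * int j + 3} \<subseteq> dist_steps (all_steps ?P [?c])"
    unfolding all_steps_one st dist_steps_simps dx dy
  proof
    fix d assume d: "d \<in> {1..2 * int \<alpha> + 4 * int j + 3}"
    have e: "\<bar>int \<alpha> + int j - (- int \<alpha> - int j - 2)\<bar> = 2 * int \<alpha> + 2 * int j + 2"
      "\<bar>- int \<alpha> - int j - 2 - (int \<alpha> - int j - 2)\<bar> = 2 * int \<alpha>"
      "\<bar>int \<alpha> + 2 * int j - (- 1 - int \<alpha>)\<bar> = 2 * int \<alpha> + 2 * int j + 1"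
      "\<bar>- 1 - int \<alpha> - int j - (int \<alpha> + int j + 2)\<bar> = 2 * int \<alpha> + 2 * int j + 3" by simp_all
    have "d - (2 * int \<alpha> + 2 * int j + 3) \<in> dist_steps (steps z)"
      if "2 * int \<alpha> + 2 * int j + 3 < d" using z(4) d that by auto
    then show "d \<in> insert \<bar>int \<alpha> + int j - (- int \<alpha> - int j - 2)\<bar>
      (insert \<bar>- int \<alpha> - int j - 2 - (int \<alpha> - int j - 2)\<bar> (dist_steps (steps w)))
      \<union> insert \<bar>int \<alpha> + 2 * int j - (- 1 - int \<alpha>)\<bar>
        (insert \<bar>- 1 - int \<alpha> - int j - (int \<alpha> + int j + 2)\<bar>
        ({2 * int \<alpha> + 1..2 * int \<alpha> + 2 * int j} \<union>
         (\<lambda>d. d + (2 * int \<alpha> + 2 * int j + 3)) ` dist_steps (steps z)))"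
      unfolding e using d w(4)
      by (cases "d < 2 * int \<alpha>"; cases "2 * int \<alpha> + 2 * int j + 3 < d")
         (auto intro!: image_eqI[of d _ "d - (2 * int \<alpha> + 2 * int j + 3)"])
  qed
  with sets have t: "tour (- int (\<alpha> + 2 * j + 2)) (int (\<alpha> + 2 * j + 2) - 1) {} ?P [?c]"
    unfolding tour_def UN_set_single eq using w(2) z(2) xy by simp
  show ?thesis
  proof (rule blockI[OF _ _ t])
    show "cycle_dists [?c] \<subseteq> {..2 * int (\<alpha> + 2 * j + 2)}"
      using tour_cycle_dists[OF t] by auto
    have "crossing (steps ?x)" by (rule crossing_zigzag_neg) simp_all
    moreover have "crossing (steps ?y)"
      unfolding steps_map by (rule crossing_spread[OF z(5)]) simp_all
    ultimately show "crossing (all_steps ?P [?c])"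
      unfolding all_steps_one st using w(5) j by simp
    have "length z = 2 * j + 1" using z(2) by linarith
    then show "map length [?c] = [4 * j + 2]" by simp
  qed (use w j in auto)
qed

text \<open>The length 10 is exceptional in the previous construction, since \<open>block 2 3 1\<close> does not exist.\<close>

lemma even_block_10:
  assumes "4 \<le> \<alpha>"
  shows "block (\<alpha> + 7) (\<alpha> + 7) (\<alpha> + 3) [10] (2 * int (\<alpha> + 7))"
proof -
  have "block \<alpha> \<alpha> (\<alpha> - 4) [] 0"
    using assms by (intro block_path) auto
  then obtain w Vs where "tour (- int \<alpha>) (int \<alpha> - 1) {} w Vs" "crossing (all_steps w Vs)"
      "hd w = int (\<alpha> - 4)" "last w = int (\<alpha> - 4) - int \<alpha>" "map length Vs = []"
    by (auto elim!: blockE)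
  then have w: "set w = {- int \<alpha>..int \<alpha> - 1}" "int (length w) = 2 * int \<alpha>" "w \<noteq> []"
      "{1..2 * int \<alpha> - 1} \<subseteq> dist_steps (steps w)" "crossing (steps w)"
      "hd w = int \<alpha> - 4" "last w = - 4"
    using assms by (auto simp: of_nat_diff tour_def all_steps_def)
  let ?a = "int \<alpha>"
  let ?P = "[?a + 3, - 6 - ?a, ?a + 4, - 4 - ?a] @ w"
  let ?c = "[- 1 - ?a, ?a, - 2 - ?a, ?a + 1, - 3 - ?a, ?a + 2, - 5 - ?a, ?a + 6, - 7 - ?a, ?a + 5]"
  have st: "steps ?P = {(?a + 3, - 6 - ?a), (- 6 - ?a, ?a + 4), (?a + 4, - 4 - ?a), (- 4 - ?a, ?a - 4)} \<union> steps w"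
    using w by (simp add: steps_Cons)
  have sets: "set ?P \<union> set ?c = {- int (\<alpha> + 7)..int (\<alpha> + 7) - 1}"
    unfolding set_append list.set w(1) by (auto; presburger)
  have eq: "int (\<alpha> + 7) - 1 - - int (\<alpha> + 7) = 2 * ?a + 13" by simp
  have "{1..2 * ?a + 13} \<subseteq> dist_steps (all_steps ?P [?c])"
  proof
    fix d assume d: "d \<in> {1..2 * ?a + 13}"
    show "d \<in> dist_steps (all_steps ?P [?c])"
    proof (cases "d < 2 * ?a")
      case True
      then show ?thesis using d w(4) unfolding all_steps_one st dist_steps_simps by auto
    next
      case False
      with d have "d = 2 * ?a \<or> d = 2 * ?a + 1 \<or> d = 2 * ?a + 2 \<or> d = 2 * ?a + 3 \<or> d = 2 * ?a + 4
        \<or> d = 2 * ?a + 5 \<or> d = 2 * ?a + 6 \<or> d = 2 * ?a + 7 \<or> d = 2 * ?a + 8 \<or> d = 2 * ?a + 9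
        \<or> d = 2 * ?a + 10 \<or> d = 2 * ?a + 11 \<or> d = 2 * ?a + 12 \<or> d = 2 * ?a + 13"
        unfolding atLeastAtMost_iff by presburger
      moreover have "dist_steps (all_steps ?P [?c]) \<supseteq> {2 * ?a, 2 * ?a + 1, 2 * ?a + 2, 2 * ?a + 3, 2 * ?a + 4,
        2 * ?a + 5, 2 * ?a + 6, 2 * ?a + 7, 2 * ?a + 8, 2 * ?a + 9, 2 * ?a + 10, 2 * ?a + 11, 2 * ?a + 12, 2 * ?a + 13}"
        unfolding all_steps_one st dist_steps_simps by (simp add: cycle_steps_def abs_if)
      ultimately show ?thesis by blast
    qed
  qed
  with sets have t: "tour (- int (\<alpha> + 7)) (int (\<alpha> + 7) - 1) {} ?P [?c]"
    unfolding tour_def UN_set_single eq using w(2) by simp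
  show ?thesis
  proof (rule blockI[OF _ _ t])
    show "cycle_dists [?c] \<subseteq> {..2 * int (\<alpha> + 7)}"
      using tour_cycle_dists[OF t] by auto
    show "crossing (all_steps ?P [?c])"
      unfolding all_steps_one st using w(5) assms by (simp add: cycle_steps_def)
  qed (use w in auto)
qed

text \<open>Half the number of labels of the block with one cycle of length \<open>l\<close>,
  expressed by its start \<open>u\<close>, which is \<open>\<beta> + j\<close>,
  \<open>\<alpha> + j\<close> or, for length 10, \<open>\<alpha> + 3\<close>.\<close>

definition half_size :: "nat \<Rightarrow> nat \<Rightarrow> nat" where
  "half_size u l = u + l div 4 + (if 4 dvd l then 1 else 2)"

text \<open>Blocks can be nested only if they have the same start. A \<open>u\<close> that is not a
  multiple of 3 suits all even lengths at once: it avoids the exception \<open>u = 3 * j\<close> for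
  length \<open>4 * j\<close>, and \<open>u = 6\<close>, which leaves too few labels for length
  10.\<close>

lemma even_block:
  assumes "even l" "4 \<le> l" "l div 2 < u" "u mod 3 \<noteq> 0"
  shows "block (half_size u l) (half_size u l) u [l] (2 * int (half_size u l))"
proof (cases "4 dvd l")
  case True
  then obtain j where j: "l = 4 * j" by blast
  define \<beta> where "\<beta> = u - j"
  have "u \<noteq> 3 * j" using assms(4) by auto
  then have "u = \<beta> + j" "0 < j" "j < \<beta>" "\<beta> \<noteq> 2 * j"
    using assms j by (auto simp: \<beta>_def)
  moreover from this have "half_size u l = \<beta> + 2 * j + 1" using j by (simp add: half_size_def)
  ultimately show ?thesis using even_block_4[of j \<beta>] j by metis
next
  case False
  define j where "j = l div 4"
  have j: "l = 4 * j + 2" "0 < j" using False assms(1,2) unfolding j_def by presburger+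
  show ?thesis
  proof (cases "j = 2")
    case True
    define \<alpha> where "\<alpha> = u - 3"
    have u: "u \<noteq> 6" using assms by auto
    then have "u = \<alpha> + 3" "4 \<le> \<alpha>" using assms j True by (auto simp: \<alpha>_def)
    moreover have "l = 10" using j True by simp
    moreover from calculation have "half_size u l = \<alpha> + 7" by (simp add: half_size_def)
    ultimately show ?thesis using even_block_10[of \<alpha>] by metis
  next
    case jn: False
    define \<alpha> where "\<alpha> = u - j"
    have "u = \<alpha> + j" "j + 2 \<le> \<alpha>"
      using assms j by (auto simp: \<alpha>_def)
    moreover from this have "half_size u l = \<alpha> + 2 * j + 2" using j False by (simp add: half_size_def)
    ultimately show ?thesis using even_block_2[of j \<alpha>] j jn by metis
  qed
qed

text \<open>The outermost layer is a path block that fills up to \<open>W\<close>. Hence the cycle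
  distances are bounded by the blocks alone, independently of \<open>W\<close>; the strict
  inequality leaves this layer room for its start \<open>u\<close>.\<close>

lemma even_blocks:
  assumes "\<forall>l\<in>set L. even l \<and> 4 \<le> l \<and> l div 2 < u" "u mod 3 \<noteq> 0"
    and "sum_list (map (half_size u) L) + u < W"
  shows "block W W u L (2 * int (sum_list (map (half_size u) L)))"
  using assms
proof (induction L arbitrary: W)
  case Nil
  then show ?case by (intro block_path) auto
next
  case (Cons l L)
  let ?h = "half_size u l" and ?S = "sum_list (map (half_size u) L)"
  have "block ?h ?h u [l] (2 * int ?h)"
    using Cons.prems by (intro even_block) auto
  moreover have "block (W - ?h) (W - ?h) u L (2 * int ?S)"
    using Cons.prems by (intro Cons.IH) auto
  ultimately have "block (?h + (W - ?h)) (?h + (W - ?h)) u ([l] @ L) (2 * int (?h + ?S))"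
    by (rule block_append(1)) auto
  then show ?case using Cons.prems by simp
qed

section \<open>Odd cycles\<close>

text \<open>The path end \<open>t\<close> is recorded because a block placed around these labels is
  joined by a step of length \<open>e + 1\<close> exactly if it starts at \<open>t\<close>.\<close>

definition graceful :: "nat \<Rightarrow> nat \<Rightarrow> nat multiset \<Rightarrow> bool" where
  "graceful e t L \<longleftrightarrow>
     (\<exists>P Cs. tour 0 (int e) {} P Cs \<and> last P = int t \<and> mset (map length Cs) = L)"

lemma tour_perm: "mset Cs = mset Ds \<Longrightarrow> tour a b X P Cs \<Longrightarrow> tour a b X P Ds"
  unfolding tour_def all_steps_def
  by (metis mset_eq_setD mset_map sum_mset_sum_list)

lemma tour_normalize:
  assumes "tour a b X P Cs" "b - a = e" "last P = a + t \<or> last P = b - t"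
  obtains Q f where "tour 0 e X Q (map (map f) Cs)" "last Q = t"
    "\<And>Ds. [] \<notin> set Ds \<Longrightarrow> cycle_dists (map (map f) Ds) = cycle_dists Ds"
proof -
  have ne: "P \<noteq> []" using assms(1) by (simp add: tour_def)
  from assms(3) show thesis
  proof
    assume "last P = a + t"
    then show thesis
      using tour_map_affine(2)[OF assms(1), of "- a"] assms(2) ne
      by (intro that[of "map ((+) (- a)) P" "(+) (- a)"]) (simp_all add: last_map cycle_dists_translate)
  next
    assume "last P = b - t"
    then show thesis
      using tour_map_affine(1)[OF assms(1), of b] assms(2) ne
      by (intro that[of "map ((-) b) P" "(-) b"]) (simp_all add: last_map cycle_dists_reflect)
  qed
qed

lemma gracefulI:
  assumes "tour a b {} P Cs" "b - a = int e" "last P = a + int t \<or> last P = b - int t"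
    "mset (map length Cs) = L"
  shows "graceful e t L"
proof -
  obtain Q f where "tour 0 (int e) {} Q (map (map f) Cs)" "last Q = int t"
    using tour_normalize[OF assms(1,2,3)] by metis
  then show ?thesis unfolding graceful_def using assms(4)
    by (intro exI[of _ Q] exI[of _ "map (map f) Cs"]) simp_all
qed

lemma crossing_dist_pos: "crossing S \<Longrightarrow> d \<in> dist_steps S \<Longrightarrow> 0 < d"
  by (auto simp: crossing_def dist_steps_def)

text \<open>Two seeds without cycles: an expanding zigzag that ends at an extreme label, and a
  contracting one that ends in the centre. When odd cycles are absent, the second one provides the
  large path end that the remaining cycles need.\<close>

lemma graceful_zigzag: "graceful e 0 {#}" and graceful_center: "graceful (2 * t) t {#}"
proof -
  show "graceful e 0 {#}"
  proof (cases "even e")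
    case True
    then obtain m where m: "e = 2 * m" by blast
    have "set (zigzag (Suc (2 * m)) (int m) (int m + 1) 1) = {0..int e}"
      unfolding set_zigzag_odd m by auto
    moreover have "{1..int e} \<subseteq> dist_steps (steps (zigzag (Suc (2 * m)) (int m) (int m + 1) 1))"
      by (subst dist_steps_zigzag_in(4)) (auto simp: m)
    ultimately have "tour 0 (int e) {} (zigzag (Suc (2 * m)) (int m) (int m + 1) 1) []"
      unfolding tour_def all_steps_def by (simp add: m)
    then show ?thesis by (rule gracefulI) (auto simp: m)
  next
    case False
    then obtain k where "e = Suc (2 * k)" by (metis oddE Suc_eq_plus1)
    then obtain m where m: "int e = 2 * int m - 1" "0 < m" by (intro that[of "Suc k"]) auto
    have "set (zigzag (2 * m) (int m) (int m - 1) (-1)) = {0..int e}"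
      unfolding set_zigzag_even m using m(2) by auto
    moreover have "{1..int e} \<subseteq> dist_steps (steps (zigzag (2 * m) (int m) (int m - 1) (-1)))"
      using m by (subst dist_steps_zigzag_in(3)) auto
    ultimately have "tour 0 (int e) {} (zigzag (2 * m) (int m) (int m - 1) (-1)) []"
      unfolding tour_def all_steps_def using m by simp
    then show ?thesis by (rule gracefulI) (use m in auto)
  qed
  have "set (zigzag (Suc (2 * t)) (2 * int t) 0 1) = {0..int (2 * t)}"
    unfolding set_zigzag_odd by auto
  moreover have "{1..int (2 * t)} \<subseteq> dist_steps (steps (zigzag (Suc (2 * t)) (2 * int t) 0 1))"
    by (subst dist_steps_zigzag_in(1)) auto
  ultimately have "tour 0 (int (2 * t)) {} (zigzag (Suc (2 * t)) (2 * int t) 0 1) []"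
    unfolding tour_def all_steps_def by simp
  then show "graceful (2 * t) t {#}"
    by (rule gracefulI) auto
qed

lemma graceful_extend:
  assumes "graceful e t L" "block p q t [] 0"
  shows "graceful (e + p + q) t L"
proof -
  obtain P Cs where P: "tour 0 (int e) {} P Cs" "last P = int t" "mset (map length Cs) = L"
    using assms(1) by (auto simp: graceful_def)
  obtain w where q: "q = p \<or> q = Suc p" "t < q" and w: "tour (- int p) (int q - 1) {} w []"
    "crossing (all_steps w [])" "hd w = int t" "last w = (if q = p then int t - int p else int p - int t)"
    using assms(2) by (auto elim!: blockE)
  have ne: "P \<noteq> []" "w \<noteq> []" using P(1) w(1) by (auto simp: tour_def)
  let ?f = "spread 0 (int e)"
  have t: "tour (0 - int p) (int e + int q) {} (P @ map ?f w) (Cs @ map (map ?f) [])"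
    by (rule tour_extend[OF _ _ w(1,2)]) (use P w in \<open>auto simp: spread_def tour_def\<close>)
  show ?thesis
    by (rule gracefulI[OF t]) (use P w ne q in \<open>auto simp: last_map spread_def\<close>)
qed

text \<open>The new labels form one path block; \<open>s = 4 * t + 1\<close> would be the impossible
  one with \<open>p = 2 * t\<close>.\<close>

lemma graceful_grow:
  assumes "graceful e t L" "2 * t + 2 \<le> s" "s \<noteq> 4 * t + 1"
  shows "graceful (e + s) t L"
proof -
  have "block (s div 2) ((s + 1) div 2) t [] 0"
    using assms by (intro block_path) presburger+
  moreover have "e + s div 2 + (s + 1) div 2 = e + s" by presburger
  ultimately show ?thesis using graceful_extend[OF assms(1)] by metis
qed


text \<open>The odd cycle has one step joining two vertices on the same side, of length \<open>e + 1\<close>. The path first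
  fills the block next to the old labels, then jumps to the outermost vertex and zigzags inwards,
  skipping the far vertex of the cycle.\<close>

lemma odd_cycle_gadget:
  assumes G: "graceful e t L" and k: "0 < k" and le: "2 * t + 3 * k + 1 \<le> e"
    and exc: "4 * (t + k) \<noteq> e - k"
  obtains e' where "graceful e' (e + t + 2 * k) (add_mset (2 * k + 1) L)"
    "4 * e + 2 * t + 5 * k + 1 \<le> e'" "e' \<le> 4 * e + 2 * t + 5 * k + 2"
proof -
  obtain P Cs where P: "tour 0 (int e) {} P Cs" "last P = int t" "mset (map length Cs) = L"
    using G by (auto simp: graceful_def)
  then have P': "P \<noteq> []" "[] \<notin> set Cs" "set P \<union> \<Union> (set ` set Cs) = {0..int e}"
    "int (length P + sum_list (map length Cs)) = int e + 1" "{1..int e} \<subseteq> dist_steps (all_steps P Cs)"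
    by (auto simp: tour_def)
  define E where "E = int e"
  \<comment> \<open>The cycle closes through the far vertex \<open>- 1 - E - int k\<close>. The step
    reaching it stays on the lower side and has length \<open>E + 1\<close>, the zigzag gives
    \<open>E + 2..E + 2 * k\<close>, and the closing step has length
    \<open>2 * E + k + 2\<close>.\<close>
  let ?x = "zigzag (2 * k) (E + 1) (- 1) (-1)"
  let ?c = "?x @ [- 1 - E - int k]"
  have x: "?x \<noteq> []" "hd ?x = E + 1" "last ?x = - int k" using k by simp_all
  have cs: "cycle_steps ?c = insert (- 1 - E - int k, E + 1) (insert (- int k, - 1 - E - int k) (steps ?x))"
    using x by (auto simp: cycle_steps_eq steps_append)
  have cset: "set ?c = {E + 1..E + int k} \<union> {- int k..- 1} \<union> {- 1 - E - int k}"
    by auto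
  have dc: "dist_steps (cycle_steps ?c) = {2 * E + int k + 2, E + 1} \<union> {E + 2..E + 2 * int k}"
    unfolding cs dist_steps_simps using k E_def by (subst dist_steps_zigzag_in(3)) auto
  let ?f = "spread (- int k) (E + int k)"
  note goal = that
  \<comment> \<open>Common part of both parities. Besides the distances of the old labels and of the
    cycle: \<open>E + 2 * k + 1\<close> joins the old path to \<open>w\<close>, the spread
    \<open>w\<close> gives the range up to \<open>2 * E + k + 1\<close>, \<open>z2\<close> gives
    \<open>2 * E + k + 3..3 * E + 2 * k\<close>, the jumps \<open>J\<close> (to \<open>z1\<close>)
    and \<open>J'\<close> (from \<open>z1\<close> to \<open>z2\<close>) give the next two values in
    some order, and \<open>z1\<close> the rest.\<close>
  have main: thesis
    if blk: "block p q (t + k) [] 0" and p: "p + q = e + 1 - k" "p + k \<le> e" "q + k \<le> e + 1"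
      and z: "z1 \<noteq> []" "z2 \<noteq> []" "hd z1 - ?f (if q = p then int (t + k) - int p else int p - int (t + k)) \<in> {J, - J}"
        "hd z2 - last z1 \<in> {J', - J'}" "{J, J'} = {3 * E + 2 * int k + 1, 3 * E + 2 * int k + 2}" "0 \<le> J" "0 \<le> J'"
      and zs: "set z1 \<union> set z2 = {lo..- 1 - int k - int p} - {- 1 - E - int k} \<union> {E + int k + 1 + int q..hi}"
        "int (length z1 + length z2) = hi - lo + 1 - (E + 1 + int p + int q + 2 * int k + 1)"
      and ds: "dist_steps (steps z1) = {3 * E + 2 * int k + 3..hi - lo}"
        "dist_steps (steps z2) = {2 * E + int k + 3..3 * E + 2 * int k}"
      and lst: "last z2 = lo + (E + int t + 2 * int k)" "lo \<le> - 1 - E - int k" "E + int k + int q \<le> hi"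
      and hl: "hi - lo = int e'" "4 * e + 2 * t + 5 * k + 1 \<le> e'" "e' \<le> 4 * e + 2 * t + 5 * k + 2"
    for p q z1 z2 J J' lo hi e'
  proof -
    obtain w where q: "q = p \<or> q = Suc p" "t + k < q" and w: "tour (- int p) (int q - 1) {} w []"
      "crossing (all_steps w [])" "hd w = int (t + k)"
      "last w = (if q = p then int (t + k) - int p else int p - int (t + k))"
      using blk by (auto elim!: blockE)
    have w': "w \<noteq> []" "set w = {- int p..int q - 1}" "int (length w) = int p + int q"
      "{1..int p + int q - 1} \<subseteq> dist_steps (steps w)" "crossing (steps w)"
      using w by (auto simp: tour_def all_steps_def)
    let ?P = "P @ map ?f w @ z1 @ z2"
    have pq: "int p + int q = E + 1 - int k" using p le by (simp add: E_def)
    have fw: "set (map ?f w) = {- int k - int p..- int k - 1} \<union> {E + int k + 1..E + int k + int q}"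
      unfolding set_map w'(2) by (rule spread_image) auto
    have st: "steps ?P = steps P \<union> {(int t, E + 2 * int k + 1 + int t)} \<union> (map_prod ?f ?f ` steps w \<union>
       {(?f (last w), hd z1)} \<union> (steps z1 \<union> {(last z1, hd z2)} \<union> steps z2))"
      using P' w' z P(2) w(3) by (simp add: steps_append hd_map last_map steps_map spread_def algebra_simps)
    have dw: "dist_steps (map_prod ?f ?f ` steps w) \<supseteq> {E + 2 * int k + 2..2 * E + int k + 1}"
    proof
      fix d assume d: "d \<in> {E + 2 * int k + 2..2 * E + int k + 1}"
      have "dist_steps (map_prod ?f ?f ` steps w) = (\<lambda>d. d + (E + int k - - int k + 1)) ` dist_steps (steps w)"
        by (rule dist_steps_spread[OF w'(5)]) (simp add: E_def)
      moreover have "d - (E + int k - - int k + 1) \<in> dist_steps (steps w)"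
        using w'(4) d pq by auto
      ultimately show "d \<in> dist_steps (map_prod ?f ?f ` steps w)"
        by (metis (no_types, lifting) diff_add_cancel image_eqI)
    qed
    have jumps: "\<bar>?f (last w) - hd z1\<bar> = J" "\<bar>last z1 - hd z2\<bar> = J'"
      using z(3,4,6,7) unfolding w(4) by auto
    have "{1..int e'} \<subseteq> dist_steps (all_steps ?P (Cs @ [?c]))"
    proof
      fix d assume d: "d \<in> {1..int e'}"
      have *: "dist_steps (all_steps ?P (Cs @ [?c])) = dist_steps (all_steps P Cs) \<union> dist_steps (cycle_steps ?c)
        \<union> {E + 2 * int k + 1} \<union> dist_steps (map_prod ?f ?f ` steps w) \<union> {J, J'}
        \<union> {3 * E + 2 * int k + 3..hi - lo} \<union> {2 * E + int k + 3..3 * E + 2 * int k}"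
        unfolding all_steps_def st dist_steps_simps ds set_append image_Un Union_Un_distrib jumps
        by (auto simp: E_def)
      consider "d \<le> E" | "d = E + 1" | "E + 2 \<le> d" "d \<le> E + 2 * int k" | "d = E + 2 * int k + 1"
        | "E + 2 * int k + 2 \<le> d" "d \<le> 2 * E + int k + 1" | "d = 2 * E + int k + 2"
        | "2 * E + int k + 3 \<le> d" "d \<le> 3 * E + 2 * int k"
        | "d = 3 * E + 2 * int k + 1 \<or> d = 3 * E + 2 * int k + 2" | "3 * E + 2 * int k + 3 \<le> d"
        by linarith
      then show "d \<in> dist_steps (all_steps ?P (Cs @ [?c]))"
      proof cases
        case 1 then show ?thesis using d P'(5) unfolding * by (auto simp: E_def)
      next
        case 5 then show ?thesis using dw unfolding * by auto
      next
        case 8 then show ?thesis using z(5) unfolding * by blast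
      next
        case 9 then show ?thesis using d hl(1) unfolding * by auto
      qed (unfold * dc, auto)
    qed
    moreover have "set ?P \<union> \<Union> (set ` set (Cs @ [?c])) = {lo..hi}"
    proof -
      have "set ?P \<union> \<Union> (set ` set (Cs @ [?c])) = {0..E} \<union> set (map ?f w) \<union> set ?c \<union> (set z1 \<union> set z2)"
        unfolding E_def P'(3)[symmetric] by auto
      also have "\<dots> = {lo..hi}"
        unfolding fw zs(1) cset using lst(2,3) p(2,3) by (auto simp: E_def)
      finally show ?thesis .
    qed
    moreover have "int (length ?P + sum_list (map length (Cs @ [?c]))) = hi - lo + 1"
      using P'(4) w'(3) zs(2) by (simp add: E_def)
    ultimately have T: "tour lo hi {} ?P (Cs @ [?c])"
      using P' hl(1) unfolding tour_def by simp
    have "graceful e' (e + t + 2 * k) (add_mset (2 * k + 1) L)"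
      by (rule gracefulI[OF T hl(1)]) (use z lst(1) P(3) in \<open>auto simp: E_def\<close>)
    then show thesis using hl(2,3) by (rule goal)
  qed
  show thesis
  \<comment> \<open>The block next to the old labels has \<open>e + 1 - k\<close> labels, so this
    parity decides between \<open>q = p\<close> and \<open>q = p + 1\<close>; in the latter case
    \<open>exc\<close> rules out the impossible start \<open>t + k\<close>.\<close>
  proof (cases "even (e - k)")
    case False
    then obtain p' where "e - k = Suc (2 * p')" by (metis oddE Suc_eq_plus1)
    then obtain p where p: "e + 1 = 2 * p + k" "0 < p" using le by (intro that[of "Suc p'"]) auto
    then have E: "E = 2 * int p + int k - 1" by (simp add: E_def)
    have tp: "t + k < p" using le p by linarith
    \<comment> \<open>\<open>Y\<close> is determined by the jump \<open>3 * E + 2 * k + 1\<close>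
      from the end \<open>t - p\<close> of the spread block. The length \<open>m1\<close> then lets
      the first zigzag stop right beyond the far vertex of the cycle.\<close>
    define Y where "Y = 2 * E - int p + int t + int k"
    define m1 where "m1 = p + t + 2 * k"
    define m2 where "m2 = p + k - 1"
    have m: "int m1 = Y - E + 1" "int m2 = E - int p" "0 < m1" "0 < m2"
      using p k by (auto simp: m1_def m2_def Y_def E of_nat_diff)
    let ?z1 = "zigzag (2 * m1) (E + int k + 1 + Y) (- int k - 2 - Y) 1"
    let ?z2 = "zigzag (2 * m2) (2 * E + int k) (- int k - E) 1"
    have hl: "hd ?z1 = E + int k + 1 + Y" "last ?z1 = - int k - 2 - E" "hd ?z2 = 2 * E + int k"
      "last ?z2 = - int k - 1 - int p"
      using m by simp_all
    show thesis
    proof (rule main[of p p ?z1 ?z2 "3 * E + 2 * int k + 1" "3 * E + 2 * int k + 2" "- int k - 2 - Y" "E + int k + 1 + Y"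
        "4 * e + 2 * t + 5 * k + 2"])
      show "block p p (t + k) [] 0" using tp by (intro block_path) auto
      show "p + p = e + 1 - k" "p + k \<le> e" "p + k \<le> e + 1" using p tp by linarith+
      show "?z1 \<noteq> []" "?z2 \<noteq> []" using m by simp_all
      show "hd ?z1 - ?f (if p = p then int (t + k) - int p else int p - int (t + k)) \<in> {3 * E + 2 * int k + 1, - (3 * E + 2 * int k + 1)}"
        unfolding hl using tp by (simp add: spread_def Y_def)
      show "hd ?z2 - last ?z1 \<in> {3 * E + 2 * int k + 2, - (3 * E + 2 * int k + 2)}"
        unfolding hl by simp
      show "0 \<le> 3 * E + 2 * int k + 1" "0 \<le> 3 * E + 2 * int k + 2" by (simp_all add: E_def)
      show "set ?z1 \<union> set ?z2 = {- int k - 2 - Y..- 1 - int k - int p} - {- 1 - E - int k} \<union> {E + int k + 1 + int p..E + int k + 1 + Y}"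
        unfolding set_zigzag_even m using k p(2) by (auto simp: E Y_def)
      show "int (length ?z1 + length ?z2) = E + int k + 1 + Y - (- int k - 2 - Y) + 1 - (E + 1 + int p + int p + 2 * int k + 1)"
        using m by (simp add: E)
      show "dist_steps (steps ?z1) = {3 * E + 2 * int k + 3..E + int k + 1 + Y - (- int k - 2 - Y)}"
        using m by (subst dist_steps_zigzag_in(1)) (auto simp: E Y_def)
      show "dist_steps (steps ?z2) = {2 * E + int k + 3..3 * E + 2 * int k}"
        using m by (subst dist_steps_zigzag_in(1)) (auto simp: E)
      show "last ?z2 = - int k - 2 - Y + (E + int t + 2 * int k)"
        unfolding hl by (simp add: Y_def E)
      have "int e = E" by (simp add: E_def)
      then show "E + int k + 1 + Y - (- int k - 2 - Y) = int (4 * e + 2 * t + 5 * k + 2)"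
        by (simp add: Y_def E)
      show "- int k - 2 - Y \<le> - 1 - E - int k" "E + int k + int p \<le> E + int k + 1 + Y"
        using p(2) by (simp_all add: Y_def E)
    qed auto
  next
    case True
    then obtain p where "e - k = 2 * p" by blast
    then have p: "e = 2 * p + k" using le by linarith
    then have E: "E = 2 * int p + int k" by (simp add: E_def)
    have tp: "t + k < p" "p \<noteq> 2 * (t + k)" using le exc p by linarith+
    \<comment> \<open>The mirror situation: the block ends on the upper side, so the outer zigzag
      starts at the lowest label, and the two jumps exchange their lengths.\<close>
    define R where "R = 2 * E - int p + int t + int k"
    define m1 where "m1 = p + t + 2 * k"
    define m2 where "m2 = p + k - 1"
    have m: "int m1 = R - E" "int m2 = E - int p - 1" "0 < m1"
      using tp k by (auto simp: m1_def m2_def R_def E of_nat_diff)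
    let ?z1 = "zigzag (2 * m1) (- int k - 1 - R) (E + int k + R) (-1)"
    let ?z2 = "zigzag (Suc (2 * m2)) (- int k - E) (2 * E + int k) (-1)"
    have hl: "hd ?z1 = - int k - 1 - R" "last ?z1 = 2 * E + int k + 1" "hd ?z2 = - int k - E"
      "last ?z2 = - int k - 1 - int p"
      using m by simp_all
    show thesis
    proof (rule main[of p "Suc p" ?z1 ?z2 "3 * E + 2 * int k + 2" "3 * E + 2 * int k + 1" "- int k - 1 - R" "E + int k + R"
        "4 * e + 2 * t + 5 * k + 1"])
      show "block p (Suc p) (t + k) [] 0" using tp by (intro block_path) auto
      show "p + Suc p = e + 1 - k" "p + k \<le> e" "Suc p + k \<le> e + 1" using p tp by linarith+
      show "?z1 \<noteq> []" "?z2 \<noteq> []" using m by simp_all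
      show "hd ?z1 - ?f (if Suc p = p then int (t + k) - int p else int p - int (t + k)) \<in> {3 * E + 2 * int k + 2, - (3 * E + 2 * int k + 2)}"
        unfolding hl using tp by (simp add: spread_def R_def)
      show "hd ?z2 - last ?z1 \<in> {3 * E + 2 * int k + 1, - (3 * E + 2 * int k + 1)}"
        unfolding hl by simp
      show "0 \<le> 3 * E + 2 * int k + 1" "0 \<le> 3 * E + 2 * int k + 2" by (simp_all add: E_def)
      show "set ?z1 \<union> set ?z2 = {- int k - 1 - R..- 1 - int k - int p} - {- 1 - E - int k} \<union> {E + int k + 1 + int (Suc p)..E + int k + R}"
        unfolding set_zigzag_even set_zigzag_odd m using k by (auto simp: E R_def)
      show "int (length ?z1 + length ?z2) = E + int k + R - (- int k - 1 - R) + 1 - (E + 1 + int p + int (Suc p) + 2 * int k + 1)"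
        using m by (simp add: E)
      show "dist_steps (steps ?z1) = {3 * E + 2 * int k + 3..E + int k + R - (- int k - 1 - R)}"
        using m by (subst dist_steps_zigzag_in(2)) (auto simp: E R_def)
      show "dist_steps (steps ?z2) = {2 * E + int k + 3..3 * E + 2 * int k}"
        using m k by (subst dist_steps_zigzag_in(2)) (auto simp: E)
      show "last ?z2 = - int k - 1 - R + (E + int t + 2 * int k)"
        unfolding hl by (simp add: R_def E)
      have "int e = E" by (simp add: E_def)
      then show "E + int k + R - (- int k - 1 - R) = int (4 * e + 2 * t + 5 * k + 1)"
        by (simp add: R_def E)
      show "- int k - 1 - R \<le> - 1 - E - int k" "E + int k + int (Suc p) \<le> E + int k + R"
        using tp by (simp_all add: R_def E)
    qed auto
  qed
qed

section \<open>Quotient factors\<close>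

text \<open>\<open>Ds\<close> holds the cycles of length 2, which are treated differently from all
  others. \<open>S\<close> only bounds the remaining cycle distances from above: it suffices to
  compare \<open>S\<close> with its image under \<open>d\<close> to \<open>n - d\<close>.\<close>

definition partial :: "int set \<Rightarrow> int set \<Rightarrow> nat list \<Rightarrow> nat \<Rightarrow> nat \<Rightarrow> nat multiset \<Rightarrow> int set \<Rightarrow> bool" where
  "partial X D N e t L S \<longleftrightarrow>
     (\<exists>P Cs Ds. tour 0 (int e) X P (Cs @ Ds) \<and> last P = int t \<and> mset (map length Cs) = L \<and>
        cycle_dists Cs \<subseteq> S \<and> cycle_dists Ds = D \<and> map length Ds = N)"

lemma partial_mono: "partial X D N e t L S \<Longrightarrow> S \<subseteq> S' \<Longrightarrow> partial X D N e t L S'"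
  unfolding partial_def by blast

lemma graceful_imp_partial: "graceful e t L \<Longrightarrow> partial {} {} [] e t L {..int e}"
  unfolding partial_def graceful_def using tour_cycle_dists by fastforce

lemma dist_all_steps: "dist_steps (all_steps P Cs) = dist_steps (steps P) \<union> cycle_dists Cs"
  by (simp add: all_steps_def cycle_dists_def)

lemma partialI:
  assumes "tour a b X P (Cs @ Ds)" "b - a = int e" "last P = a + int t \<or> last P = b - int t"
    "mset (map length Cs) = L" "cycle_dists Cs \<subseteq> S" "cycle_dists Ds = D" "map length Ds = N"
  shows "partial X D N e t L S"
proof -
  obtain Q f where Q: "tour 0 (int e) X Q (map (map f) (Cs @ Ds))" "last Q = int t"
    and f: "\<And>Ds. [] \<notin> set Ds \<Longrightarrow> cycle_dists (map (map f) Ds) = cycle_dists Ds"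
    using tour_normalize[OF assms(1,2,3)] by metis
  have "[] \<notin> set Cs" "[] \<notin> set Ds" using assms(1) by (auto simp: tour_def)
  then show ?thesis unfolding partial_def using assms Q f
    by (intro exI[of _ Q] exI[of _ "map (map f) Cs"] exI[of _ "map (map f) Ds"]) simp_all
qed

lemma block_cycle_dists:
  assumes "crossing (all_steps w Cs)" "cycle_dists Cs \<subseteq> {..B}" "[] \<notin> set Cs" "a \<le> b + 1"
  shows "cycle_dists (map (map (spread a b)) Cs) \<subseteq> {b - a + 2..b - a + 1 + B}"
proof -
  have "d > 0" if "d \<in> cycle_dists Cs" for d
    using that cycle_dists_subset crossing_dist_pos[OF assms(1)] by blast
  then show ?thesis
    unfolding cycle_dists_spread[OF assms(1,4,3)] using assms(2) by fastforce
qed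

lemma partial_extend:
  assumes "partial X D N e t L S" "block p q t M B"
  shows "partial X D N (e + p + q) t (L + mset M) (S \<union> {int e + 2..int e + 1 + B})"
proof -
  obtain P Cs Ds where P: "tour 0 (int e) X P (Cs @ Ds)" "last P = int t" "mset (map length Cs) = L"
      "cycle_dists Cs \<subseteq> S" "cycle_dists Ds = D" "map length Ds = N"
    using assms(1) by (auto simp: partial_def)
  obtain w Es where q: "q = p \<or> q = Suc p" "t < q" and w: "tour (- int p) (int q - 1) {} w Es"
    "crossing (all_steps w Es)" "hd w = int t" "last w = (if q = p then int t - int p else int p - int t)"
    "map length Es = M" "cycle_dists Es \<subseteq> {..B}" "w \<noteq> []" "[] \<notin> set Es"
    using assms(2) by (rule blockE)
  have ne: "P \<noteq> []" using P(1) by (auto simp: tour_def)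
  let ?f = "spread 0 (int e)"
  have "tour (0 - int p) (int e + int q) X (P @ map ?f w) ((Cs @ Ds) @ map (map ?f) Es)"
    by (rule tour_extend[OF _ _ w(1,2)]) (use P w in \<open>auto simp: spread_def tour_def\<close>)
  then have t: "tour (0 - int p) (int e + int q) X (P @ map ?f w) ((Cs @ map (map ?f) Es) @ Ds)"
    by (rule tour_perm[rotated]) simp
  have "cycle_dists (map (map ?f) Es) \<subseteq> {int e + 2..int e + 1 + B}"
    using block_cycle_dists[OF w(2,6,8), of 0 "int e"] by simp
  then show ?thesis
    using P w ne q by (intro partialI[OF t]) (auto simp: last_map spread_def)
qed

text \<open>The cycle of length 2 joins two vertices at distance \<open>e + 2 t\<close>; the distance \<open>e + 2 t + c\<close> is left out.\<close>

lemma pair_gadget: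
  assumes G: "graceful e t L" and t: "3 \<le> t" and c: "c = 1 \<or> c = 2" and blk: "block p q (t - c) M B"
  shows "partial {int e + 2 * int t + int c} {int e + 2 * int t} [2] (e + 2 * t + 1 + p + q) (t - c) (L + mset M)
    ({..int e} \<union> {int e + 2 * int t + 3..int e + 2 * int t + 2 + B})"
proof -
  obtain P Cs where P: "tour 0 (int e) {} P Cs" "last P = int t" "mset (map length Cs) = L"
    using G by (auto simp: graceful_def)
  then have P': "P \<noteq> []" "[] \<notin> set Cs" "set P \<union> \<Union> (set ` set Cs) = {0..int e}"
    "int (length P + sum_list (map length Cs)) = int e + 1" "{1..int e} \<subseteq> dist_steps (all_steps P Cs)"
    by (auto simp: tour_def)
  \<comment> \<open>Fills the labels between the old ones and the pair. After reflection it runs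
    from \<open>2 - t\<close> to \<open>1\<close>; entering it from \<open>e + 1 + t\<close> costs
    \<open>e + 2 * t - 1\<close>, the first distance above its own ones.\<close>
  have "block (t - 1) (t - 1) (t - 3) [] 0"
    using t by (intro block_path) auto
  then obtain v where "tour (- int (t - 1)) (int (t - 1) - 1) {} v []" "crossing (all_steps v [])"
      "hd v = int (t - 3)" "last v = int (t - 3) - int (t - 1)"
    by (auto elim!: blockE)
  then have v: "tour (1 - int t) (int t - 2) {} v []" "crossing (all_steps v [])"
      "hd v = int t - 3" "last v = - 2"
    using t by (auto simp: of_nat_diff)
  define z where "z = map ((-) (-1)) v"
  have "tour (1 - int t) (int t - 2) {} z []"
    using tour_map_affine(1)[OF v(1), of "-1"] by (simp add: z_def)
  then have z: "set z = {- (int t - 1)..(int t - 1) - 1}" "int (length z) = 2 * int t - 2" "z \<noteq> []"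
      "{1..2 * int t - 3} \<subseteq> dist_steps (steps z)"
    by (auto simp: tour_def all_steps_def)
  have hz: "hd z = 2 - int t" "last z = 1"
    using v z(3) by (auto simp: z_def hd_map last_map)
  have cz: "crossing (steps z)"
    using crossing_transpose[OF v(2)] by (simp add: z_def steps_map all_steps_def)
  let ?f = "spread 0 (int e)"
  let ?Q = "P @ (int e + 1 + int t) # map ?f z" and ?pair = "[- int t, int e + int t]"
  have st: "steps ?Q = steps P \<union> {(int t, int e + 1 + int t)} \<union>
      insert (int e + 1 + int t, 2 - int t) (map_prod ?f ?f ` steps z)"
  proof -
    have "hd (map ?f z) = 2 - int t" using z(3) hz t by (simp add: hd_map spread_def)
    then have "steps ((int e + 1 + int t) # map ?f z)
        = insert (int e + 1 + int t, 2 - int t) (map_prod ?f ?f ` steps z)"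
      using z(3) by (simp add: steps_Cons steps_map)
    then show ?thesis using P' P(2) by (subst steps_append) simp_all
  qed
  have fz: "set (map ?f z) = {1 - int t..- 1} \<union> {int e + 1..int e + int t - 1}"
    unfolding set_map z(1) by (subst spread_image) (use t in auto)
  have lQ: "last ?Q = int e + 2" using z(3) hz by (simp add: last_map spread_def)
  have dz: "dist_steps (map_prod ?f ?f ` steps z) = (\<lambda>d. d + (int e - 0 + 1)) ` dist_steps (steps z)"
    by (rule dist_steps_spread[OF cz]) simp
  have pr: "cycle_dists [?pair] = {int e + 2 * int t}"
    by (auto simp: cycle_dists_def cycle_steps_def)
  obtain w Es where q: "q = p \<or> q = Suc p" "t - c < q" and w: "tour (- int p) (int q - 1) {} w Es"
    "crossing (all_steps w Es)" "hd w = int (t - c)"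
    "last w = (if q = p then int (t - c) - int p else int p - int (t - c))"
    "map length Es = M" "cycle_dists Es \<subseteq> {..B}" "w \<noteq> []" "[] \<notin> set Es"
    using blk by (rule blockE)
  let ?w = "map ((-) (-1)) w" and ?Es = "map (map ((-) (-1))) Es"
  have tw: "tour (- int q) (int p - 1) {} ?w ?Es"
    using tour_map_affine(1)[OF w(1), of "-1"] by (simp add: algebra_simps)
  have cw: "crossing (all_steps ?w ?Es)"
    unfolding all_steps_map[OF w(8)] by (rule crossing_transpose[OF w(2)])
  have w': "hd ?w = - 1 - int t + int c" "last ?w = (if q = p then int p - 1 - int t + int c else int t - int c - int q)"
      "?w \<noteq> []" "[] \<notin> set ?Es" "cycle_dists ?Es \<subseteq> {..B}" "map length ?Es = M"
    using w q c t by (auto simp: hd_map last_map of_nat_diff cycle_dists_reflect)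
  let ?a = "- int t" and ?b = "int e + int t + 1"
  let ?g = "spread ?a ?b"
  let ?X = "{int e + 2 * int t + int c}"
  \<comment> \<open>Of the two distances \<open>e + 2 * t + 1\<close> and
    \<open>e + 2 * t + 2\<close>, the joining step realises one and the other is left out; the start
    \<open>t - c\<close> of the outer block makes the choice.\<close>
  have conn: "\<bar>last ?Q - ?g (hd ?w)\<bar> = int e + 2 * int t + 3 - int c"
    unfolding w' lQ using t c by (auto simp: spread_def)
  have base: "tour ?a ?b (insert \<bar>last ?Q - ?g (hd ?w)\<bar> ?X) ?Q (Cs @ [?pair])"
  proof -
    have "{1..?b - ?a} \<subseteq> dist_steps (all_steps ?Q (Cs @ [?pair])) \<union> insert \<bar>last ?Q - ?g (hd ?w)\<bar> ?X"
    proof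
      fix d assume d: "d \<in> {1..?b - ?a}"
      have *: "dist_steps (all_steps ?Q (Cs @ [?pair])) = dist_steps (all_steps P Cs) \<union> {int e + 1, int e + 2 * int t - 1, int e + 2 * int t}
        \<union> dist_steps (map_prod ?f ?f ` steps z)"
      proof -
        have "\<bar>int t - (int e + 1 + int t)\<bar> = int e + 1" "\<bar>int e + 1 + int t - (2 - int t)\<bar> = int e + 2 * int t - 1"
          using t by simp_all
        then show ?thesis
          unfolding dist_all_steps st dist_steps_simps cycle_dists_append pr by (simp only:) blast
      qed
      have "d - (int e + 1) \<in> dist_steps (steps z)" if "int e + 1 < d" "d \<le> int e + 2 * int t - 2"
        using z(4) that by auto
      then have mid: "d \<in> dist_steps (map_prod ?f ?f ` steps z)" if "int e + 1 < d" "d \<le> int e + 2 * int t - 2"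
        unfolding dz using that by (intro image_eqI[of _ _ "d - (int e + 1)"]) auto
      consider "d \<le> int e" | "d = int e + 1" | "int e + 1 < d" "d \<le> int e + 2 * int t - 2" | "d = int e + 2 * int t - 1"
        | "d = int e + 2 * int t" | "d = int e + 2 * int t + 1"
        using d unfolding atLeastAtMost_iff by linarith
      then show "d \<in> dist_steps (all_steps ?Q (Cs @ [?pair])) \<union> insert \<bar>last ?Q - ?g (hd ?w)\<bar> ?X"
      proof cases
        case 1 then show ?thesis using d P'(5) unfolding * by auto
      next
        case 3 then show ?thesis using mid unfolding * by blast
      next
        case 6 then show ?thesis using c unfolding conn by auto
      qed (auto simp: *)
    qed
    moreover have "set ?Q \<union> \<Union> (set ` set (Cs @ [?pair])) = {?a..?b}"
    proof -
      have "set ?Q \<union> \<Union> (set ` set (Cs @ [?pair])) = {0..int e} \<union> insert (int e + 1 + int t) (set (map ?f z)) \<union> {- int t, int e + int t}"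
        unfolding P'(3)[symmetric] by auto
      also have "\<dots> = {?a..?b}" unfolding fz using t by auto
      finally show ?thesis .
    qed
    ultimately show ?thesis
      unfolding tour_def using P' z(2) by simp
  qed
  have "tour (?a - int q) (?b + int p) ?X (?Q @ map ?g ?w) ((Cs @ [?pair]) @ map (map ?g) ?Es)"
    using c conn by (intro tour_extend[OF base _ tw cw]) auto
  then have T: "tour (?a - int q) (?b + int p) ?X (?Q @ map ?g ?w) ((Cs @ map (map ?g) ?Es) @ [?pair])"
    by (rule tour_perm[rotated]) simp
  have ends: "last (?Q @ map ?g ?w) = ?g (last ?w)"
    using w'(3) by (simp add: last_map del: map_map)
  have "cycle_dists (map (map ?g) ?Es) \<subseteq> {int e + 2 * int t + 3..int e + 2 * int t + 2 + B}"
    using block_cycle_dists[OF cw w'(5,4), of ?a ?b] by (simp add: algebra_simps del: map_map)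
  moreover have "cycle_dists Cs \<subseteq> {..int e}" using tour_cycle_dists[OF P(1)] by simp
  ultimately have cd: "cycle_dists (Cs @ map (map ?g) ?Es) \<subseteq> {..int e} \<union> {int e + 2 * int t + 3..int e + 2 * int t + 2 + B}"
    unfolding cycle_dists_append by blast
  show ?thesis
  proof (rule partialI[OF T _ _ _ cd pr])
    show "?b + int p - (?a - int q) = int (e + 2 * t + 1 + p + q)" by simp
    show "last (?Q @ map ?g ?w) = ?a - int q + int (t - c) \<or> last (?Q @ map ?g ?w) = ?b + int p - int (t - c)"
      unfolding ends w'(2) using q c t by (auto simp: spread_def)
    show "mset (map length (Cs @ map (map ?g) ?Es)) = L + mset M"
      unfolding map_append map_length_map using P(3) w(5) by simp
  qed simp
qed

text \<open>Lifted to the integers modulo \<open>2 * n\<close>, the closing edge of a cycle in \<open>Cs\<close> may realise \<open>n - d\<close> instead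
  of its distance \<open>d\<close>; this is repaired on the path, so \<open>n - d\<close> must not occur on a cycle. A pair in \<open>Ds\<close>
  always realises both \<open>d\<close> and \<open>n - d\<close>.\<close>

definition quotient_factor :: "nat \<Rightarrow> int list \<Rightarrow> int list list \<Rightarrow> int list list \<Rightarrow> bool" where
  "quotient_factor n P Cs Ds \<longleftrightarrow> tour 0 (int n - 1) ((-) (int n) ` cycle_dists Ds) P (Cs @ Ds) \<and>
     (\<forall>d\<in>cycle_dists Cs. int n - d \<notin> cycle_dists (Cs @ Ds) \<and> d \<notin> cycle_dists Ds)"

text \<open>Two distances below \<open>n / 2\<close> cannot add up to \<open>n\<close>, so all
  complements of cycle distances lie on the path.\<close>

lemma quotient_factor_plain:
  assumes "partial {} {} [] e t L {..B}" "n = e + 1" "2 * B < int n"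
  shows "\<exists>P Cs. quotient_factor n P Cs [] \<and> mset (map length Cs) = L"
proof -
  obtain P Cs where P: "tour 0 (int e) {} P Cs" "mset (map length Cs) = L" "cycle_dists Cs \<subseteq> {..B}"
    using assms(1) unfolding partial_def by auto
  have "int n - d \<notin> cycle_dists Cs" if "d \<in> cycle_dists Cs" for d
  proof
    assume "int n - d \<in> cycle_dists Cs"
    with that P(3) have "int n - d \<le> B" "d \<le> B" by auto
    with assms(3) show False by linarith
  qed
  then have "quotient_factor n P Cs []"
    unfolding quotient_factor_def using P(1) assms(2) by (simp add: cycle_dists_def)
  then show ?thesis using P(2) by (intro exI conjI)
qed

lemma partial_grow:
  assumes "partial X D N e t L S" "2 * t + 2 \<le> s" "s \<noteq> 4 * t + 1"
  shows "partial X D N (e + s) t L S"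
proof -
  have "block (s div 2) ((s + 1) div 2) t [] (- 1)"
    using assms by (intro block_path) presburger+
  from partial_extend[OF assms(1) this]
  have "partial X D N (e + s div 2 + (s + 1) div 2) t L S" by simp
  moreover have "e + s div 2 + (s + 1) div 2 = e + s" by presburger
  ultimately show ?thesis by metis
qed

lemma quotient_factor_odd:
  assumes "graceful e t L" "2 * e < n" "e + 2 * t + 3 \<le> n" "n \<noteq> e + 4 * t + 2"
  shows "\<exists>P Cs. quotient_factor n P Cs [] \<and> mset (map length Cs) = L"
proof (rule quotient_factor_plain)
  have "partial {} {} [] (e + (n - 1 - e)) t L {..int e}"
    using assms by (intro partial_grow graceful_imp_partial) auto
  then show "partial {} {} [] (n - 1) t L {..int e}" using assms by simp
qed (use assms in auto)

lemma quotient_factor_even: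
  assumes "graceful e t L" and E: "\<forall>l\<in>set E. even l \<and> 4 \<le> l \<and> l div 2 < u" "u mod 3 \<noteq> 0"
    and T: "T = sum_list (map (half_size u) E)" "T \<le> t"
    and n: "2 * (e + 1 + 2 * T) < n" "e + 4 * t + 2 * u + 5 \<le> n" "n \<noteq> e + 6 * t + 2 * u + 4"
  shows "\<exists>P Cs. quotient_factor n P Cs [] \<and> mset (map length Cs) = L + mset E"
proof (rule quotient_factor_plain)
  \<comment> \<open>With this width, reversal turns the common start \<open>u\<close> of the even
    blocks into \<open>W - 1 - u = t\<close>, as the end of the inner path demands;
    \<open>T \<le> t\<close> makes the width sufficient.\<close>
  define W where "W = t + u + 1"
  have "block W W u E (2 * int T)"
    unfolding T(1) using E T by (intro even_blocks) (auto simp: W_def)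
  from block_reverse[OF this] have "block W W t E (2 * int T)" by (simp add: W_def)
  from partial_extend[OF graceful_imp_partial[OF assms(1)] this]
  have "partial {} {} [] (e + W + W) t (L + mset E) {..int e + 1 + 2 * int T}"
    by (rule partial_mono) auto
  then have "partial {} {} [] (e + W + W + (n - 1 - (e + W + W))) t (L + mset E) {..int e + 1 + 2 * int T}"
    by (rule partial_grow) (use n in \<open>auto simp: W_def\<close>)
  moreover have "e + W + W + (n - 1 - (e + W + W)) = n - 1" using n by (simp add: W_def)
  ultimately show "partial {} {} [] (n - 1) t (L + mset E) {..int e + 1 + 2 * int T}"
    by metis
qed (use n in auto)

text \<open>The core is first grown until \<open>n = 2 * e + 4 * t + c\<close>; then the omitted
  distance \<open>e + 2 * t + c\<close> is \<open>n\<close> minus that of the pair. Inner cycle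
  distances are at most \<open>e\<close>, and \<open>T + 2 \<le> t\<close> keeps the outer ones
  below \<open>n - e\<close>. As the outer ones also exceed \<open>n / 2\<close>, no two cycle
  distances add up to \<open>n\<close>.\<close>

lemma quotient_factor_pair:
  assumes "graceful e\<^sub>0 t L" and E: "\<forall>l\<in>set E. even l \<and> 4 \<le> l \<and> l div 2 < u" "u mod 3 \<noteq> 0"
    and T: "T = sum_list (map (half_size u) E)" "T + 2 \<le> t" "3 \<le> t"
    and c: "c = 1 \<or> c = 2" "even (n + c)"
    and n: "2 * e\<^sub>0 + 8 * t + 4 + c \<le> n" "n \<noteq> 2 * e\<^sub>0 + 12 * t + 2 + c" "12 * t + 4 * u + 12 \<le> n + 13 * c"
  shows "\<exists>P Cs Ds. quotient_factor n P Cs Ds \<and> mset (map length Cs) = L + mset E \<and> map length Ds = [2]"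
proof -
  define e where "e = (n - 4 * t - c) div 2"
  have ne: "n = 2 * e + 4 * t + c"
  proof -
    have "even (n - 4 * t - c)" "4 * t + c \<le> n" using c n(1) by auto
    then show ?thesis unfolding e_def by auto
  qed
  have "graceful (e\<^sub>0 + (e - e\<^sub>0)) t L"
  proof (rule graceful_grow[OF assms(1)])
    show "2 * t + 2 \<le> e - e\<^sub>0" using ne n(1) by linarith
    show "e - e\<^sub>0 \<noteq> 4 * t + 1" using ne n(1,2) by linarith
  qed
  moreover have "e\<^sub>0 + (e - e\<^sub>0) = e" using ne n(1) by linarith
  ultimately have G: "graceful e t L" by simp
  define W where "W = t - c + u + 1"
  have "block W W u E (2 * int T)"
    unfolding T(1)
  proof (rule even_blocks[OF E])
    show "sum_list (map (half_size u) E) + u < W"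
      using T c(1) unfolding W_def by linarith
  qed
  from block_reverse[OF this] have "block W W (t - c) E (2 * int T)" by (simp add: W_def)
  note pair_gadget[OF G T(3) c(1) this]
  define S where "S = {..int e} \<union> {int e + 2 * int t + 3..int e + 2 * int t + 2 + 2 * int T}"
  define e' where "e' = e + 2 * t + 1 + W + W"
  have "partial {int e + 2 * int t + int c} {int e + 2 * int t} [2] e' (t - c) (L + mset E) S"
    unfolding e'_def S_def by fact
  then have "partial {int e + 2 * int t + int c} {int e + 2 * int t} [2] (e' + (n - 1 - e')) (t - c) (L + mset E) S"
  proof (rule partial_grow)
    have "4 * (t - c) + 2 \<le> n - 1 - e'"
      using n(3) ne c T(3) unfolding e'_def W_def by linarith
    then show "2 * (t - c) + 2 \<le> n - 1 - e'" "n - 1 - e' \<noteq> 4 * (t - c) + 1" by linarith+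
  qed
  moreover have "e' + (n - 1 - e') = n - 1"
    using n(3) ne c T(3) unfolding e'_def W_def by linarith
  ultimately have "partial {int e + 2 * int t + int c} {int e + 2 * int t} [2] (n - 1) (t - c) (L + mset E) S"
    by metis
  then have "\<exists>P Cs Ds. tour 0 (int (n - 1)) {int e + 2 * int t + int c} P (Cs @ Ds) \<and>
      mset (map length Cs) = L + mset E \<and> cycle_dists Cs \<subseteq> S \<and>
      cycle_dists Ds = {int e + 2 * int t} \<and> map length Ds = [2]"
    unfolding partial_def
    by (elim exE conjE) (rule exI, rule exI, rule exI, intro conjI, assumption+)
  then obtain P Cs Ds where P: "tour 0 (int (n - 1)) {int e + 2 * int t + int c} P (Cs @ Ds)"
      "mset (map length Cs) = L + mset E" "cycle_dists Cs \<subseteq> S" "cycle_dists Ds = {int e + 2 * int t}" "map length Ds = [2]"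
    by (elim exE conjE) (rule that)
  have n': "int n = 2 * int e + 4 * int t + int c" using ne by simp
  have "int n - d \<notin> cycle_dists (Cs @ Ds) \<and> d \<notin> cycle_dists Ds" if "d \<in> cycle_dists Cs" for d
  proof -
    have "d \<in> S" using that P by blast
    then have "int n - d \<notin> S" "int n - d \<noteq> int e + 2 * int t" "d \<noteq> int e + 2 * int t"
      unfolding S_def n' using c T by auto
    then show ?thesis using P by auto
  qed
  moreover have "(-) (int n) ` cycle_dists Ds = {int e + 2 * int t + int c}"
    unfolding P n' by simp
  moreover have "int (n - 1) = int n - 1" using n by simp
  ultimately show ?thesis unfolding quotient_factor_def using P by metis
qed

section \<open>Chains of odd cycles and the size estimates\<close>

definition odd_lengths :: "nat list \<Rightarrow> nat multiset" where
  "odd_lengths ks = mset (map (\<lambda>k. 2 * k + 1) ks)"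

text \<open>The invariant sustains itself: \<open>3 * t \<le> e\<close> and
  \<open>12 * K + 5 \<le> e\<close> leave room for the next cycle and give
  \<open>4 * e + 2 * t + 5 * k + 2 \<le> 7 * e\<close>, while \<open>e \<le> 4 * t + 2\<close>
  excludes the exceptional size \<open>e = 4 * t + 5 * k\<close>.\<close>

lemma odd_chain:
  assumes "ks \<noteq> []" "\<forall>k\<in>set ks. 0 < k \<and> k \<le> K"
  shows "\<exists>e t. graceful e t (odd_lengths ks) \<and> 3 * t \<le> e \<and> e \<le> 4 * t + 2 \<and> 12 * K + 5 \<le> e \<and>
           e \<le> 7 ^ (length ks - 1) * (17 * K + 10)"
  using assms
proof (induction ks rule: list_nonempty_induct)
  case (single k)
  \<comment> \<open>The least size with room for any of the cycles, raised by one if it is the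
    exceptional size for path end 0. One gadget leads to at most
    \<open>4 * (3 * K + 2) + 5 * K + 2 = 17 * K + 10\<close>.\<close>
  define e where "e = (if 3 * K + 1 = 5 * k then 3 * K + 2 else 3 * K + 1)"
  have e: "3 * K + 1 \<le> e" "e \<le> 3 * K + 2" "4 * (0 + k) \<noteq> e - k" "2 * 0 + 3 * k + 1 \<le> e"
    using single by (auto simp: e_def)
  from single obtain e' where e': "graceful e' (e + 0 + 2 * k) (add_mset (2 * k + 1) {#})"
      "4 * e + 2 * 0 + 5 * k + 1 \<le> e'" "e' \<le> 4 * e + 2 * 0 + 5 * k + 2"
    using odd_cycle_gadget[OF graceful_zigzag _ e(4,3)] by auto
  have k: "0 < k" "k \<le> K" using single by auto
  have "3 * (e + 2 * k) \<le> e'" "e' \<le> 4 * (e + 2 * k) + 2" "12 * K + 5 \<le> e'" "e' \<le> 17 * K + 10"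
    using e(1,2) e'(2,3) k by auto
  then show ?case
    using e'(1) by (intro exI[of _ e'] exI[of _ "e + 2 * k"]) (auto simp: odd_lengths_def)
next
  case (cons k ks)
  then obtain e t where G: "graceful e t (odd_lengths ks)" and et: "3 * t \<le> e" "e \<le> 4 * t + 2" "12 * K + 5 \<le> e"
      "e \<le> 7 ^ (length ks - 1) * (17 * K + 10)" by auto
  have k: "0 < k" "k \<le> K" using cons.prems by auto
  have "2 * t + 3 * k + 1 \<le> e" "4 * (t + k) \<noteq> e - k" using et k by auto
  then obtain e' where e': "graceful e' (e + t + 2 * k) (add_mset (2 * k + 1) (odd_lengths ks))"
      "4 * e + 2 * t + 5 * k + 1 \<le> e'" "e' \<le> 4 * e + 2 * t + 5 * k + 2"
    using odd_cycle_gadget[OF G k(1)] by auto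
  obtain m where m: "length ks = Suc m" using cons.hyps by (cases ks) auto
  have "e' \<le> 7 * e" using et(1,3) k e'(3) by auto
  also have "\<dots> \<le> 7 ^ (length (k # ks) - 1) * (17 * K + 10)" using et(4) by (simp add: m)
  finally have "e' \<le> 7 ^ (length (k # ks) - 1) * (17 * K + 10)" .
  moreover have "3 * (e + t + 2 * k) \<le> e'" "e' \<le> 4 * (e + t + 2 * k) + 2" "12 * K + 5 \<le> e'"
    using e'(2,3) et(1-3) k by auto
  ultimately show ?case
    using e'(1) by (intro exI[of _ e'] exI[of _ "e + t + 2 * k"]) (auto simp: odd_lengths_def)
qed

text \<open>Of four consecutive sizes before the last odd cycle, one is ruled out by the parity exception of
  path blocks and one by that of the odd cycle; of the two remaining ones at least one avoids \<open>N\<close>.\<close>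

lemma odd_last:
  assumes fam: "\<And>x. m \<le> x \<Longrightarrow> x \<noteq> z \<Longrightarrow> graceful x t L" and k: "0 < k" and m: "2 * t + 3 * k + 1 \<le> m"
    and T: "T \<le> M" "m \<le> M" and a: "0 < a"
  shows "\<exists>e t'. graceful e t' (add_mset (2 * k + 1) L) \<and> T \<le> t' \<and> a * e + b * t' \<noteq> N \<and>
           e \<le> 4 * M + 2 * t + 5 * k + 14 \<and> t' \<le> M + 3 + t + 2 * k"
proof -
  define ok where "ok x \<longleftrightarrow> x \<noteq> z \<and> x \<noteq> k + 4 * (t + k)" for x
  have ok: "x \<noteq> z" "4 * (t + k) \<noteq> x - k" if "ok x" for x
    using that k unfolding ok_def by auto
  have "\<exists>x y. M \<le> x \<and> x < y \<and> y \<le> M + 3 \<and> ok x \<and> ok y"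
  proof -
    have *: "ok x \<or> ok y \<or> ok w" if "x < y" "y < w" for x y w
      using that unfolding ok_def by auto
    consider "ok M" "ok (M + 1)" | "ok M" "ok (M + 2)" | "ok M" "ok (M + 3)"
      | "ok (M + 1)" "ok (M + 2)" | "ok (M + 1)" "ok (M + 3)" | "ok (M + 2)" "ok (M + 3)"
    proof -
      have "ok M \<or> ok (M + 1) \<or> ok (M + 2)" "ok M \<or> ok (M + 1) \<or> ok (M + 3)"
        "ok M \<or> ok (M + 2) \<or> ok (M + 3)" "ok (M + 1) \<or> ok (M + 2) \<or> ok (M + 3)"
        by (rule *; simp)+
      then show thesis using that by blast
    qed
    then show ?thesis
    proof cases
      case 1 then show ?thesis by (intro exI[of _ M] exI[of _ "M + 1"]) simp
    next
      case 2 then show ?thesis by (intro exI[of _ M] exI[of _ "M + 2"]) simp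
    next
      case 3 then show ?thesis by (intro exI[of _ M] exI[of _ "M + 3"]) simp
    next
      case 4 then show ?thesis by (intro exI[of _ "M + 1"] exI[of _ "M + 2"]) simp
    next
      case 5 then show ?thesis by (intro exI[of _ "M + 1"] exI[of _ "M + 3"]) simp
    next
      case 6 then show ?thesis by (intro exI[of _ "M + 2"] exI[of _ "M + 3"]) simp
    qed
  qed
  then obtain x y where xy: "M \<le> x" "x < y" "y \<le> M + 3" "ok x" "ok y" by blast
  have gad: "\<exists>e. graceful e (x + t + 2 * k) (add_mset (2 * k + 1) L) \<and> 4 * x + 2 * t + 5 * k + 1 \<le> e \<and>
      e \<le> 4 * x + 2 * t + 5 * k + 2" if x: "ok x" "M \<le> x" for x
  proof -
    have "graceful x t L" using x T ok by (intro fam) auto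
    moreover have "2 * t + 3 * k + 1 \<le> x" using x(2) m T(2) by linarith
    ultimately obtain e where "graceful e (x + t + 2 * k) (add_mset (2 * k + 1) L)"
      "4 * x + 2 * t + 5 * k + 1 \<le> e" "e \<le> 4 * x + 2 * t + 5 * k + 2"
      using odd_cycle_gadget[of x t L k] ok(2)[OF x(1)] k by blast
    then show ?thesis by blast
  qed
  obtain e1 where e1: "graceful e1 (x + t + 2 * k) (add_mset (2 * k + 1) L)" "4 * x + 2 * t + 5 * k + 1 \<le> e1"
    "e1 \<le> 4 * x + 2 * t + 5 * k + 2" using gad[of x] xy by auto
  obtain e2 where e2: "graceful e2 (y + t + 2 * k) (add_mset (2 * k + 1) L)" "4 * y + 2 * t + 5 * k + 1 \<le> e2"
    "e2 \<le> 4 * y + 2 * t + 5 * k + 2" using gad[of y] xy by auto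
  have "e1 < e2" using e1 e2 xy by linarith
  then have "a * e1 < a * e2" using a by simp
  moreover have "b * (x + t + 2 * k) \<le> b * (y + t + 2 * k)" using xy by simp
  ultimately have "a * e1 + b * (x + t + 2 * k) \<noteq> N \<or> a * e2 + b * (y + t + 2 * k) \<noteq> N" by linarith
  then show ?thesis
  proof
    assume "a * e1 + b * (x + t + 2 * k) \<noteq> N"
    then show ?thesis using e1 xy T by (intro exI[of _ e1] exI[of _ "x + t + 2 * k"]) auto
  next
    assume "a * e2 + b * (y + t + 2 * k) \<noteq> N"
    then show ?thesis using e2 xy T by (intro exI[of _ e2] exI[of _ "y + t + 2 * k"]) auto
  qed
qed

text \<open>\<open>T\<close> is the path end required by the remaining cycles; the excluded value
  \<open>N\<close> later stands for an impossible path block. The factor 84 clears the denominators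
  in \<open>e \<le> 17 * q / 28\<close>, valid before the last cycle, and
  \<open>t \<le> e / 3\<close>.\<close>

lemma odd_cycles:
  assumes ks: "ks \<noteq> []" "\<forall>k\<in>set ks. 0 < k \<and> k \<le> K" and a: "0 < a"
    and q: "q = 7 ^ (length ks - 1) * (4 * K + 3)"
  shows "\<exists>e t. graceful e t (odd_lengths ks) \<and> T \<le> t \<and> a * e + b * t \<noteq> N \<and>
     84 * e \<le> 336 * T + 412 * q + 406 \<and> 84 * t \<le> 84 * T + 108 * q + 294 \<and>
     84 * (e + 4 * t) \<le> 672 * T + 838 * q + 1876"
proof -
  obtain k ks' where ks': "ks = k # ks'" using ks(1) by (cases ks) auto
  have k: "0 < k" "k \<le> K" using ks ks' by auto
  show ?thesis
  proof (cases "ks' = []")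
    case True
    obtain M where M: "T \<le> M" "3 * K + 1 \<le> M" "M \<le> T + (3 * K + 1)"
      by (rule that[of "max T (3 * K + 1)"]) auto
    have "\<exists>e t'. graceful e t' (add_mset (2 * k + 1) {#}) \<and> T \<le> t' \<and> a * e + b * t' \<noteq> N \<and>
           e \<le> 4 * M + 2 * 0 + 5 * k + 14 \<and> t' \<le> M + 3 + 0 + 2 * k"
    proof (rule odd_last)
      show "graceful x 0 {#}" for x by (rule graceful_zigzag)
      show "2 * 0 + 3 * k + 1 \<le> 3 * K + 1" using k by auto
    qed (use k a M in auto)
    then obtain e t' where r: "graceful e t' (add_mset (2 * k + 1) {#})" "T \<le> t'" "a * e + b * t' \<noteq> N"
        "e \<le> 4 * M + 2 * 0 + 5 * k + 14" "t' \<le> M + 3 + 0 + 2 * k"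
      by blast
    have "q = 4 * K + 3" using q True ks' by simp
    then have "84 * e \<le> 336 * T + 412 * q + 406" "84 * t' \<le> 84 * T + 108 * q + 294"
      "84 * (e + 4 * t') \<le> 672 * T + 838 * q + 1876" using r(4,5) k M(3) by auto
    then show ?thesis using r True ks' by (intro exI[of _ e] exI[of _ t']) (simp add: odd_lengths_def)
  next
    case False
    then obtain e t where G: "graceful e t (odd_lengths ks')" and et: "3 * t \<le> e" "12 * K + 5 \<le> e"
        "e \<le> 7 ^ (length ks' - 1) * (17 * K + 10)"
      using odd_chain[of ks' K] ks ks' by auto
    \<comment> \<open>From here on the chain can be grown to every size but one, as the preceding
      lemma requires of its family.\<close>
    define m where "m = e + 2 * t + 2"
    obtain M' where M: "T \<le> M'" "m \<le> M'" "M' \<le> T + m"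
      by (rule that[of "max T m"]) auto
    have "\<exists>e' t'. graceful e' t' (add_mset (2 * k + 1) (odd_lengths ks')) \<and> T \<le> t' \<and> a * e' + b * t' \<noteq> N \<and>
           e' \<le> 4 * M' + 2 * t + 5 * k + 14 \<and> t' \<le> M' + 3 + t + 2 * k"
    proof (rule odd_last)
      show "graceful x t (odd_lengths ks')" if "m \<le> x" "x \<noteq> e + (4 * t + 1)" for x
        using graceful_grow[OF G, of "x - e"] that by (auto simp: m_def)
      show "2 * t + 3 * k + 1 \<le> m" using et k by (auto simp: m_def)
    qed (use k a M in auto)
    then obtain e' t' where r: "graceful e' t' (add_mset (2 * k + 1) (odd_lengths ks'))" "T \<le> t'" "a * e' + b * t' \<noteq> N"
        "e' \<le> 4 * M' + 2 * t + 5 * k + 14" "t' \<le> M' + 3 + t + 2 * k"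
      by blast
    obtain j where j: "length ks' = Suc j" using False by (cases ks') auto
    have "28 * e \<le> 17 * q"
    proof -
      have "4 * e \<le> 4 * (7 ^ j * (17 * K + 10))" using et(3) by (simp add: j)
      also have "\<dots> = 7 ^ j * (4 * (17 * K + 10))" by (simp only: mult.left_commute)
      also have "\<dots> \<le> 7 ^ j * (17 * (4 * K + 3))" by (intro mult_left_mono) auto
      also have "\<dots> = 17 * (7 ^ j * (4 * K + 3))" by (simp only: mult.left_commute)
      finally show ?thesis unfolding q ks' by (simp add: j)
    qed
    moreover have "7 * (4 * K + 3) \<le> q"
    proof -
      have "1 * (7 * (4 * K + 3)) \<le> 7 ^ j * (7 * (4 * K + 3))" by (intro mult_right_mono) auto
      also have "\<dots> = q" unfolding q ks' by (simp add: j)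
      finally show ?thesis by (simp only: mult_1)
    qed
    ultimately have "84 * e' \<le> 336 * T + 412 * q + 406" "84 * t' \<le> 84 * T + 108 * q + 294"
      "84 * (e' + 4 * t') \<le> 672 * T + 838 * q + 1876" using r(4,5) k et(1) m_def M(3) by auto
    then show ?thesis using r ks' by (intro exI[of _ e'] exI[of _ t']) (simp add: odd_lengths_def)
  qed
qed

lemma half_size_le:
  assumes "even l"
  shows "4 * half_size u l \<le> 4 * u + l + 6"
proof (cases "4 dvd l")
  case False
  with assms have "4 * (l div 4) + 2 \<le> l" by presburger
  with False show ?thesis by (simp add: half_size_def)
qed (auto simp: half_size_def)

lemma sum_half_size_le:
  assumes "\<forall>l\<in>set E. even l \<and> l \<le> m" "2 * u \<le> m + 4"
  shows "4 * sum_list (map (half_size u) E) \<le> 3 * (length E * m) + 14 * length E"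
  using assms(1)
proof (induction E)
  case (Cons l E)
  then show ?case using half_size_le[of l u] assms(2) by auto
qed auto

text \<open>\<open>A\<close> measures the even cycles and \<open>Q\<close> the odd ones. The bounds
  \<open>1 \<le> A\<close> and \<open>3 \<le> Q\<close> supply the slack when one kind is absent;
  they correspond to the maxima with 1 and 3 in the bound on \<open>h\<close>.\<close>

lemma quotient_factor_exists:
  assumes E: "\<forall>l\<in>set E. even l \<and> 4 \<le> l \<and> l \<le> m" and ks: "\<forall>k\<in>set ks. 0 < k \<and> k \<le> K"
    and A: "1 \<le> A" "E \<noteq> [] \<Longrightarrow> 2 * (length E * (m + 3)) \<le> A + 1"
    and Q: "3 \<le> Q" "ks \<noteq> [] \<Longrightarrow> 7 ^ (length ks + length N - 1) * (4 * K + 3) \<le> Q"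
    and N: "N = [] \<or> N = [2]" and n: "8 * A + 10 * Q + 14 + sum_list N \<le> n"
  shows "\<exists>P Cs Ds. quotient_factor n P Cs Ds \<and> mset (map length Cs) = odd_lengths ks + mset E \<and>
           map length Ds = N"
proof -
  \<comment> \<open>For even cycles this is the least number above \<open>m div 2\<close> that is
    not a multiple of 3.\<close>
  define u where "u = (if E = [] then 1 else if (m div 2 + 1) mod 3 = 0 then m div 2 + 2 else m div 2 + 1)"
  have u: "u mod 3 \<noteq> 0" "\<forall>l\<in>set E. even l \<and> 4 \<le> l \<and> l div 2 < u"
  proof -
    show "u mod 3 \<noteq> 0" unfolding u_def by (simp, presburger)
    show "\<forall>l\<in>set E. even l \<and> 4 \<le> l \<and> l div 2 < u"
    proof (intro ballI conjI)
      fix l assume l: "l \<in> set E"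
      then have "l div 2 \<le> m div 2" using E by (intro div_le_mono) auto
      then show "l div 2 < u" using l unfolding u_def by auto
    qed (use E in auto)
  qed
  define T\<^sub>0 where "T\<^sub>0 = sum_list (map (half_size u) E)"
  define a where "a = length E"
  define X where "X = a * m"
  have ev: "4 * T\<^sub>0 \<le> 3 * X + 14 * a" "4 * a \<le> X" "m \<le> X" "2 * X + 6 * a \<le> A + 1" "2 * u \<le> m + 4" "1 \<le> a"
    if "E \<noteq> []"
  proof -
    show "1 \<le> a" using that by (cases E) (auto simp: a_def)
    have "4 \<le> m" using E that by (cases E) auto
    then show "4 * a \<le> X" by (simp add: X_def)
    show "m \<le> X" using \<open>1 \<le> a\<close> by (simp add: X_def)
    show u4: "2 * u \<le> m + 4" unfolding u_def using that by auto
    show "4 * T\<^sub>0 \<le> 3 * X + 14 * a"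
      using sum_half_size_le[of E m u] E u4 by (auto simp: T\<^sub>0_def X_def a_def)
    show "2 * X + 6 * a \<le> A + 1" using A(2)[OF that] by (simp add: X_def a_def algebra_simps)
  qed
  have no_ev: "T\<^sub>0 = 0" "u = 1" if "E = []" using that by (auto simp: T\<^sub>0_def u_def)
  define q where "q = 7 ^ (length ks - 1) * (4 * K + 3)"
  have q: "7 \<le> q" if "ks \<noteq> []"
  proof -
    have "1 \<le> K" using ks that by (cases ks) auto
    then have "1 * 7 \<le> q" unfolding q_def by (intro mult_le_mono) auto
    then show ?thesis by simp
  qed
  from N show ?thesis
  proof
    assume N: "N = []"
    have Qq: "q \<le> Q" if "ks \<noteq> []" using Q(2)[OF that] by (simp add: N q_def)
    show ?thesis
    proof (cases "E = []")
      case True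
      have "\<exists>e t. graceful e t (odd_lengths ks) \<and> 2 * e < n \<and> e + 2 * t + 3 \<le> n \<and> n \<noteq> e + 4 * t + 2"
      proof (cases "ks = []")
        case True
        have "graceful 0 0 (odd_lengths ks)"
          using graceful_zigzag[of 0] by (simp add: True odd_lengths_def)
        then show ?thesis using n A(1) by (intro exI[of _ 0]) auto
      next
        case False
        from odd_cycles[OF False ks _ q_def, of 1 0 4 "n - 2"]
        obtain e t where "graceful e t (odd_lengths ks)" "1 * e + 4 * t \<noteq> n - 2"
          "84 * e \<le> 336 * 0 + 412 * q + 406" "84 * t \<le> 84 * 0 + 108 * q + 294" by auto
        then show ?thesis using n A(1) Qq[OF False] by (intro exI[of _ e] exI[of _ t]) auto
      qed
      then show ?thesis using quotient_factor_odd[of _ _ "odd_lengths ks" n] True N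
        by fastforce
    next
      case False
      note ev = ev[OF False]
      have "\<exists>e t. graceful e t (odd_lengths ks) \<and> T\<^sub>0 \<le> t \<and> 2 * (e + 1 + 2 * T\<^sub>0) < n \<and> e + 4 * t + 2 * u + 5 \<le> n \<and>
          n \<noteq> e + 6 * t + 2 * u + 4"
      proof (cases "ks = []")
        case True
        \<comment> \<open>The excluded value of \<open>n\<close> depends on \<open>t\<close> and is
          left by raising \<open>t\<close> by one.\<close>
        define t where "t = (if n = 2 * T\<^sub>0 + 6 * T\<^sub>0 + 2 * u + 4 then T\<^sub>0 + 1 else T\<^sub>0)"
        have "graceful (2 * t) t (odd_lengths ks)"
          using graceful_center[of t] by (simp add: True odd_lengths_def)
        moreover have "T\<^sub>0 \<le> t" "t \<le> T\<^sub>0 + 1" "n \<noteq> 2 * t + 6 * t + 2 * u + 4" by (auto simp: t_def)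
        ultimately show ?thesis using n ev Q(1) by (intro exI[of _ "2 * t"] exI[of _ t]) auto
      next
        case False
        from odd_cycles[OF False ks _ q_def, of 1 T\<^sub>0 6 "n - (2 * u + 4)"]
        obtain e t where "graceful e t (odd_lengths ks)" "1 * e + 6 * t \<noteq> n - (2 * u + 4)" "T\<^sub>0 \<le> t"
          "84 * e \<le> 336 * T\<^sub>0 + 412 * q + 406" "84 * (e + 4 * t) \<le> 672 * T\<^sub>0 + 838 * q + 1876" by auto
        then show ?thesis using n ev Qq[OF False] q[OF False] by (intro exI[of _ e] exI[of _ t]) auto
      qed
      then obtain e t where "graceful e t (odd_lengths ks)" "T\<^sub>0 \<le> t" "2 * (e + 1 + 2 * T\<^sub>0) < n"
        "e + 4 * t + 2 * u + 5 \<le> n" "n \<noteq> e + 6 * t + 2 * u + 4" by blast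
      from quotient_factor_even[OF this(1) u(2,1) T\<^sub>0_def this(2-)] show ?thesis using N by fastforce
    qed
  next
    assume N: "N = [2]"
    define c :: nat where "c = (if even n then 2 else 1)"
    have c: "c = 1 \<or> c = 2" "even (n + c)" by (auto simp: c_def)
    \<comment> \<open>The cycle of length 2 also counts in the exponent; the factor 7 gained pays
      for the size \<open>2 * e + 8 * t\<close> that the pair requires.\<close>
    have Qq: "7 * q \<le> Q" if "ks \<noteq> []"
    proof -
      have "length ks = Suc (length ks - 1)" using that by (cases ks) auto
      then have "7 ^ length ks = 7 * (7 ^ (length ks - 1) :: nat)" by (metis power_Suc)
      then show ?thesis using Q(2)[OF that] by (simp add: N q_def mult.assoc)
    qed
    have "\<exists>e t. graceful e t (odd_lengths ks) \<and> T\<^sub>0 + 2 \<le> t \<and> 3 \<le> t \<and> 2 * e + 8 * t + 4 + c \<le> n \<and>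
        n \<noteq> 2 * e + 12 * t + 2 + c \<and> 12 * t + 4 * u + 12 \<le> n + 13 * c"
    proof (cases "ks = []")
      case True
      define t\<^sub>0 where "t\<^sub>0 = max (T\<^sub>0 + 2) 3"
      define t where "t = (if n = 2 * (2 * t\<^sub>0) + 12 * t\<^sub>0 + 2 + c then t\<^sub>0 + 1 else t\<^sub>0)"
      have g: "graceful (2 * t) t (odd_lengths ks)"
        using graceful_center[of t] by (simp add: True odd_lengths_def)
      have t: "t\<^sub>0 \<le> t" "t \<le> t\<^sub>0 + 1" "n \<noteq> 2 * (2 * t) + 12 * t + 2 + c" by (auto simp: t_def)
      have t0: "T\<^sub>0 + 2 \<le> t\<^sub>0" "3 \<le> t\<^sub>0" "t\<^sub>0 \<le> T\<^sub>0 + 3" by (auto simp: t\<^sub>0_def)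
      show ?thesis
      proof (cases "E = []")
        case True
        have "t\<^sub>0 = 3" using no_ev[OF True] by (simp add: t\<^sub>0_def)
        moreover have "54 \<le> n" using n A(1) Q(1) N by simp
        moreover have "55 \<le> n" if "c = 1" using that \<open>54 \<le> n\<close> unfolding c_def by (cases "n = 54") auto
        ultimately show ?thesis using g t no_ev[OF True] c(1)
          by (intro exI[of _ "2 * t"] exI[of _ t]) auto
      next
        case False
        then show ?thesis using g t t0 n ev[OF False] Q(1) N c(1) by (intro exI[of _ "2 * t"] exI[of _ t]) auto
      qed
    next
      case False
      from odd_cycles[OF False ks _ q_def, of 2 "T\<^sub>0 + 3" 12 "n - (2 + c)"]
      obtain e t where et: "graceful e t (odd_lengths ks)" "2 * e + 12 * t \<noteq> n - (2 + c)" "T\<^sub>0 + 3 \<le> t"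
        "84 * e \<le> 336 * (T\<^sub>0 + 3) + 412 * q + 406" "84 * t \<le> 84 * (T\<^sub>0 + 3) + 108 * q + 294" by auto
      have "8 * A + 70 * q + 14 \<le> n" using n Qq[OF False] by simp
      moreover have "7 \<le> q" by (rule q[OF False])
      ultimately have "2 * e + 8 * t + 4 + c \<le> n" "12 * t + 4 * u + 12 \<le> n + 13 * c"
        using ev no_ev et(4,5) c(1) A(1) by (cases "E = []"; auto)+
      then show ?thesis using et by (intro exI[of _ e] exI[of _ t]) auto
    qed
    then obtain e t where "graceful e t (odd_lengths ks)" "T\<^sub>0 + 2 \<le> t" "3 \<le> t" "2 * e + 8 * t + 4 + c \<le> n"
      "n \<noteq> 2 * e + 12 * t + 2 + c" "12 * t + 4 * u + 12 \<le> n + 13 * c" by blast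
    from quotient_factor_pair[OF this(1) u(2,1) T\<^sub>0_def this(2,3) c this(4-)] show ?thesis
      using N by fastforce
  qed
qed

section \<open>Cycle graphs and translations\<close>

definition undirected :: "('a \<times> 'a) set \<Rightarrow> 'a set set" where
  "undirected S = (\<lambda>(x, y). {x, y}) ` S"

lemma undirected_simps [simp]:
  "undirected {} = {}" "undirected (insert (x, y) S) = insert {x, y} (undirected S)"
  "undirected (S \<union> S') = undirected S \<union> undirected S'"
  "undirected (\<Union> (f ` I)) = (\<Union>i\<in>I. undirected (f i))"
  by (auto simp: undirected_def)

lemma undirected_swap [simp]: "undirected (prod.swap ` S) = undirected S"
  unfolding undirected_def image_image by (intro image_cong) auto

lemma image_case_prod_Collect: "(\<lambda>(i, j). g i j) ` {(i, j). Q i j} = {g i j | i j. Q i j}"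
  by auto

lemma undirected_map: "undirected (map_prod f f ` S) = (`) f ` undirected S"
  unfolding undirected_def image_image by (intro image_cong) auto

definition cycle_graph_of :: "'a list list \<Rightarrow> 'a ugraph" where
  "cycle_graph_of Ls = \<lparr>verts = \<Union> (set ` set Ls), edges = undirected (\<Union> (cycle_steps ` set Ls))\<rparr>"

lemma cycle_steps_nth:
  assumes "c \<noteq> []"
  shows "cycle_steps c = {(c ! j, c ! (Suc j mod length c)) | j. j < length c}"
proof -
  have eq: "(c @ [hd c]) ! Suc j = c ! (Suc j mod length c)" if "j < length c" for j
    using that assms by (cases "Suc j = length c") (auto simp: nth_append hd_conv_nth)
  have eq0: "(c @ [hd c]) ! j = c ! j" if "j < length c" for j
    using that by (simp add: nth_append)
  have "cycle_steps c = {((c @ [hd c]) ! j, (c @ [hd c]) ! Suc j) | j. j < length c}"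
    unfolding cycle_steps_def steps_def by (auto simp: set_zip nth_tl)
  also have "\<dots> = {(c ! j, c ! (Suc j mod length c)) | j. j < length c}"
    using eq eq0 by (intro Collect_cong ex_cong1) auto
  finally show ?thesis .
qed

lemma graph_iso_cycles:
  assumes d: "distinct (concat Ls)" and ne: "[] \<notin> set Ls"
  shows "graph_iso (cycle_graph_of Ls) (cycles_graph (map length Ls))"
proof -
  let ?V = "verts (cycles_graph (map length Ls))"
  define \<psi> where "\<psi> = (\<lambda>(i, j). Ls ! i ! j)"
  have V: "?V = {(i, j). i < length Ls \<and> j < length (Ls ! i)}"
    by (auto simp: cycles_graph_def)
  have dl: "distinct (Ls ! i)" if "i < length Ls" for i
    using d that by (auto simp: distinct_concat_iff)
  have disj: "i = i'" if "i < length Ls" "i' < length Ls" "x \<in> set (Ls ! i)" "x \<in> set (Ls ! i')" for i i' x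
  proof (rule ccontr)
    assume "i \<noteq> i'"
    moreover have "distinct Ls" using d ne by (simp add: distinct_concat_iff)
    ultimately have "Ls ! i \<noteq> Ls ! i'" using that by (simp add: nth_eq_iff_index_eq)
    then have "set (Ls ! i) \<inter> set (Ls ! i') = {}" using d that by (simp add: distinct_concat_iff)
    then show False using that by auto
  qed
  have inj: "inj_on \<psi> ?V"
  proof (rule inj_onI)
    fix p p' assume p: "p \<in> ?V" "p' \<in> ?V" "\<psi> p = \<psi> p'"
    obtain i j i' j' where ij: "p = (i, j)" "p' = (i', j')" by (cases p, cases p')
    have *: "i < length Ls" "j < length (Ls ! i)" "i' < length Ls" "j' < length (Ls ! i')" "Ls ! i ! j = Ls ! i' ! j'"
      using p ij by (auto simp: V \<psi>_def)
    then have "i = i'" using disj[of i i' "Ls ! i ! j"] by (metis nth_mem)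
    then show "p = p'" using * dl ij by (simp add: nth_eq_iff_index_eq)
  qed
  have im: "\<psi> ` ?V = verts (cycle_graph_of Ls)"
    unfolding V cycle_graph_of_def \<psi>_def by (force simp: in_set_conv_nth image_iff)
  then have bij: "bij_betw \<psi> ?V (verts (cycle_graph_of Ls))" using inj by (simp add: bij_betw_def)
  have E: "edges (cycles_graph (map length Ls))
      = {{(i, j), (i, Suc j mod length (Ls ! i))} | i j. i < length Ls \<and> j < length (Ls ! i)}"
    unfolding cycles_graph_def by (simp, intro Collect_cong ex_cong1) auto
  have edges: "(`) \<psi> ` edges (cycles_graph (map length Ls)) = edges (cycle_graph_of Ls)"
  proof -
    have "edges (cycle_graph_of Ls) = {{Ls ! i ! j, Ls ! i ! (Suc j mod length (Ls ! i))} | i j. i < length Ls \<and> j < length (Ls ! i)}"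
    proof -
      have "edges (cycle_graph_of Ls) = (\<Union>i<length Ls. undirected (cycle_steps (Ls ! i)))"
        unfolding cycle_graph_of_def by (auto simp: set_conv_nth)
      also have "\<dots> = (\<Union>i<length Ls. {{Ls ! i ! j, Ls ! i ! (Suc j mod length (Ls ! i))} | j. j < length (Ls ! i)})"
      proof (intro SUP_cong refl)
        fix i assume "i \<in> {..<length Ls}"
        then have "Ls ! i \<noteq> []" using ne by (metis lessThan_iff nth_mem)
        then show "undirected (cycle_steps (Ls ! i)) = {{Ls ! i ! j, Ls ! i ! (Suc j mod length (Ls ! i))} | j. j < length (Ls ! i)}"
          unfolding cycle_steps_nth[OF \<open>Ls ! i \<noteq> []\<close>] undirected_def by auto
      qed
      finally show ?thesis by auto
    qed
    moreover have "(`) \<psi> ` edges (cycles_graph (map length Ls))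
        = {{Ls ! i ! j, Ls ! i ! (Suc j mod length (Ls ! i))} | i j. i < length Ls \<and> j < length (Ls ! i)}"
      unfolding E image_case_prod_Collect[symmetric] image_image
      by (intro image_cong refl) (auto simp: \<psi>_def)
    ultimately show ?thesis by simp
  qed
  define \<phi> where "\<phi> = inv_into ?V \<psi>"
  have "bij_betw \<phi> (verts (cycle_graph_of Ls)) ?V"
    unfolding \<phi>_def by (rule bij_betw_inv_into[OF bij])
  moreover have "(`) \<phi> ` edges (cycle_graph_of Ls) = edges (cycles_graph (map length Ls))"
  proof -
    have sub: "e \<subseteq> ?V" if e': "e \<in> edges (cycles_graph (map length Ls))" for e
    proof -
      obtain i j where e: "i < length Ls" "j < length (Ls ! i)" "e = {(i, j), (i, Suc j mod length (Ls ! i))}"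
        using e' unfolding E by blast
      then have "Suc j mod length (Ls ! i) < length (Ls ! i)" by (intro mod_less_divisor) auto
      with e show ?thesis by (auto simp: V)
    qed
    have inv: "\<phi> ` (\<psi> ` e) = e" if "e \<in> edges (cycles_graph (map length Ls))" for e
      unfolding \<phi>_def by (rule inv_into_image_cancel[OF inj sub[OF that]])
    have "(`) \<phi> ` edges (cycle_graph_of Ls) = (\<lambda>e. \<phi> ` (\<psi> ` e)) ` edges (cycles_graph (map length Ls))"
      unfolding edges[symmetric] image_image ..
    also have "\<dots> = (\<lambda>e. e) ` edges (cycles_graph (map length Ls))"
      by (rule image_cong[OF refl inv])
    finally show ?thesis by simp
  qed
  ultimately show ?thesis unfolding graph_iso_def by blast
qed

lemma graph_iso_trans:
  assumes "graph_iso H F" "graph_iso F K"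
  shows "graph_iso H K"
proof -
  obtain \<phi> where \<phi>: "bij_betw \<phi> (verts H) (verts F)" "(`) \<phi> ` edges H = edges F"
    using assms(1) unfolding graph_iso_def by blast
  obtain \<psi> where \<psi>: "bij_betw \<psi> (verts F) (verts K)" "(`) \<psi> ` edges F = edges K"
    using assms(2) unfolding graph_iso_def by blast
  have "(`) (\<psi> \<circ> \<phi>) ` edges H = edges K"
    unfolding \<psi>(2)[symmetric] \<phi>(2)[symmetric] by (simp add: image_image image_comp[symmetric])
  then show ?thesis
    unfolding graph_iso_def using bij_betw_trans[OF \<phi>(1) \<psi>(1)] by blast
qed

lemma graph_iso_image:
  assumes "bij_betw \<tau> V V" "verts H = V" "\<Union> (edges H) \<subseteq> V"
  shows "graph_iso (graph_image \<tau> H) H"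
proof -
  define \<phi> where "\<phi> = inv_into V \<tau>"
  have "bij_betw \<phi> V V" unfolding \<phi>_def by (rule bij_betw_inv_into[OF assms(1)])
  moreover have "\<tau> ` V = V" using assms(1) by (simp add: bij_betw_def)
  moreover have "\<phi> ` (\<tau> ` e) = e" if "e \<in> edges H" for e
  proof -
    have "e \<subseteq> V" using that assms(3) by blast
    then show ?thesis
      using assms(1) unfolding \<phi>_def by (simp add: bij_betw_def inv_into_image_cancel)
  qed
  ultimately show ?thesis
    unfolding graph_iso_def graph_image_def using assms(2) by (intro exI[of _ \<phi>]) (simp add: image_image)
qed

section \<open>The cyclic translation group and its action\<close>

definition translate :: "nat \<Rightarrow> nat \<Rightarrow> nat \<Rightarrow> nat" where
  "translate n g x = (if x < 2 * n then (x + g) mod (2 * n) else x)"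

lemma translate_translate: "n > 0 \<Longrightarrow> translate n g (translate n h x) = translate n ((g + h) mod (2 * n)) x"
  unfolding translate_def by (simp add: mod_simps add_ac)

lemma translate_0 [simp]: "translate n 0 x = x"
  by (simp add: translate_def)

lemma translate_less [simp]: "n > 0 \<Longrightarrow> translate n g x < 2 * n + f \<longleftrightarrow> x < 2 * n + f"
proof -
  assume "n > 0"
  then have "(x + g) mod (2 * n) < 2 * n" by simp
  then show ?thesis unfolding translate_def by auto
qed

lemma bij_translate:
  assumes "n > 0"
  shows "bij_betw (translate n g) {..<2 * n + f} {..<2 * n + f}"
proof -
  let ?h = "(2 * n - g mod (2 * n)) mod (2 * n)"
  have "(?h + g) mod (2 * n) = 0"
  proof -
    have "g mod (2 * n) < 2 * n" using assms by simp
    then have "(2 * n - g mod (2 * n) + g mod (2 * n)) mod (2 * n) = 0" by simp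
    then show ?thesis by (simp add: mod_simps)
  qed
  moreover from this have "(g + ?h) mod (2 * n) = 0" by (simp add: add.commute)
  ultimately show ?thesis
    using assms by (intro bij_betw_byWitness[of _ "translate n ?h"]) (auto simp: translate_translate)
qed

definition translation_group :: "nat \<Rightarrow> nat \<Rightarrow> (nat \<Rightarrow> nat) set" where
  "translation_group n f = (\<lambda>g. restrict (translate n g) {..<2 * n + f}) ` {..<2 * n}"

lemma translation_group_subgroup:
  assumes "n > 0"
  shows "subgroup (translation_group n f) (BijGroup {..<2 * n + f})"
proof -
  let ?V = "{..<2 * n + f}" and ?t = "\<lambda>g. restrict (translate n g) {..<2 * n + f}"
  have B: "?t g \<in> Bij ?V" for g
    using bij_translate[OF assms, of g f] by (auto simp: Bij_def bij_betw_restrict_eq)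
  have mult: "?t g \<otimes>\<^bsub>BijGroup ?V\<^esub> ?t h = ?t ((g + h) mod (2 * n))" for g h
  proof -
    have "compose ?V (?t g) (?t h) = ?t ((g + h) mod (2 * n))"
      using assms by (intro ext) (auto simp: compose_def translate_translate)
    then show ?thesis using B by (simp add: BijGroup_def)
  qed
  have one: "?t 0 = \<one>\<^bsub>BijGroup ?V\<^esub>" by (auto simp: BijGroup_def restrict_def)
  interpret group "BijGroup ?V" by (rule group_BijGroup)
  have carrier: "?t g \<in> carrier (BijGroup ?V)" for g using B by (simp add: BijGroup_def)
  show ?thesis
  proof (rule subgroupI)
    show "translation_group n f \<subseteq> carrier (BijGroup ?V)" using carrier by (auto simp: translation_group_def)
    show "translation_group n f \<noteq> {}" using assms by (auto simp: translation_group_def lessThan_empty_iff)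
    show "a \<otimes>\<^bsub>BijGroup ?V\<^esub> b \<in> translation_group n f" if "a \<in> translation_group n f" "b \<in> translation_group n f" for a b
      using that assms by (auto simp: translation_group_def mult)
    show "inv\<^bsub>BijGroup ?V\<^esub> a \<in> translation_group n f" if a: "a \<in> translation_group n f" for a
    proof -
      obtain g where g: "g < 2 * n" "a = ?t g" using a by (auto simp: translation_group_def)
      let ?h = "(2 * n - g) mod (2 * n)"
      have "(?h + g) mod (2 * n) = 0" using g by (simp add: mod_simps)
      then have "?t ?h \<otimes>\<^bsub>BijGroup ?V\<^esub> a = \<one>\<^bsub>BijGroup ?V\<^esub>" unfolding g(2) mult one[symmetric] by simp
      then have "inv\<^bsub>BijGroup ?V\<^esub> a = ?t ?h" using carrier g(2) by (intro inv_equality) auto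
      then show ?thesis using assms by (auto simp: translation_group_def)
    qed
  qed
qed

lemma fixed_points_translation_group:
  assumes "n > 0"
  shows "fixed_points {..<2 * n + f} (translation_group n f) = {2 * n..<2 * n + f}"
proof -
  have "\<exists>g\<in>translation_group n f. g x \<noteq> x" if "x < 2 * n" for x
  proof -
    have "restrict (translate n 1) {..<2 * n + f} x \<noteq> x"
    proof (cases "x + 1 < 2 * n")
      case False
      then have "x + 1 = 2 * n" using that by simp
      then have "translate n 1 x = 0" using that by (simp add: translate_def)
      moreover have "x \<noteq> 0" using \<open>x + 1 = 2 * n\<close> by presburger
      ultimately show ?thesis using that by simp
    qed (use that in \<open>simp add: translate_def\<close>)
    moreover have "restrict (translate n 1) {..<2 * n + f} \<in> translation_group n f"
      using assms by (auto simp: translation_group_def)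
    ultimately show ?thesis by blast
  qed
  moreover have "g x = x" if "g \<in> translation_group n f" "2 * n \<le> x" "x < 2 * n + f" for g x
    using that by (auto simp: translation_group_def translate_def)
  ultimately show ?thesis unfolding fixed_points_def by (fastforce simp: not_less)
qed

lemma translation_group_sharply_transitive:
  assumes "n > 0" "x < 2 * n" "y < 2 * n"
  shows "\<exists>!g. g \<in> translation_group n f \<and> g x = y"
proof -
  define a where "a = (y + (2 * n - x)) mod (2 * n)"
  have "translate n a x = y"
  proof -
    have "(x + (y + (2 * n - x))) mod (2 * n) = y" using assms by (simp add: add.commute)
    then show ?thesis using assms by (simp add: translate_def a_def mod_simps)
  qed
  then have "restrict (translate n a) {..<2 * n + f} x = y" using assms by simp
  moreover have "restrict (translate n a) {..<2 * n + f} \<in> translation_group n f"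
    using assms by (auto simp: translation_group_def a_def)
  moreover have "g = h" if gh: "g \<in> translation_group n f" "g x = y" "h \<in> translation_group n f" "h x = y" for g h
  proof -
    obtain a where a: "a < 2 * n" "g = restrict (translate n a) {..<2 * n + f}"
      using gh(1) by (auto simp: translation_group_def)
    obtain b where b: "b < 2 * n" "h = restrict (translate n b) {..<2 * n + f}"
      using gh(3) by (auto simp: translation_group_def)
    note ab = a b
    then have "(x + a) mod (2 * n) = (x + b) mod (2 * n)" using gh(2,4) assms by (simp add: translate_def)
    then have "[a = b] (mod (2 * n))" by (metis cong_add_lcancel_nat cong_def)
    then have "a = b" using ab by (simp add: cong_def)
    then show "g = h" using ab by simp
  qed
  ultimately show ?thesis by blast
qed

section \<open>Lifting a starter modulo 2n\<close>

lemma card_cycle_steps_le: "card (cycle_steps c) \<le> length c"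
proof -
  have "card (cycle_steps c) \<le> length (zip (c @ [hd c]) (tl (c @ [hd c])))"
    unfolding cycle_steps_def steps_def by (rule card_length)
  then show ?thesis by simp
qed

lemma finite_steps [simp]: "finite (steps c)" "finite (cycle_steps c)"
  by (simp_all add: steps_def cycle_steps_def)

lemma card_edges_le: "card (edges (cycle_graph_of Ls)) \<le> sum_list (map length Ls)"
proof -
  have "card (\<Union> (cycle_steps ` set Ls)) \<le> sum_list (map length Ls)"
  proof (induction Ls)
    case (Cons c Ls)
    have "card (\<Union> (cycle_steps ` set (c # Ls))) \<le> card (cycle_steps c) + card (\<Union> (cycle_steps ` set Ls))"
      by (simp add: card_Un_le)
    then show ?case using Cons card_cycle_steps_le[of c] by simp
  qed simp
  moreover have "card (edges (cycle_graph_of Ls)) \<le> card (\<Union> (cycle_steps ` set Ls))"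
    unfolding cycle_graph_of_def undirected_def by (simp add: card_image_le)
  ultimately show ?thesis by simp
qed

lemma cycle_steps_subset: "c \<noteq> [] \<Longrightarrow> (x, y) \<in> cycle_steps c \<Longrightarrow> x \<in> set c \<and> y \<in> set c"
  unfolding cycle_steps_def using steps_subset[of x y "c @ [hd c]"] by auto

lemma edges_subset_verts:
  assumes "[] \<notin> set Ls"
  shows "\<Union> (edges (cycle_graph_of Ls)) \<subseteq> verts (cycle_graph_of Ls)"
proof
  fix z assume "z \<in> \<Union> (edges (cycle_graph_of Ls))"
  then obtain c x y where c: "c \<in> set Ls" "(x, y) \<in> cycle_steps c" "z \<in> {x, y}"
    by (auto simp: cycle_graph_of_def undirected_def)
  then have "c \<noteq> []" using assms by auto
  then show "z \<in> verts (cycle_graph_of Ls)"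
    using c cycle_steps_subset[of c x y] by (auto simp: cycle_graph_of_def)
qed

text \<open>The first \<open>r\<close> cycles are doubled: they close up only after the addition of \<open>n\<close>. The fixed vertices are
  \<open>2 * n\<close> and \<open>2 * n + 1\<close>, and \<open>special f\<close> consists of the edges joining the two halves of the long cycle.\<close>

locale starter =
  fixes n r :: nat and X :: "int list" and cs :: "int list list"
  assumes n: "2 \<le> n" and X: "2 \<le> length X" and ne: "[] \<notin> set cs"
    and labels: "\<And>y. 0 \<le> y \<Longrightarrow> y < int n \<Longrightarrow> \<exists>a\<in>set X \<union> \<Union> (set ` set cs). a mod int n = y"
    and len: "length X + sum_list (map length cs) = n"
begin

text \<open>Integer representatives of the edges of the factor modulo translation by
  \<open>n\<close>, except those in \<open>special\<close>. Integers keep the sign of differences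
  and allow the closing step \<open>hd c + n\<close> of a doubled cycle.\<close>

definition base :: "(int \<times> int) set" where
  "base = steps X \<union> \<Union> ((\<lambda>c. steps (c @ [hd c + int n])) ` set (take r cs))
     \<union> \<Union> (cycle_steps ` set (drop r cs))"

definition \<rho> :: "nat \<Rightarrow> int \<Rightarrow> nat" where
  "\<rho> s x = nat ((x + int s) mod (2 * int n))"

lemma \<rho>_less: "\<rho> s x < 2 * n"
  using n by (simp add: \<rho>_def nat_less_iff)

lemma \<rho>_add: "\<rho> s (x + int n) = \<rho> (s + n) x" "\<rho> (n + n) x = \<rho> 0 x"
  using n by (simp_all add: \<rho>_def algebra_simps)

lemma translate_\<rho>: "translate n g (\<rho> s x) = \<rho> (s + g) x"
proof -
  have "int ((\<rho> s x + g) mod (2 * n)) = int (\<rho> (s + g) x)"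
    using n by (simp add: \<rho>_def zmod_int mod_simps algebra_simps)
  then show ?thesis using \<rho>_less[of s x] by (simp add: translate_def)
qed

text \<open>The second copy of the path is traversed backwards, so the two copies of each path end
  become neighbours, directly or through a fixed vertex.\<close>

definition big :: "nat \<Rightarrow> nat list" where
  "big f = (if f = 0 then [] else [2 * n]) @ map (\<rho> 0) X @ (if f = 2 then [2 * n + 1] else []) @ map (\<rho> n) (rev X)"

definition lists :: "nat \<Rightarrow> nat list list" where
  "lists f = big f # map (\<lambda>c. map (\<rho> 0) c @ map (\<rho> n) c) (take r cs)
     @ concat (map (\<lambda>c. [map (\<rho> 0) c, map (\<rho> n) c]) (drop r cs))"

definition special :: "nat \<Rightarrow> nat set set" where
  "special f = (if f = 2 then {{2 * n + 1, \<rho> 0 (last X)}, {2 * n + 1, \<rho> n (last X)}} else {{\<rho> 0 (last X), \<rho> n (last X)}})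
     \<union> (if f = 0 then {{\<rho> 0 (hd X), \<rho> n (hd X)}} else {{2 * n, \<rho> 0 (hd X)}, {2 * n, \<rho> n (hd X)}})"

definition H :: "nat \<Rightarrow> nat ugraph" where
  "H f = cycle_graph_of (lists f)"

lemma X_ne: "X \<noteq> []"
  using X by auto

lemma undirected_big:
  assumes "f \<le> 2"
  shows "undirected (cycle_steps (big f)) = (`) (\<rho> 0) ` undirected (steps X) \<union> (`) (\<rho> n) ` undirected (steps X) \<union> special f"
proof -
  have st: "steps (map (\<rho> s) X) = map_prod (\<rho> s) (\<rho> s) ` steps X"
    "steps (map (\<rho> s) (rev X)) = prod.swap ` map_prod (\<rho> s) (\<rho> s) ` steps X" for s
    by (auto simp: steps_map rev_map[symmetric] steps_rev)
  have X': "map (\<rho> s) X \<noteq> []" "map (\<rho> s) (rev X) \<noteq> []" for s using X_ne by auto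
  have hl: "hd (map (\<rho> s) X) = \<rho> s (hd X)" "last (map (\<rho> s) X) = \<rho> s (last X)"
    "hd (map (\<rho> s) (rev X)) = \<rho> s (last X)" "last (map (\<rho> s) (rev X)) = \<rho> s (hd X)" for s
    using X_ne by (auto simp: hd_map last_map hd_rev last_rev)
  have "f = 0 \<or> f = 1 \<or> f = 2" using assms by auto
  then show ?thesis
    by (elim disjE) (simp_all add: big_def cycle_steps_eq steps_append steps_Cons X' hl st special_def
      undirected_map insert_commute Un_ac X_ne del: map_map rev_map)
qed

lemma undirected_twisted:
  assumes "c \<noteq> []"
  shows "undirected (cycle_steps (map (\<rho> 0) c @ map (\<rho> n) c))
    = (`) (\<rho> 0) ` undirected (steps (c @ [hd c + int n])) \<union> (`) (\<rho> n) ` undirected (steps (c @ [hd c + int n]))"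
  using assms
  by (simp add: cycle_steps_eq steps_append hd_map last_map steps_map undirected_map \<rho>_add insert_commute Un_ac)

lemma undirected_cycle: "c \<noteq> [] \<Longrightarrow> undirected (cycle_steps (map (\<rho> s) c)) = (`) (\<rho> s) ` undirected (cycle_steps c)"
  by (simp add: cycle_steps_map undirected_map)

text \<open>In this form the invariance under translation by \<open>n\<close> is visible: the two
  copies of \<open>base\<close> are exchanged and \<open>special\<close> is preserved.\<close>

lemma edges_H:
  assumes "f \<le> 2"
  shows "edges (H f) = (`) (\<rho> 0) ` undirected base \<union> (`) (\<rho> n) ` undirected base \<union> special f"
proof -
  have ne': "c \<noteq> []" if "c \<in> set (take r cs) \<or> c \<in> set (drop r cs)" for c
    using that ne by (auto dest: in_set_takeD in_set_dropD)
  have t: "(\<Union>c\<in>set (take r cs). undirected (cycle_steps (map (\<rho> 0) c @ map (\<rho> n) c)))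
     = (\<Union>c\<in>set (take r cs). (`) (\<rho> 0) ` undirected (steps (c @ [hd c + int n])) \<union>
         (`) (\<rho> n) ` undirected (steps (c @ [hd c + int n])))"
    by (rule SUP_cong[OF refl], rule undirected_twisted, rule ne', simp)
  have d: "(\<Union>c\<in>set (drop r cs). undirected (cycle_steps (map (\<rho> s) c)))
     = (\<Union>c\<in>set (drop r cs). (`) (\<rho> s) ` undirected (cycle_steps c))" for s
    by (rule SUP_cong[OF refl], rule undirected_cycle, rule ne', simp)
  have "edges (H f) = undirected (cycle_steps (big f)) \<union>
     (\<Union>c\<in>set (take r cs). undirected (cycle_steps (map (\<rho> 0) c @ map (\<rho> n) c))) \<union>
     ((\<Union>c\<in>set (drop r cs). undirected (cycle_steps (map (\<rho> 0) c))) \<union>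
      (\<Union>c\<in>set (drop r cs). undirected (cycle_steps (map (\<rho> n) c))))"
    unfolding H_def cycle_graph_of_def lists_def by (auto simp: undirected_def)
  then show ?thesis
    unfolding undirected_big[OF assms] t d base_def undirected_simps image_Un image_UN
    by (simp only: UN_Un_distrib Un_ac)
qed

lemma lists_ne: "[] \<notin> set (lists f)"
proof -
  have "big f \<noteq> []" using X_ne by (auto simp: big_def)
  then show ?thesis unfolding lists_def using ne by (auto dest: in_set_takeD in_set_dropD)
qed

lemma length_lists: "f \<le> 2 \<Longrightarrow> sum_list (map length (lists f)) = 2 * n + f"
proof -
  assume "f \<le> 2"
  then have "length (big f) = 2 * length X + f" by (auto simp: big_def)
  moreover have "sum_list (map length (map (\<lambda>c. map (\<rho> 0) c @ map (\<rho> n) c) ds)) = 2 * sum_list (map length ds)" for ds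
    by (induction ds) auto
  moreover have "sum_list (map length (concat (map (\<lambda>c. [map (\<rho> 0) c, map (\<rho> n) c]) ds))) = 2 * sum_list (map length ds)" for ds
    by (induction ds) auto
  moreover have "sum_list (map length (take r cs)) + sum_list (map length (drop r cs)) = sum_list (map length cs)"
    by (metis append_take_drop_id map_append sum_list.append)
  ultimately show ?thesis unfolding lists_def using len by simp
qed

lemma verts_H:
  assumes "f \<le> 2"
  shows "verts (H f) = {..<2 * n + f}"
proof -
  have *: "set (lists f) = insert (big f) ((\<lambda>c. map (\<rho> 0) c @ map (\<rho> n) c) ` set (take r cs) \<union>
      (\<Union>c\<in>set (drop r cs). {map (\<rho> 0) c, map (\<rho> n) c}))"
    by (auto simp: lists_def)
  have big: "set (big f) = \<rho> 0 ` set X \<union> \<rho> n ` set X \<union> {2 * n..<2 * n + f}"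
    using assms by (auto simp: big_def)
  have cs: "\<Union> (set ` set cs) = \<Union> (set ` set (take r cs)) \<union> \<Union> (set ` set (drop r cs))"
    by (metis Union_Un_distrib append_take_drop_id image_Un set_append)
  have v: "verts (H f) = \<rho> 0 ` (set X \<union> \<Union> (set ` set cs)) \<union> \<rho> n ` (set X \<union> \<Union> (set ` set cs)) \<union> {2 * n..<2 * n + f}"
    unfolding H_def cycle_graph_of_def cs by (simp add: * big) blast
  have im: "\<rho> 0 ` (set X \<union> \<Union> (set ` set cs)) \<union> \<rho> n ` (set X \<union> \<Union> (set ` set cs)) = {..<2 * n}"
  proof (intro equalityI subsetI)
    fix x assume "x \<in> {..<2 * n}"
    then have x: "x < 2 * n" by simp
    obtain a where a: "a \<in> set X \<union> \<Union> (set ` set cs)" "a mod int n = int x mod int n"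
      using labels[of "int x mod int n"] n by auto
    then obtain k where k: "int x = a + int n * k" by (metis mod_eqE)
    have "\<exists>j. int x = a + 2 * int n * j \<or> int x = a + int n + 2 * int n * j"
    proof (cases "even k")
      case True
      then obtain j where "k = 2 * j" by blast
      then show ?thesis using k by (intro exI[of _ j]) (simp add: algebra_simps)
    next
      case False
      then obtain j where "k = 2 * j + 1" by (rule oddE)
      then show ?thesis using k by (intro exI[of _ j]) (simp add: algebra_simps)
    qed
    then have "int x mod (2 * int n) = a mod (2 * int n) \<or> int x mod (2 * int n) = (a + int n) mod (2 * int n)"
      by auto
    moreover have "int x mod (2 * int n) = int x" using x by simp
    ultimately have "x = \<rho> 0 a \<or> x = \<rho> n a" unfolding \<rho>_def by (metis add_0_right nat_int of_nat_0)
    then show "x \<in> \<rho> 0 ` (set X \<union> \<Union> (set ` set cs)) \<union> \<rho> n ` (set X \<union> \<Union> (set ` set cs))"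
      using a(1) by blast
  qed (use \<rho>_less in auto)
  show ?thesis unfolding v im by auto
qed

text \<open>The lists cover \<open>2 * n + f\<close> vertices with total length
  \<open>2 * n + f\<close>, so nothing is repeated.\<close>

lemma distinct_lists: "f \<le> 2 \<Longrightarrow> distinct (concat (lists f))"
proof -
  assume f: "f \<le> 2"
  have "set (concat (lists f)) = {..<2 * n + f}"
    using verts_H[OF f] by (simp add: H_def cycle_graph_of_def)
  moreover have "length (concat (lists f)) = 2 * n + f"
    using length_lists[OF f] by (simp add: length_concat)
  ultimately show ?thesis by (intro card_distinct) simp
qed

text \<open>A unique translation \<open>G\<close> modulo \<open>2 * n\<close> carries
  \<open>a\<close> to \<open>x\<close>, and then \<open>b\<close> to \<open>y\<close>. If
  \<open>G \<ge> n\<close>, the surplus \<open>n\<close> is absorbed by passing to the other copy;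
  hence the translations below \<open>n\<close> suffice.\<close>

lemma translate_pair:
  assumes "x < 2 * n" "y < 2 * n" "2 * int n dvd (int y - int x) - (b - a)"
  shows "\<exists>g<n. \<exists>s\<in>{0, n}. translate n g (\<rho> s a) = x \<and> translate n g (\<rho> s b) = y"
proof -
  define G where "G = nat ((int x - a) mod (2 * int n))"
  have G: "G < 2 * n" using n by (simp add: G_def nat_less_iff)
  have iG: "int G = (int x - a) mod (2 * int n)" using n by (simp add: G_def)
  have "(a + int G) mod (2 * int n) = int x" unfolding iG using assms(1) by (simp add: mod_simps)
  moreover have "(b + int G) mod (2 * int n) = int y"
  proof -
    have "(b + int G) mod (2 * int n) = (b + (int x - a)) mod (2 * int n)" unfolding iG by (simp add: mod_simps)
    also have "\<dots> = int y mod (2 * int n)"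
      using assms(3) by (simp add: mod_eq_dvd_iff) (smt (verit) dvd_minus_iff)
    finally show ?thesis using assms(2) by simp
  qed
  ultimately have xy: "\<rho> G a = x" "\<rho> G b = y" by (simp_all add: \<rho>_def)
  show ?thesis
  proof (cases "G < n")
    case True
    then show ?thesis using xy by (intro exI[of _ G] conjI bexI[of _ 0]) (auto simp: translate_\<rho>)
  next
    case False
    then show ?thesis using xy G by (intro exI[of _ "G - n"] conjI bexI[of _ n]) (auto simp: translate_\<rho>)
  qed
qed

end

section \<open>From covering to partition by counting\<close>

lemma card_complete_edges: "finite V \<Longrightarrow> card (complete_edges V) = card V choose 2"
  unfolding complete_edges_def by (rule n_subsets)

lemma finite_complete_edges: "finite V \<Longrightarrow> finite (complete_edges V)"
  unfolding complete_edges_def by simp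

text \<open>If every element is covered often enough and the sets together are no larger than
  \<open>M\<close>, there is no room for a repetition.\<close>

lemma sum_mset_set_eqI:
  assumes "finite I" "\<And>g. g \<in> I \<Longrightarrow> finite (E g)"
    and "\<And>e. count M e \<le> card {g \<in> I. e \<in> E g}" "(\<Sum>g\<in>I. card (E g)) \<le> size M"
  shows "(\<Sum>g\<in>I. mset_set (E g)) = M"
proof -
  have "M \<subseteq># (\<Sum>g\<in>I. mset_set (E g))"
  proof (rule mset_subset_eqI)
    fix e
    have "count (\<Sum>g\<in>I. mset_set (E g)) e = (\<Sum>g\<in>I. if e \<in> E g then 1 else 0)"
      unfolding count_sum using assms(2) by (intro sum.cong) auto
    also have "\<dots> = card {g \<in> I. e \<in> E g}"
      using assms(1) by (simp add: sum.If_cases Int_def)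
    finally show "count M e \<le> count (\<Sum>g\<in>I. mset_set (E g)) e" using assms(3) by simp
  qed
  moreover have "size (\<Sum>g\<in>I. mset_set (E g)) \<le> size M"
    using assms(1,4) by (simp add: size_multiset_sum)
  ultimately show ?thesis
    by (metis linorder_not_less mset_subset_size subset_mset.le_neq_trans)
qed

context starter
begin

text \<open>The edges of difference \<open>n\<close>: the part of the 1-factor \<open>I'\<close> on
  the moved vertices, which is removed or doubled for \<open>\<sigma> \<noteq> 0\<close>.\<close>

definition halves :: "nat set set" where
  "halves = (\<lambda>x. {x, x + n}) ` {..<n}"

lemma card_halves: "card halves = n"
proof -
  have "inj_on (\<lambda>x. {x, x + n}) {..<n}" by (rule inj_onI) (auto simp: doubleton_eq_iff)
  then show ?thesis by (simp add: halves_def card_image)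
qed

lemma halves_mem: "x < 2 * n \<Longrightarrow> e \<in> halves \<Longrightarrow> x \<in> e \<Longrightarrow> e = (if x < n then {x, x + n} else {x - n, x})"
  by (auto simp: halves_def)

lemma halves_ex: "x < 2 * n \<Longrightarrow> (if x < n then {x, x + n} else {x - n, x}) \<in> halves"
  by (auto simp: halves_def image_iff)

lemma one_factor_halves: "one_factor {..<2 * n} halves"
  unfolding one_factor_def
proof (intro conjI ballI ex1I)
  show "halves \<subseteq> complete_edges {..<2 * n}" by (auto simp: halves_def complete_edges_def)
  fix x assume x: "x \<in> {..<2 * n}"
  then show "(if x < n then {x, x + n} else {x - n, x}) \<in> halves" "x \<in> (if x < n then {x, x + n} else {x - n, x})"
    using halves_ex by auto
  show "e = (if x < n then {x, x + n} else {x - n, x})" if "e \<in> halves \<and> x \<in> e" for e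
    using halves_mem[of x e] that x by auto
qed

lemma one_factor_halves_insert: "one_factor {..<2 * n + 2} (insert {2 * n, 2 * n + 1} halves)"
  unfolding one_factor_def
proof (intro conjI ballI)
  show "insert {2 * n, 2 * n + 1} halves \<subseteq> complete_edges {..<2 * n + 2}"
    by (auto simp: halves_def complete_edges_def)
  fix x assume x: "x \<in> {..<2 * n + 2}"
  show "\<exists>!e. e \<in> insert {2 * n, 2 * n + 1} halves \<and> x \<in> e"
  proof (cases "x < 2 * n")
    case True
    define e\<^sub>0 where "e\<^sub>0 = (if x < n then {x, x + n} else {x - n, x})"
    show ?thesis
    proof (rule ex1I)
      have "x \<in> e\<^sub>0" by (simp add: e\<^sub>0_def)
      then show "e\<^sub>0 \<in> insert {2 * n, 2 * n + 1} halves \<and> x \<in> e\<^sub>0"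
        using halves_ex[OF True] by (simp add: e\<^sub>0_def)
      fix e assume e: "e \<in> insert {2 * n, 2 * n + 1} halves \<and> x \<in> e"
      then have "e \<in> halves" using True by auto
      then show "e = e\<^sub>0" using halves_mem[OF True] e unfolding e\<^sub>0_def by blast
    qed
  next
    case False
    then show ?thesis using x
      by (intro ex1I[of _ "{2 * n, 2 * n + 1}"]) (auto simp: halves_def)
  qed
qed

definition moved_edges :: "nat \<Rightarrow> nat \<Rightarrow> nat set set" where
  "moved_edges f g = (`) (translate n g) ` edges (H f)"

lemma special_edges: "f \<le> 2 \<Longrightarrow> special f \<subseteq> edges (H f)"
  using edges_H by blast

lemma base_edges:
  assumes "f \<le> 2" "(a, b) \<in> base" "s \<in> {0, n}"
  shows "{\<rho> s a, \<rho> s b} \<in> edges (H f)"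
proof -
  have "{a, b} \<in> undirected base"
    using assms(2) unfolding undirected_def by (rule rev_image_eqI) simp
  then have "\<rho> s ` {a, b} \<in> (`) (\<rho> s) ` undirected base" by (rule imageI)
  then show ?thesis unfolding edges_H[OF assms(1)] using assms(3) by auto
qed

lemma moved_half:
  assumes "f \<le> 2" "x < n" "{\<rho> 0 a, \<rho> n a} \<in> edges (H f)"
  shows "\<exists>g<n. {x, x + n} = translate n g ` {\<rho> 0 a, \<rho> n a} \<and> {x, x + n} \<in> moved_edges f g"
proof -
  obtain g s where g: "g < n" "s \<in> {0, n}" "translate n g (\<rho> s a) = x" "translate n g (\<rho> s (a + int n)) = x + n"
    using translate_pair[of x "x + n" "a + int n" a] assms(2) by auto
  have eq: "{\<rho> s a, \<rho> s (a + int n)} = {\<rho> 0 a, \<rho> n a}" using g(2) by (auto simp: \<rho>_add)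
  have "{x, x + n} = translate n g ` {\<rho> 0 a, \<rho> n a}"
    unfolding eq[symmetric] using g(3,4) by simp
  then show ?thesis using g(1) assms(3) unfolding moved_edges_def by blast
qed

lemma moved_infinity:
  assumes "x < 2 * n" "2 * n \<le> z" "{z, \<rho> 0 a} \<in> edges (H f)" "{z, \<rho> n a} \<in> edges (H f)"
  shows "\<exists>g<n. {z, x} \<in> moved_edges f g"
proof -
  obtain g s where g: "g < n" "s \<in> {0, n}" "translate n g (\<rho> s a) = x"
    using translate_pair[of x x a a] assms(1) by auto
  moreover have "translate n g z = z" using assms(2) by (simp add: translate_def)
  ultimately have "{z, x} = translate n g ` {z, \<rho> s a}" by simp
  moreover have "{z, \<rho> s a} \<in> edges (H f)" using g(2) assms by auto
  ultimately show ?thesis using g(1) unfolding moved_edges_def by blast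
qed

end

text \<open>Up to sign, \<open>1..n - 1\<close> are the differences of all edges between moved
  vertices outside \<open>halves\<close>; the edges of difference \<open>n\<close> and those at
  fixed vertices come from \<open>special\<close>.\<close>

locale covering_starter = starter +
  assumes cover: "\<And>d. 1 \<le> d \<Longrightarrow> d \<le> int n - 1 \<Longrightarrow>
    \<exists>a b. (a, b) \<in> base \<and> (2 * int n dvd b - a - d \<or> 2 * int n dvd a - b - d)"
begin

lemma moved_base_aux:
  assumes "f \<le> 2" "x < 2 * n" "y < 2 * n" "1 \<le> d" "d \<le> int n - 1" "2 * int n dvd int y - int x - d"
  shows "\<exists>g<n. {x, y} \<in> moved_edges f g"
proof -
  obtain a b where ab: "(a, b) \<in> base" "2 * int n dvd b - a - d \<or> 2 * int n dvd a - b - d"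
    using cover assms(4,5) by blast
  have "2 * int n dvd int y - int x - (b - a) \<or> 2 * int n dvd int y - int x - (a - b)"
  proof -
    have "int y - int x - (b - a) = (int y - int x - d) - (b - a - d)"
      "int y - int x - (a - b) = (int y - int x - d) - (a - b - d)" by simp_all
    then show ?thesis using ab(2) dvd_diff[OF assms(6)] by metis
  qed
  then obtain g s a' b' where g: "g < n" "s \<in> {0, n}" "translate n g (\<rho> s a') = x" "translate n g (\<rho> s b') = y"
      "(a', b') = (a, b) \<or> (a', b') = (b, a)"
    using translate_pair[OF assms(2,3)] by metis
  then have "{\<rho> s a', \<rho> s b'} \<in> edges (H f)"
    using base_edges[OF assms(1) ab(1) g(2)] by (auto simp: insert_commute)
  moreover have "{x, y} = translate n g ` {\<rho> s a', \<rho> s b'}" using g by auto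
  ultimately show ?thesis using g(1) unfolding moved_edges_def by blast
qed

lemma moved_base:
  assumes "f \<le> 2" "x < 2 * n" "y < 2 * n" "x \<noteq> y" "{x, y} \<notin> halves"
  shows "\<exists>g<n. {x, y} \<in> moved_edges f g"
proof -
  have aux: "\<exists>g<n. {x, y} \<in> moved_edges f g" if "x < y" "y < 2 * n" "{x, y} \<notin> halves" for x y
  proof (cases "y - x < n")
    case True
    then show ?thesis using that assms(1) by (intro moved_base_aux[of f x y "int y - int x"]) auto
  next
    case False
    have "y \<noteq> x + n" using that by (auto simp: halves_def)
    then have "\<exists>g<n. {y, x} \<in> moved_edges f g"
      using that assms(1) False by (intro moved_base_aux[of f y x "2 * int n + int x - int y"]) auto
    then show ?thesis by (simp add: insert_commute)
  qed
  show ?thesis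
  proof (cases "x < y")
    case False
    then show ?thesis using aux[of y x] assms by (simp add: insert_commute)
  qed (use aux assms in auto)
qed

lemma moved_halves:
  assumes "f < 2" "e \<in> halves"
  shows "\<exists>g<n. e \<in> moved_edges f g"
  using assms special_edges[of f] moved_half[of f _ "last X"] by (fastforce simp: halves_def special_def)

text \<open>For \<open>f = 0\<close> the factor has an edge of difference \<open>n\<close> at either
  end of the path. Each is moved onto \<open>e\<close>; a common translation would identify the two
  edges, although the path ends have distinct residues modulo \<open>n\<close>.\<close>

lemma moved_halves_twice:
  assumes "e \<in> halves"
  shows "2 \<le> card {g \<in> {..<n}. e \<in> moved_edges 0 g}"
proof -
  obtain x where x: "x < n" "e = {x, x + n}" using assms by (auto simp: halves_def)
  obtain g where g: "g < n" "e = translate n g ` {\<rho> 0 (hd X), \<rho> n (hd X)}" "e \<in> moved_edges 0 g"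
    using moved_half[of 0 x "hd X"] special_edges[of 0] x by (auto simp: special_def)
  obtain h where h: "h < n" "e = translate n h ` {\<rho> 0 (last X), \<rho> n (last X)}" "e \<in> moved_edges 0 h"
    using moved_half[of 0 x "last X"] special_edges[of 0] x by (auto simp: special_def)
  have "g \<noteq> h"
  proof
    assume "g = h"
    have inj: "inj_on (translate n g) {..<2 * n}" using bij_translate[of n g 0] n by (simp add: bij_betw_def)
    have "translate n g ` {\<rho> 0 (hd X), \<rho> n (hd X)} = translate n g ` {\<rho> 0 (last X), \<rho> n (last X)}"
      using g(2) h(2) \<open>g = h\<close> by metis
    then have "{\<rho> 0 (hd X), \<rho> n (hd X)} = {\<rho> 0 (last X), \<rho> n (last X)}"
      by (subst (asm) inj_on_image_eq_iff[OF inj]) (use \<rho>_less in auto)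
    then have eq: "\<rho> 0 (hd X) = \<rho> 0 (last X) \<or> \<rho> 0 (hd X) = \<rho> n (last X)" by auto
    have "distinct (big 0)" using distinct_lists[of 0] by (simp add: lists_def)
    then have d: "distinct (map (\<rho> 0) X)" "\<rho> 0 ` set X \<inter> \<rho> n ` set X = {}" by (auto simp: big_def)
    have m: "hd X \<in> set X" "last X \<in> set X" using X_ne by auto
    have "hd X \<noteq> last X"
    proof -
      obtain u v xs where "X = u # v # xs" using X by (cases X; cases "tl X") auto
      then show ?thesis using d(1) by (auto simp: distinct_map)
    qed
    then have "\<rho> 0 (hd X) \<noteq> \<rho> 0 (last X)" using d(1) m by (auto simp: distinct_map inj_on_def)
    then show False using eq d(2) m by auto
  qed
  then have "card {g, h} = 2" by simp
  moreover have "card {g, h} \<le> card {g \<in> {..<n}. e \<in> moved_edges 0 g}"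
    using g h by (intro card_mono) auto
  ultimately show ?thesis by simp
qed

lemma complete_edge_cases:
  assumes "e \<in> complete_edges {..<2 * n + f}" "f \<le> 2"
  obtains x y where "e = {x, y}" "x < 2 * n" "y < 2 * n" "x \<noteq> y"
    | x where "e = {2 * n, x}" "x < 2 * n" "1 \<le> f"
    | x where "e = {2 * n + 1, x}" "x < 2 * n" "f = 2"
    | "e = {2 * n, 2 * n + 1}" "f = 2"
proof -
  obtain a b where ab: "e = {a, b}" "a \<noteq> b" "a < 2 * n + f" "b < 2 * n + f"
    using assms(1) by (auto simp: complete_edges_def card_2_iff)
  obtain x y where xy: "e = {x, y}" "x < y" "y < 2 * n + f"
  proof (cases "a < b")
    case True
    then show thesis using ab that by blast
  next
    case False
    then have "e = {b, a}" "b < a" using ab by auto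
    then show thesis using ab that by blast
  qed
  consider "y < 2 * n" | "y = 2 * n" "1 \<le> f" | "y = 2 * n + 1" "f = 2" using xy assms(2) by linarith
  then show thesis
  proof cases
    case 1 then show ?thesis using that(1) xy by auto
  next
    case 2 then show ?thesis using that(2)[of x] xy by (simp add: insert_commute)
  next
    case 3
    show ?thesis
    proof (cases "x = 2 * n")
      case True
      then have "e = {2 * n, 2 * n + 1}" using xy(1) 3(1) by simp
      then show ?thesis using 3(2) by (rule that(4))
    next
      case False
      then have "e = {2 * n + 1, x}" "x < 2 * n" using xy 3 by auto
      then show ?thesis using 3(2) by (rule that(3))
    qed
  qed
qed

lemma moved_complete:
  assumes "f \<le> 2" "e \<in> complete_edges {..<2 * n + f}"
    and "f = 2 \<Longrightarrow> e \<notin> insert {2 * n, 2 * n + 1} halves"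
  shows "\<exists>g<n. e \<in> moved_edges f g"
  using assms(2,1)
proof (cases rule: complete_edge_cases)
  case (1 x y)
  show ?thesis
  proof (cases "e \<in> halves")
    case True
    then have "f < 2" using assms(1,3) by (cases "f = 2") auto
    then show ?thesis using moved_halves True by blast
  next
    case False
    then show ?thesis using moved_base[of f x y] assms(1) 1 by blast
  qed
next
  case (2 x)
  then show ?thesis using moved_infinity[of x "2 * n" "hd X" f] special_edges[of f] assms(1)
    by (auto simp: special_def)
next
  case (3 x)
  then show ?thesis using moved_infinity[of x "2 * n + 1" "last X" f] special_edges[of f]
    by (auto simp: special_def)
qed (use assms in auto)

lemma finite_edges_H: "finite (edges (H f))"
  unfolding H_def cycle_graph_of_def undirected_def by simp

lemma card_moved_edges: "f \<le> 2 \<Longrightarrow> card (moved_edges f g) \<le> 2 * n + f"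
  using card_image_le[OF finite_edges_H, of "(`) (translate n g)"] card_edges_le[of "lists f"] length_lists[of f]
  unfolding moved_edges_def H_def by (metis le_trans)

text \<open>Each of the \<open>n\<close> factors has at most \<open>2 * n + f\<close> edges, and
  \<open>n * (2 * n + f)\<close> is the size of \<open>M\<close> for all three values of
  \<open>f\<close>.\<close>

lemma sum_moved_edges:
  assumes f: "f \<le> 2" and M: "M = (if f = 0 then mset_set (complete_edges {..<2 * n}) + mset_set halves
      else if f = 1 then mset_set (complete_edges {..<2 * n + 1})
      else mset_set (complete_edges {..<2 * n + 2}) - mset_set (insert {2 * n, 2 * n + 1} halves))"
  shows "(\<Sum>g<n. mset_set (moved_edges f g)) = M"
proof (rule sum_mset_set_eqI)
  show "finite (moved_edges f g)" for g using finite_edges_H by (simp add: moved_edges_def)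
  have fin: "finite (complete_edges {..<2 * n + k})" for k by (simp add: finite_complete_edges)
  have finh: "finite halves" by (simp add: halves_def)
  have sub: "insert {2 * n, 2 * n + 1} halves \<subseteq> complete_edges {..<2 * n + 2}" "halves \<subseteq> complete_edges {..<2 * n}"
    using one_factor_halves_insert one_factor_halves by (auto simp: one_factor_def)
  have one: "1 \<le> card {g \<in> {..<n}. e \<in> moved_edges f g}" if "\<exists>g<n. e \<in> moved_edges f g" for e
    using that by (auto simp: Suc_le_eq card_gt_0_iff)
  have f3: "f = 0 \<or> f = 1 \<or> f = 2" using f by auto
  have M2: "M = mset_set (complete_edges {..<2 * n + 2} - insert {2 * n, 2 * n + 1} halves)" if "f = 2"
    unfolding M using that sub(1) fin[of 2] by (simp add: mset_set_Diff)
  show "count M e \<le> card {g \<in> {..<n}. e \<in> moved_edges f g}" for e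
    using f3
  proof (elim disjE)
    assume [simp]: "f = 0"
    show ?thesis
    proof (cases "e \<in> halves")
      case True
      then show ?thesis using M moved_halves_twice[OF True] fin[of 0] finh by (simp add: count_mset_set')
    next
      case False
      then show ?thesis using M moved_complete[of 0 e] fin[of 0] finh one[of e] by (simp add: count_mset_set')
    qed
  next
    assume [simp]: "f = 1"
    show ?thesis using M moved_complete[of 1 e] fin[of 1] one[of e] by (simp add: count_mset_set')
  next
    assume [simp]: "f = 2"
    show ?thesis using M2 moved_complete[of 2 e] fin[of 2] one[of e] by (simp add: count_mset_set')
  qed
  have "(\<Sum>g<n. card (moved_edges f g)) \<le> (\<Sum>g<n. 2 * n + f)" by (intro sum_mono card_moved_edges f)
  also have "\<dots> = n * (2 * n + f)" by simp
  also have "\<dots> \<le> size M"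
    using f3
  proof (elim disjE)
    assume [simp]: "f = 0"
    have "size M = (2 * n choose 2) + n" using M fin[of 0] finh by (simp add: card_complete_edges card_halves)
    also have "2 * n choose 2 = n * (2 * n - 1)" by (simp add: choose_two)
    finally show ?thesis using n by (simp add: algebra_simps)
  next
    assume [simp]: "f = 1"
    have "size M = (2 * n + 1 choose 2)" using M by (simp add: card_complete_edges)
    also have "\<dots> = n * (2 * n + 1)" by (simp add: choose_two)
    finally show ?thesis by simp
  next
    assume [simp]: "f = 2"
    have "{2 * n, 2 * n + 1} \<notin> halves" by (auto simp: halves_def doubleton_eq_iff)
    then have "card (insert {2 * n, 2 * n + 1} halves) = n + 1" using finh by (simp add: card_halves)
    then have "size M = (2 * n + 2 choose 2) - (n + 1)"
      using M2 sub(1) fin[of 2] finh by (simp add: card_Diff_subset card_complete_edges)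
    also have "(2 * n + 2 choose 2) = (n + 1) * (2 * n + 1)" by (simp add: choose_two)
    finally show ?thesis by (simp add: algebra_simps)
  qed
  finally show "(\<Sum>g<n. card (moved_edges f g)) \<le> size M" .
qed simp

end

lemma graph_image_graph_image: "graph_image a (graph_image b H) = graph_image (\<lambda>x. a (b x)) H"
  by (simp add: graph_image_def image_image)

lemma graph_image_cong:
  assumes "\<And>x. x \<in> verts H \<Longrightarrow> a x = b x" "\<Union> (edges H) \<subseteq> verts H"
  shows "graph_image a H = graph_image b H"
proof -
  have "a ` e = b ` e" if "e \<in> edges H" for e
    using that assms by (intro image_cong) auto
  then show ?thesis using assms(1) by (simp add: graph_image_def)
qed

context covering_starter
begin

definition factor :: "nat \<Rightarrow> nat \<Rightarrow> nat ugraph" where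
  "factor f g = graph_image (translate n g) (H f)"

lemma H_subset: "\<Union> (edges (H f)) \<subseteq> verts (H f)"
  unfolding H_def by (rule edges_subset_verts[OF lists_ne])

lemma verts_factor: "f \<le> 2 \<Longrightarrow> verts (factor f g) = {..<2 * n + f}"
  using bij_translate[of n g f] n by (simp add: factor_def graph_image_def verts_H bij_betw_def)

lemma edges_factor: "edges (factor f g) = moved_edges f g"
  by (simp add: factor_def graph_image_def moved_edges_def)

lemma factor_subset:
  assumes "f \<le> 2" shows "\<Union> (edges (factor f g)) \<subseteq> {..<2 * n + f}"
proof
  fix z assume "z \<in> \<Union> (edges (factor f g))"
  then obtain e x where "e \<in> edges (H f)" "x \<in> e" "z = translate n g x"
    by (auto simp: edges_factor moved_edges_def)
  moreover from this have "x \<in> verts (H f)" using H_subset by blast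
  ultimately show "z \<in> {..<2 * n + f}" using assms n by (simp add: verts_H)
qed

lemma translate_n_edges:
  assumes "f \<le> 2"
  shows "(`) (translate n n) ` edges (H f) = edges (H f)"
proof -
  have i: "(`) (translate n n) ` (`) (\<rho> s) ` A = (`) (\<rho> (s + n)) ` A" for s A
    by (simp add: image_image translate_\<rho>)
  have fixed: "translate n n (2 * n) = 2 * n" "translate n n (Suc (2 * n)) = Suc (2 * n)" by (simp_all add: translate_def)
  have "(`) (translate n n) ` special f = special f"
    by (simp add: special_def image_Un translate_\<rho> \<rho>_add fixed insert_commute)
  moreover have "\<rho> (n + n) = \<rho> 0" using \<rho>_add(2) by (simp add: fun_eq_iff)
  ultimately show ?thesis unfolding edges_H[OF assms] by (simp add: image_Un i Un_commute)
qed

lemma factor_add_n: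
  assumes "f \<le> 2"
  shows "factor f (g + n) = factor f g"
proof -
  have "translate n (g + n) = (\<lambda>x. translate n g (translate n n x))"
    using n by (intro ext, simp add: translate_translate) (simp add: translate_def mod_simps)
  then have "factor f (g + n) = graph_image (translate n g) (graph_image (translate n n) (H f))"
    by (simp add: factor_def graph_image_graph_image)
  also have "graph_image (translate n n) (H f) = H f"
    using verts_factor[of f n] verts_H[of f] translate_n_edges assms
    by (simp add: factor_def graph_image_def)
  finally show ?thesis by (simp add: factor_def)
qed

lemma factor_mod: "f \<le> 2 \<Longrightarrow> factor f (g mod n) = factor f g"
proof -
  assume f: "f \<le> 2"
  have "factor f (j + k * n) = factor f j" for j k
  proof (induction k)
    case (Suc k)
    then show ?case using factor_add_n[OF f, of "j + k * n"] by (simp add: add_ac)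
  qed simp
  from this[of "g mod n" "g div n"] show ?thesis by simp
qed

lemma translate_factor:
  assumes "f \<le> 2"
  shows "graph_image (restrict (translate n a) {..<2 * n + f}) (factor f g) = factor f ((a + g) mod n)"
proof -
  have "graph_image (restrict (translate n a) {..<2 * n + f}) (factor f g) = graph_image (translate n a) (factor f g)"
    using assms factor_subset[OF assms, of g] by (intro graph_image_cong) (auto simp: verts_factor)
  also have "\<dots> = factor f (a + g)"
  proof -
    have "(\<lambda>x. translate n a (translate n g x)) = translate n (a + g)"
      using n by (intro ext, simp add: translate_translate) (simp add: translate_def mod_simps)
    then show ?thesis by (simp add: factor_def graph_image_graph_image)
  qed
  finally show ?thesis using assms by (simp add: factor_mod)
qed

definition factors :: "nat \<Rightarrow> nat ugraph multiset" where
  "factors f = image_mset (factor f) (mset_set {..<n})"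

lemma pyramidal_factors:
  assumes "f \<le> 2"
  shows "pyramidal f {..<2 * n + f} (factors f)"
proof -
  let ?V = "{..<2 * n + f}"
  have n0: "n > 0" using n by simp
  show ?thesis
    unfolding pyramidal_def
  proof (intro exI[of _ "translation_group n f"] conjI)
    show "\<forall>a\<in>translation_group n f. \<forall>K\<in>#factors f. graph_image a K \<in># factors f"
      using n0 by (auto simp: translation_group_def factors_def translate_factor[OF assms])
    show "subgroup (translation_group n f) (BijGroup ?V)" by (rule translation_group_subgroup[OF n0])
    show "card (fixed_points ?V (translation_group n f)) = f"
      by (simp add: fixed_points_translation_group[OF n0])
    show "\<forall>x\<in>?V - fixed_points ?V (translation_group n f). \<forall>y\<in>?V - fixed_points ?V (translation_group n f).
        \<exists>!a. a \<in> translation_group n f \<and> a x = y"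
      unfolding fixed_points_translation_group[OF n0]
      by (intro ballI translation_group_sharply_transitive[OF n0]) auto
  qed
qed

lemma OP_solution_factors:
  assumes "\<sigma> \<in> {-1, 0, 1}" and f: "f = nat (1 - \<sigma>)"
  shows "OP_solution \<sigma> (cycles_graph (map length (lists f))) {..<2 * n + f} (factors f)"
proof -
  have f2: "f \<le> 2" using assms by auto
  define M where "M = (if f = 0 then mset_set (complete_edges {..<2 * n}) + mset_set halves
      else if f = 1 then mset_set (complete_edges {..<2 * n + 1})
      else mset_set (complete_edges {..<2 * n + 2}) - mset_set (insert {2 * n, 2 * n + 1} halves))"
  have sum: "(\<Sum>g<n. mset_set (moved_edges f g)) = M"
    by (rule sum_moved_edges[OF f2 M_def])
  have K: "K_sigma_edges {..<2 * n + f} \<sigma> M"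
    using assms(1)
  proof (elim insertE)
    assume "\<sigma> = -1"
    then show ?thesis using one_factor_halves_insert f by (auto simp: K_sigma_edges_def M_def)
  next
    assume "\<sigma> = 0"
    then show ?thesis using f by (auto simp: K_sigma_edges_def M_def)
  next
    assume "\<sigma> = 1"
    then show ?thesis using one_factor_halves f by (auto simp: K_sigma_edges_def M_def)
  qed simp
  have iso: "graph_iso (factor f g) (cycles_graph (map length (lists f)))" for g
  proof (rule graph_iso_trans)
    show "graph_iso (factor f g) (H f)"
      unfolding factor_def using bij_translate[of n g f] n H_subset[of f] f2
      by (intro graph_iso_image[of _ "{..<2 * n + f}"]) (auto simp: verts_H)
    show "graph_iso (H f) (cycles_graph (map length (lists f)))"
      unfolding H_def by (rule graph_iso_cycles[OF distinct_lists[OF f2] lists_ne])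
  qed
  have sub: "edges (factor f g) \<subseteq> set_mset M" if "g < n" for g
  proof
    fix e assume "e \<in> edges (factor f g)"
    then have "e \<in># mset_set (moved_edges f g)"
      using finite_edges_H by (simp add: edges_factor moved_edges_def)
    then show "e \<in># M" unfolding sum[symmetric] using that
      by (subst set_mset_sum) auto
  qed
  have "(\<Sum>K\<in>#factors f. mset_set (edges K)) = M"
    unfolding factors_def sum[symmetric] by (simp add: image_mset.compositionality o_def edges_factor sum_unfold_sum_mset)
  then show ?thesis
    unfolding OP_solution_def factorization_def using K iso sub
    by (intro exI[of _ M] conjI ballI) (auto simp: factors_def verts_factor f2)
qed

lemma map_length_lists:
  "f \<le> 2 \<Longrightarrow> map length (lists f) = (2 * length X + f) # map (\<lambda>c. 2 * length c) (take r cs)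
     @ concat (map (\<lambda>c. [length c, length c]) (drop r cs))"
  by (auto simp: lists_def big_def map_concat o_def)

end

section \<open>From quotient factors to pyramidal solutions\<close>

text \<open>The steps with distance in \<open>T\<close> are twisted: \<open>N\<close> is added to all later labels.\<close>

fun lift_path :: "int \<Rightarrow> int set \<Rightarrow> int \<Rightarrow> int list \<Rightarrow> int list" where
  "lift_path N T b [] = []"
| "lift_path N T b [x] = [x + b]"
| "lift_path N T b (x # y # zs) = (x + b) # lift_path N T (if \<bar>x - y\<bar> \<in> T then b + N else b) (y # zs)"

lemma lift_path_Cons: "\<exists>ys. lift_path N T b (x # xs) = (x + b) # ys"
  by (cases xs) auto

lemma length_lift_path [simp]: "length (lift_path N T b xs) = length xs"
  by (induction N T b xs rule: lift_path.induct) auto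

lemma lift_path_mod:
  assumes "N dvd b" "x \<in> set xs"
  shows "\<exists>a\<in>set (lift_path N T b xs). a mod N = x mod N"
  using assms
proof (induction N T b xs rule: lift_path.induct)
  case (2 N T b x)
  then show ?case by (auto elim!: dvdE)
next
  case (3 N T b x' y zs)
  show ?case
  proof (cases "x = x'")
    case True
    then show ?thesis using 3 by (auto elim!: dvdE)
  next
    case False
    then show ?thesis using 3 by (auto split: if_splits)
  qed
qed simp

lemma lift_path_step:
  assumes "(x, y) \<in> steps xs"
  shows "\<exists>a c. (a, c) \<in> steps (lift_path N T b xs) \<and> c - a = y - x + (if \<bar>x - y\<bar> \<in> T then N else 0)"
  using assms
proof (induction N T b xs rule: lift_path.induct)
  case (3 N T b x' y' zs)
  obtain ys where ys: "lift_path N T (if \<bar>x' - y'\<bar> \<in> T then b + N else b) (y' # zs) = (y' + (if \<bar>x' - y'\<bar> \<in> T then b + N else b)) # ys"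
    using lift_path_Cons by blast
  show ?case
  proof (cases "(x, y) = (x', y')")
    case True
    then show ?thesis using ys
      by (intro exI[of _ "x' + b"] exI[of _ "y' + (if \<bar>x' - y'\<bar> \<in> T then b + N else b)"]) auto
  next
    case False
    then have "(x, y) \<in> steps (y' # zs)" using 3(2) by auto
    then obtain a c where "(a, c) \<in> steps (lift_path N T (if \<bar>x' - y'\<bar> \<in> T then b + N else b) (y' # zs))"
       "c - a = y - x + (if \<bar>x - y\<bar> \<in> T then N else 0)"
      using 3(1) by blast
    then show ?thesis unfolding lift_path.simps ys steps_Cons2 by blast
  qed
qed auto

text \<open>Adding \<open>N\<close> to a difference of absolute value \<open>t\<close> gives
  \<open>N - t\<close> or \<open>N + t\<close>, and the latter is \<open>- (N - t)\<close> modulo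
  \<open>2 * N\<close>; so the orientation of a twisted step is irrelevant.\<close>

lemma covered_by_step:
  assumes "b - a = y - x + (if tw then N else 0)" "d = (if tw then N - \<bar>x - y\<bar> else \<bar>x - y\<bar>)"
  shows "2 * N dvd b - a - d \<or> 2 * N dvd a - b - (d :: int)"
proof -
  have "b - a - d = 0 \<or> a - b - d = 0 \<or> a - b - d = 2 * N * (-1)"
    using assms by (cases tw; cases "x \<le> y") auto
  then show ?thesis by (metis dvd_0_right dvd_triv_left)
qed

text \<open>The twisted distances are the complements \<open>n - d\<close> for closing steps of
  doubled cycles. Twisting is decided by distance, not by position, so repeated path distances
  change together. Cycles of length 2 are left out because they already realise both
  \<open>d\<close> and \<open>n - d\<close>.\<close>

lemma covering_starter_lift_path:
  assumes q: "quotient_factor n P Cs Ds" and cs: "mset cs = mset (Cs @ Ds)"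
    and Ds: "\<And>c. c \<in> set Ds \<Longrightarrow> length c = 2 \<and> c \<in> set (take r cs)"
    and Cs: "\<And>c. c \<in> set Cs \<Longrightarrow> length c \<noteq> 2" and P: "2 \<le> length P"
  shows "covering_starter n r
    (lift_path (int n) {int n - \<bar>last c - hd c\<bar> | c. c \<in> set (take r cs) \<and> length c \<noteq> 2} 0 P) cs"
proof -
  define T where "T = {int n - \<bar>last c - hd c\<bar> | c. c \<in> set (take r cs) \<and> length c \<noteq> 2}"
  define X where "X = lift_path (int n) T 0 P"
  have t: "tour 0 (int n - 1) ((-) (int n) ` cycle_dists Ds) P (Cs @ Ds)"
    and avoid: "\<And>d. d \<in> cycle_dists Cs \<Longrightarrow> int n - d \<notin> cycle_dists (Cs @ Ds) \<and> d \<notin> cycle_dists Ds"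
    using q unfolding quotient_factor_def by auto
  have set_cs: "set cs = set (Cs @ Ds)" using cs by (rule mset_eq_setD)
  have len: "length P + sum_list (map length cs) = n"
  proof -
    have "sum_list (map length cs) = sum_list (map length (Cs @ Ds))"
      using cs by (metis mset_map sum_mset_sum_list)
    then show ?thesis using t unfolding tour_def by auto
  qed
  have vs: "set P \<union> \<Union> (set ` set cs) = {0..int n - 1}" and ne: "[] \<notin> set cs"
    using t unfolding tour_def set_cs by auto
  interpret starter n r X cs
  proof
    show "2 \<le> n" using len P by simp
    show "2 \<le> length X" "length X + sum_list (map length cs) = n" using P len by (simp_all add: X_def)
    show "[] \<notin> set cs" by (rule ne)
    fix y assume y: "0 \<le> y" "y < int n"
    then have ym: "y mod int n = y" by simp
    have "y \<in> set P \<union> \<Union> (set ` set cs)" unfolding vs using y by simp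
    then show "\<exists>a\<in>set X \<union> \<Union> (set ` set cs). a mod int n = y"
      using lift_path_mod[of "int n" 0 y P T] ym unfolding X_def by (metis UnCI UnE dvd_0_right)
  qed
  define covered where "covered = (\<lambda>d. \<exists>a b. (a, b) \<in> base \<and> (2 * int n dvd b - a - d \<or> 2 * int n dvd a - b - d))"
  have direct: "covered \<bar>x - y\<bar>" if "(x, y) \<in> base" for x y
    unfolding covered_def using that covered_by_step[of y x y x False] by auto
  have path: "covered (if \<bar>x - y\<bar> \<in> T then int n - \<bar>x - y\<bar> else \<bar>x - y\<bar>)" if xy: "(x, y) \<in> steps P" for x y
  proof -
    obtain a c where "(a, c) \<in> steps X" "c - a = y - x + (if \<bar>x - y\<bar> \<in> T then int n else 0)"
      using lift_path_step[OF xy] unfolding X_def by blast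
    then show ?thesis
      unfolding covered_def base_def using covered_by_step[of c a y x "\<bar>x - y\<bar> \<in> T" "int n"] by blast
  qed
  have closing: "covered (int n - \<bar>last c - hd c\<bar>)" and forward: "steps c \<subseteq> base" if c: "c \<in> set (take r cs)" for c
  proof -
    have "c \<noteq> []" using ne c by (auto dest: in_set_takeD)
    then have eq: "steps (c @ [hd c + int n]) = insert (last c, hd c + int n) (steps c)" by (simp add: steps_append)
    then have sub: "insert (last c, hd c + int n) (steps c) \<subseteq> base"
      using c unfolding base_def by blast
    then show "steps c \<subseteq> base" by simp
    show "covered (int n - \<bar>last c - hd c\<bar>)"
      unfolding covered_def
    proof (intro exI conjI)
      show "(last c, hd c + int n) \<in> base" using sub by simp
      show "2 * int n dvd hd c + int n - last c - (int n - \<bar>last c - hd c\<bar>)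
          \<or> 2 * int n dvd last c - (hd c + int n) - (int n - \<bar>last c - hd c\<bar>)"
        by (rule covered_by_step[of _ _ "hd c" "last c" True]) simp_all
    qed
  qed
  \<comment> \<open>A doubled pair \<open>[u, w]\<close> contributes the steps \<open>(u, w)\<close>
    and \<open>(w, u + n)\<close>, which realise complementary distances.\<close>
  have pair: "covered d" "covered (int n - d)" if d: "d \<in> cycle_dists Ds" for d
  proof -
    obtain c x y where c: "c \<in> set Ds" "(x, y) \<in> cycle_steps c" "d = \<bar>x - y\<bar>"
      using d unfolding cycle_dists_def dist_steps_def by auto
    then obtain u w where uw: "c = [u, w]" using Ds[OF c(1)] by (auto simp: length_Suc_conv numeral_2_eq_2)
    then have "d = \<bar>u - w\<bar>" using c by (auto simp: cycle_steps_def)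
    then show "covered d" "covered (int n - d)"
      using direct[of u w] forward[of c] closing[of c] Ds[OF c(1)] uw by (auto simp: abs_minus_commute)
  qed
  have "covered d" if d: "1 \<le> d" "d \<le> int n - 1" for d
  proof -
    have dd: "e \<in> dist_steps (steps P) \<or> e \<in> cycle_dists Cs \<or> e \<in> cycle_dists Ds \<or> int n - e \<in> cycle_dists Ds"
      if "1 \<le> e" "e \<le> int n - 1" for e
    proof -
      have "e \<in> dist_steps (all_steps P (Cs @ Ds)) \<union> (-) (int n) ` cycle_dists Ds"
        using t that unfolding tour_def by auto
      then have "e \<in> dist_steps (steps P) \<union> cycle_dists (Cs @ Ds) \<or> (\<exists>d\<in>cycle_dists Ds. e = int n - d)"
        unfolding dist_all_steps by blast
      then show ?thesis by auto
    qed
    from dd[OF d] show ?thesis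
    proof (elim disjE)
      assume "d \<in> dist_steps (steps P)"
      then obtain x y where xy: "(x, y) \<in> steps P" "d = \<bar>x - y\<bar>" by (auto simp: dist_steps_def)
      show ?thesis
      proof (cases "d \<in> T")
        case True
        then show ?thesis using closing unfolding T_def by auto
      next
        case False
        then show ?thesis using path[OF xy(1)] xy(2) by simp
      qed
    next
      assume dC: "d \<in> cycle_dists Cs"
      then obtain c x y where c: "c \<in> set Cs" "(x, y) \<in> cycle_steps c" "d = \<bar>x - y\<bar>"
        unfolding cycle_dists_def dist_steps_def by auto
      then have cin: "c \<in> set cs" and "c \<noteq> []" using set_cs ne by auto
      have "set cs = set (take r cs) \<union> set (drop r cs)" by (metis append_take_drop_id set_append)
      then consider "c \<in> set (drop r cs)" | "c \<in> set (take r cs)" using cin by blast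
      then show ?thesis
      proof cases
        case 1
        then have "(x, y) \<in> base" using c(2) unfolding base_def by blast
        then show ?thesis using direct c(3) by simp
      next
        case 2
        consider "(x, y) \<in> steps c" | "x = last c" "y = hd c"
          using c(2) \<open>c \<noteq> []\<close> by (auto simp: cycle_steps_eq)
        then show ?thesis
        proof cases
          case 1
          then show ?thesis using direct forward[OF 2] c(3) by blast
        next
          case closed: 2
          then have "int n - d \<in> T" unfolding T_def using 2 Cs[OF c(1)] c(3) by blast
          \<comment> \<open>\<open>avoid\<close> says that \<open>n - d\<close> is on no cycle and
            that \<open>d\<close> is not the distance of a pair, so \<open>n - d\<close> is not
            among the omitted values; only the path remains.\<close>
          moreover have "int n - d \<in> dist_steps (steps P)"
            using dd[of "int n - d"] avoid[OF dC] d by auto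
          then obtain x' y' where xy': "(x', y') \<in> steps P" "\<bar>x' - y'\<bar> = int n - d"
            by (auto simp: dist_steps_def)
          ultimately show ?thesis using path[OF xy'(1)] unfolding xy'(2) by simp
        qed
      qed
    next
      assume "int n - d \<in> cycle_dists Ds"
      then show ?thesis using pair(2)[of "int n - d"] by simp
    qed (rule pair)
  qed
  then show ?thesis
    unfolding T_def[symmetric] X_def[symmetric] by unfold_locales (simp add: covered_def)
qed

lemma mset_map_eq_imp_ex:
  "mset (map f xs) = mset ys \<Longrightarrow> \<exists>zs. mset zs = mset xs \<and> map f zs = ys"
proof (induction ys arbitrary: xs)
  case (Cons y ys)
  then have "y \<in> set (map f xs)" by (metis list.set_intros(1) mset_eq_setD)
  then obtain x where x: "x \<in> set xs" "y = f x" by auto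
  then obtain us ws where xs: "xs = us @ x # ws" by (metis split_list)
  then have "mset (map f (us @ ws)) = mset ys" using Cons.prems x(2) by simp
  then obtain zs where "mset zs = mset (us @ ws)" "map f zs = ys" using Cons.IH by blast
  then show ?case using xs x(2) by (intro exI[of _ "x # zs"]) simp
qed simp

lemma mset_split_lengths:
  assumes "\<forall>x\<in>set ls. 2 \<le> (x :: nat)"
  shows "mset ls = odd_lengths (map (\<lambda>x. x div 2) (filter odd ls)) + mset (filter (\<lambda>x. 2 < x \<and> even x) ls)
    + mset (filter (\<lambda>x. x = 2) ls)"
proof -
  have "map (\<lambda>k. 2 * k + 1) (map (\<lambda>x. x div 2) (filter odd ls)) = filter odd ls"
    unfolding map_map o_def by (intro map_idI) auto
  then have "odd_lengths (map (\<lambda>x. x div 2) (filter odd ls)) = mset (filter odd ls)"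
    unfolding odd_lengths_def by simp
  moreover have "mset ls = mset (filter odd ls) + mset (filter (\<lambda>x. 2 < x \<and> even x) ls) + mset (filter (\<lambda>x. x = 2) ls)"
  proof (rule multiset_eqI)
    fix x
    have "count (mset ls) x = 0 \<or> x = 2 \<or> 2 < x"
      using assms by (cases "x \<in> set ls") (auto simp: not_in_iff[symmetric])
    then show "count (mset ls) x = count (mset (filter odd ls) + mset (filter (\<lambda>x. 2 < x \<and> even x) ls) + mset (filter (\<lambda>x. x = 2) ls)) x"
      by (auto simp: not_in_iff)
  qed
  ultimately show ?thesis by (simp only:)
qed

text \<open>\<open>m\<close> is the number of path labels, which yields the long cycle of length
  \<open>2 * m + f\<close>. The cycles of the quotient factor are reordered to follow
  \<open>ls\<close>, so that exactly the first \<open>r\<close> are doubled; a length 2 can only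
  occur among these.\<close>

lemma OP_pyramidal_solution_exists:
  fixes ls :: "nat list"
  defines "E \<equiv> filter (\<lambda>x. 2 < x \<and> even x) ls" and "Os \<equiv> filter odd ls" and "N \<equiv> filter (\<lambda>x. x = 2) ls"
  assumes ls: "\<forall>x\<in>set ls. 2 \<le> x" "\<forall>x\<in>set (drop r ls). 3 \<le> x" "length N \<le> 1"
    and E: "\<forall>x\<in>set E. x + 3 \<le> M" "1 \<le> A" "E \<noteq> [] \<Longrightarrow> 2 * (length E * M) \<le> A + 1"
    and Os: "\<forall>x\<in>set Os. 2 * x + 1 \<le> L" "3 \<le> Q" "Os \<noteq> [] \<Longrightarrow> 7 ^ (length Os + length N - 1) * L \<le> Q"
    and m: "8 * A + 10 * Q + 14 \<le> m"
    and \<sigma>: "\<sigma> \<in> {-1, 0, 1}" and f: "f = nat (1 - \<sigma>)"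
  shows "\<exists>\<F>. OP_solution \<sigma> (cycles_graph ((2 * m + f) # map (\<lambda>x. 2 * x) (take r ls) @ concat (map (\<lambda>x. [x, x]) (drop r ls))))
      {..<2 * (m + sum_list ls) + f} \<F> \<and> pyramidal f {..<2 * (m + sum_list ls) + f} \<F>"
proof -
  define ks where "ks = map (\<lambda>x. x div 2) Os"
  define n where "n = m + sum_list ls"
  have Nls: "N = [] \<or> N = [2]"
  proof (cases N)
    case (Cons x xs)
    then have "xs = []" using ls(3) by simp
    moreover have "x \<in> set N" using Cons by simp
    then have "x = 2" by (simp add: N_def)
    ultimately show ?thesis using Cons by simp
  qed simp
  have K: "\<exists>K. (\<forall>k\<in>set ks. 0 < k \<and> k \<le> K) \<and> (ks \<noteq> [] \<longrightarrow> 4 * K + 3 \<le> L)"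
  proof (cases "ks = []")
    case False
    let ?K = "Max (set ks)"
    have "?K \<in> set ks" using False by simp
    then obtain x where x: "x \<in> set Os" "?K = x div 2" unfolding ks_def by auto
    then have "odd x" by (simp add: Os_def)
    \<comment> \<open>This is where \<open>4 * K + 3\<close> comes from: with
      \<open>x = 2 * K + 1\<close> it is the term \<open>2 * l i + 1\<close> of
      \<open>h1\<close>.\<close>
    then have "4 * ?K + 3 = 2 * x + 1" unfolding x(2) by (auto elim!: oddE)
    then have "4 * ?K + 3 \<le> L" using Os(1) x(1) by auto
    moreover have "0 < k" if k: "k \<in> set ks" for k
    proof -
      obtain x where "x \<in> set Os" "k = x div 2" using k unfolding ks_def by auto
      then show ?thesis using ls(1) by (auto simp: Os_def)
    qed
    ultimately show ?thesis by (intro exI[of _ ?K]) auto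
  qed simp
  then obtain K where K: "\<forall>k\<in>set ks. 0 < k \<and> k \<le> K" "ks \<noteq> [] \<Longrightarrow> 4 * K + 3 \<le> L" by blast
  have "\<exists>P Cs Ds. quotient_factor n P Cs Ds \<and> mset (map length Cs) = odd_lengths ks + mset E \<and> map length Ds = N"
  proof (rule quotient_factor_exists)
    show "\<forall>l\<in>set E. even l \<and> 4 \<le> l \<and> l \<le> M - 3" using E(1) by (auto simp: E_def elim!: evenE)
    show "\<forall>k\<in>set ks. 0 < k \<and> k \<le> K" by (rule K(1))
    show "1 \<le> A" by (rule E(2))
    show "2 * (length E * (M - 3 + 3)) \<le> A + 1" if "E \<noteq> []"
    proof -
      have "3 \<le> M" using that E(1) by (cases E) auto
      then show ?thesis using E(3)[OF that] by simp
    qed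
    show "3 \<le> Q" by (rule Os(2))
    show "7 ^ (length ks + length N - 1) * (4 * K + 3) \<le> Q" if "ks \<noteq> []"
    proof -
      have "7 ^ (length Os + length N - 1) * (4 * K + 3) \<le> 7 ^ (length Os + length N - 1) * L"
        using K(2)[OF that] by simp
      also have "\<dots> \<le> Q" using Os(3) that by (simp add: ks_def)
      finally show ?thesis by (simp add: ks_def)
    qed
    show "N = [] \<or> N = [2]" by (rule Nls)
    have "sum_list N \<le> sum_list ls" unfolding N_def by (induction ls) auto
    then show "8 * A + 10 * Q + 14 + sum_list N \<le> n" using m unfolding n_def by linarith
  qed
  then obtain P Cs Ds where q: "quotient_factor n P Cs Ds" and Cs: "mset (map length Cs) = odd_lengths ks + mset E"
    and Ds: "map length Ds = N" by blast
  have "mset (map length (Cs @ Ds)) = mset ls"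
    using mset_split_lengths[OF ls(1)] Cs Ds by (simp add: E_def ks_def Os_def N_def)
  then obtain cs where cs: "mset cs = mset (Cs @ Ds)" "map length cs = ls"
    using mset_map_eq_imp_ex by blast
  have lenP: "length P = m"
  proof -
    have "length P + sum_list (map length (Cs @ Ds)) = n"
      using q unfolding quotient_factor_def tour_def by auto
    moreover have "sum_list (map length (Cs @ Ds)) = sum_list ls"
      using cs by (metis mset_map sum_mset_sum_list)
    ultimately show ?thesis by (simp add: n_def)
  qed
  have "covering_starter n r
    (lift_path (int n) {int n - \<bar>last c - hd c\<bar> | c. c \<in> set (take r cs) \<and> length c \<noteq> 2} 0 P) cs"
  proof (rule covering_starter_lift_path[OF q cs(1)])
    fix c assume c: "c \<in> set Ds"
    then have "length c \<in> set N" unfolding Ds[symmetric] by simp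
    then have l2: "length c = 2" using Nls by auto
    moreover have "c \<notin> set (drop r cs)"
    proof
      assume "c \<in> set (drop r cs)"
      then have "length c \<in> set (drop r ls)" unfolding cs(2)[symmetric] drop_map by simp
      then show False using ls(2) l2 by auto
    qed
    moreover have "set cs = set (take r cs) \<union> set (drop r cs)" by (metis append_take_drop_id set_append)
    moreover have "c \<in> set cs" using cs(1) c by (metis UnCI mset_eq_setD set_append)
    ultimately show "length c = 2 \<and> c \<in> set (take r cs)" by blast
  next
    fix c assume "c \<in> set Cs"
    then have "length c \<in># mset (map length Cs)" by simp
    then show "length c \<noteq> 2" unfolding Cs odd_lengths_def E_def by (auto dest: arg_cong[of _ _ even])
  qed (use lenP m in simp)
  then interpret covering_starter n r
    "lift_path (int n) {int n - \<bar>last c - hd c\<bar> | c. c \<in> set (take r cs) \<and> length c \<noteq> 2} 0 P" cs .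
  have f2: "f \<le> 2" using \<sigma> f by auto
  have dl: "map length (lists f) = (2 * m + f) # map (\<lambda>x. 2 * x) (take r ls) @ concat (map (\<lambda>x. [x, x]) (drop r ls))"
    unfolding map_length_lists[OF f2] length_lift_path lenP cs(2)[symmetric] by (simp add: take_map drop_map o_def)
  show ?thesis
    unfolding n_def[symmetric] using OP_solution_factors[OF \<sigma> f, unfolded dl] pyramidal_factors[OF f2] by blast
qed

lemma le_max0: "finite A \<Longrightarrow> x \<in> A \<Longrightarrow> x \<le> max0 A"
  by (auto simp: max0_def)

theorem theorem1p3:
  fixes h r s v :: nat and l :: "nat \<Rightarrow> nat" and F :: "(nat \<times> nat) ugraph"
    and I :: "nat set" and h0 :: int and h1 :: real and \<sigma> :: int
  assumes "r \<le> s"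
    and "h \<ge> 3"
    and "\<forall>i \<in> {1..r}. 2 \<le> l i"
    and "strict_mono_on {1..r} l"
    and "\<forall>j \<in> {r+1..s}. 3 \<le> l j"
    and "F = cycles_graph (F_lengths h r s l)"
    and "v = card (verts F)"
    and "I = {i \<in> {1..s}. l i > 2 \<and> even (l i)}"
    and "h0 = 2 * int (card I) * int (max0 {l i + 3 | i. i \<in> I}) - 1"
    and "h1 = 7 powi (int s - int (card I) - 1)
                * real (max0 {2 * l i + 1 | i. i \<in> {1..s} \<and> i \<notin> I \<and> l i \<noteq> 2})"
    and "real h > 16 * max 1 (of_int h0) + 20 * max 3 h1 + 29"
    and "\<sigma> \<in> {-1, 0, 1}"
    and "[int v - 1 = \<sigma>] (mod 2)"
  shows "\<exists>\<F>. OP_solution \<sigma> F {..<v} \<F> \<and> pyramidal (nat (1 - \<sigma>)) {..<v} \<F>"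
proof -
  define ls where "ls = map l [1..<Suc s]"
  define f where "f = nat (1 - \<sigma>)"
  define E where "E = filter (\<lambda>x. 2 < x \<and> even x) ls"
  define Os where "Os = filter odd ls"
  define N where "N = filter (\<lambda>x. x = 2) ls"
  have l2: "2 \<le> l i" if "i \<in> {1..s}" for i
  proof (cases "i \<le> r")
    case False
    then have "3 \<le> l i" using that assms(5) by auto
    then show ?thesis by simp
  qed (use that assms(3) in auto)
  have set_ls: "set ls = l ` {1..s}" unfolding ls_def by auto
  have ls2: "\<forall>x\<in>set ls. 2 \<le> x" using l2 unfolding set_ls by auto
  have upt: "[1..<Suc s] = [1..<Suc r] @ [Suc r..<Suc s]"
    using assms(1) upt_add_eq_append[of 1 "Suc r" "s - r"] by simp
  have take: "take r ls = map l [1..<Suc r]" and drop: "drop r ls = map l [Suc r..<Suc s]"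
    unfolding ls_def upt by simp_all
  have lengthE: "length E = card I"
  proof -
    have "length E = card ({i. 2 < l i \<and> even (l i)} \<inter> set [1..<Suc s])"
      unfolding E_def ls_def filter_map length_map o_def by (rule distinct_length_filter) simp
    also have "{i. 2 < l i \<and> even (l i)} \<inter> set [1..<Suc s] = I" unfolding assms(8) by auto
    finally show ?thesis .
  qed
  have lengths: "length Os + length N + card I = s"
  proof -
    have "size (mset ls) = length Os + length E + length N"
      unfolding mset_split_lengths[OF ls2] odd_lengths_def by (simp add: E_def Os_def N_def del: mset_filter)
    then show ?thesis by (simp add: lengthE ls_def del: upt_Suc)
  qed
  \<comment> \<open>Length 2 occurs only at indices up to \<open>r\<close>, where \<open>l\<close>
    is injective.\<close>
  have lengthN: "length N \<le> 1"
  proof -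
    have "length N = card ({i. l i = 2} \<inter> set [1..<Suc s])"
      unfolding N_def ls_def filter_map length_map o_def by (rule distinct_length_filter) simp
    moreover have "i = j" if ij: "i \<in> {i. l i = 2} \<inter> set [1..<Suc s]" "j \<in> {i. l i = 2} \<inter> set [1..<Suc s]" for i j
    proof -
      have "k \<in> {1..r}" if "k \<in> {i. l i = 2} \<inter> set [1..<Suc s]" for k
      proof (rule ccontr)
        assume "k \<notin> {1..r}"
        then have "k \<in> {r + 1..s}" using that by (auto simp del: upt_Suc)
        then have "3 \<le> l k" using assms(5) by blast
        then show False using that by simp
      qed
      then have "i \<in> {1..r}" "j \<in> {1..r}" using ij by blast+
      moreover have eq: "l i = l j" using ij by simp
      ultimately show ?thesis using inj_onD[OF strict_mono_on_imp_inj_on[OF assms(4)] eq] by blast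
    qed
    then have "card ({i. l i = 2} \<inter> set [1..<Suc s]) \<le> Suc 0"
      by (subst card_le_Suc0_iff_eq) blast+
    ultimately show ?thesis by simp
  qed
  define M where "M = max0 {l i + 3 | i. i \<in> I}"
  define L where "L = max0 {2 * l i + 1 | i. i \<in> {1..s} \<and> i \<notin> I \<and> l i \<noteq> 2}"
  have finI: "finite I" unfolding assms(8) by simp
  have M: "\<forall>x\<in>set E. x + 3 \<le> M"
  proof
    fix x assume "x \<in> set E"
    then obtain i where "i \<in> I" "x = l i" using set_ls unfolding E_def assms(8) by auto
    then show "x + 3 \<le> M" unfolding M_def using finI by (intro le_max0) auto
  qed
  have L: "\<forall>x\<in>set Os. 2 * x + 1 \<le> L"
  proof
    fix x assume "x \<in> set Os"
    then obtain i where "i \<in> {1..s}" "x = l i" "odd x" using set_ls unfolding Os_def by auto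
    then show "2 * x + 1 \<le> L" unfolding L_def by (intro le_max0) (auto simp: assms(8))
  qed
  define A where "A = (if E = [] then 1 else 2 * (length E * M) - 1)"
  define Q where "Q = (if Os = [] then 3 else 7 ^ (length Os + length N - 1) * L)"
  have ME: "1 \<le> length E * M" if "E \<noteq> []" using M that by (cases E) auto
  have A: "1 \<le> A" "E \<noteq> [] \<Longrightarrow> 2 * (length E * M) \<le> A + 1"
  proof -
    show "1 \<le> A"
    proof (cases "E = []")
      case False
      then have "A = 2 * (length E * M) - 1" by (simp add: A_def)
      then show ?thesis using ME[OF False] by linarith
    qed (simp add: A_def)
  qed (simp add: A_def)
  have "int A = max 1 h0"
  proof (cases "E = []")
    case False
    then have "int A = h0" using ME unfolding assms(9) M_def[symmetric] lengthE[symmetric]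
      by (simp add: A_def of_nat_diff)
    then show ?thesis using A(1) by simp
  qed (use lengthE assms(9) in \<open>simp add: A_def\<close>)
  then have Amax: "real A = max 1 (of_int h0)" by (metis of_int_1 of_int_max of_int_of_nat_eq)
  have Q: "3 \<le> Q" "Os \<noteq> [] \<Longrightarrow> 7 ^ (length Os + length N - 1) * L \<le> Q"
  proof -
    show "3 \<le> Q"
    proof (cases "Os = []")
      case False
      then have o: "hd Os \<in> set Os" by simp
      then have "2 \<le> hd Os" using ls2 by (simp add: Os_def)
      then have "3 \<le> L" using o L by fastforce
      also have "L \<le> 7 ^ (length Os + length N - 1) * L" by simp
      finally show ?thesis using False by (simp add: Q_def)
    qed (simp add: Q_def)
  qed (simp add: Q_def)
  have Qmax: "real Q \<le> max 3 h1"
  proof (cases "Os = []")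
    case False
    \<comment> \<open>The exponent in \<open>h1\<close> counts the odd lengths and a possible length
      2, minus one; it is nonnegative because an odd length exists.\<close>
    then have "int s - int (card I) - 1 = int (length Os + length N - 1)"
      using lengths[symmetric] by (cases Os) auto
    then have "h1 = 7 ^ (length Os + length N - 1) * real L"
      unfolding assms(10) L_def[symmetric] by (simp only: power_int_of_nat)
    then show ?thesis using False by (simp add: Q_def)
  qed (simp add: Q_def)
  have "real h > 16 * real A + 20 * real Q + 29" using assms(11) Amax Qmax by linarith
  then have h: "16 * A + 20 * Q + 29 < h" by linarith
  have f2: "f \<le> 2" "\<sigma> = 1 - int f" using assms(12) by (auto simp: f_def)
  have v: "v = h + 2 * sum_list ls"
  proof -
    have "sum_list (map (\<lambda>x. 2 * x) xs) = 2 * sum_list xs" "sum_list (concat (map (\<lambda>x. [x, x]) xs)) = 2 * sum_list xs" for xs :: "nat list"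
      by (induction xs) auto
    note this[of "map l [1..<Suc r]"] this[of "map l [Suc r..<Suc s]"]
    moreover have "sum_list ls = sum_list (map l [1..<Suc r]) + sum_list (map l [Suc r..<Suc s])"
      unfolding ls_def upt by simp
    ultimately show ?thesis
      unfolding assms(6,7) card_verts_cycles_graph F_lengths_def by (simp add: o_def del: upt_Suc)
  qed
  have "2 dvd int v - 1 - \<sigma>" using assms(13) by (simp add: cong_iff_dvd_diff)
  then have "even (int h - int f)" unfolding v f2(2) by simp
  define m where "m = (h - f) div 2"
  have hm: "h = 2 * m + f"
  proof -
    have "even (h - f)" using \<open>even (int h - int f)\<close> f2(1) h by (simp add: even_diff_nat)
    then show ?thesis using f2(1) h by (auto simp: m_def)
  qed
  have "\<exists>\<F>. OP_solution \<sigma> (cycles_graph ((2 * m + f) # map (\<lambda>x. 2 * x) (take r ls) @ concat (map (\<lambda>x. [x, x]) (drop r ls))))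
      {..<2 * (m + sum_list ls) + f} \<F> \<and> pyramidal f {..<2 * (m + sum_list ls) + f} \<F>"
  proof (rule OP_pyramidal_solution_exists[OF ls2 _ _ _ A(1) _ _ Q(1) _ _ assms(12) f_def])
    show "\<forall>x\<in>set (drop r ls). 3 \<le> x" unfolding drop using assms(5) by auto
    \<comment> \<open>From \<open>16 * A + 20 * Q + 30 \<le> h = 2 * m + f\<close> with
      \<open>f \<le> 2\<close>; this accounts for the 29 in the bound on \<open>h\<close>.\<close>
    show "8 * A + 10 * Q + 14 \<le> m" using h hm f2(1) by linarith
  qed (use lengthN M L A Q in \<open>simp_all add: E_def Os_def N_def\<close>)
  moreover have "(2 * m + f) # map (\<lambda>x. 2 * x) (take r ls) @ concat (map (\<lambda>x. [x, x]) (drop r ls)) = F_lengths h r s l"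
    unfolding F_lengths_def hm take drop by (simp add: o_def del: upt_Suc)
  moreover have "2 * (m + sum_list ls) + f = v" unfolding v hm by simp
  ultimately show ?thesis unfolding assms(6) f_def[symmetric] by simp
qed

end
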